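(* Let $S_\cdot$ be a simplicial set with prismatic triangulation $P_\cdot S_\cdot$. The composition $\lambda=\mathrm{proj}_2\circ\Lambda$ $$\|\,|P_\cdot S_\cdot|\,\|\xrightarrow{\ \Lambda\ }\|\,|S_\cdot|\,\|\xrightarrow{\ \mathrm{proj}_2\ }|S_\cdot|$$ is a homotopy equivalence.
   Context: $\Delta^p$ is the standard $p$-simplex with barycentric coordinates, $\varepsilon^i:\Delta^{p-1}\to\Delta^p$ the coface maps, $\Delta^{q_0\dots q_p}=\Delta^{q_0}\times\dots\times\Delta^{q_p}$, $q=q_0+\dots+q_p$, $Q_i=q_0+\dots+q_{i-1}+i$. The prismatic triangulation of $S$ is given by $P_pS_{q_0,\dots,q_p}=S_{q+p}$ for $p\ge0$, $q_i\ge0$, a $(p+1)$-multi-simplicial set for each $p$ with operators $d^{(i)}_j=d_{Q_i+j}$, lowering $q_i$ by one, and $s^{(i)}_j=s_{Q_i+j}$, raising $q_i$ by one ($0\le i\le p$, $0\le j\le q_i$), and with further face operators $d_{(i)}=d_{Q_i}\circ\dots\circ d_{Q_i+q_i}:P_pS_{q_0,\dots,q_p}\to P_{p-1}S_{q_0,\dots,\hat q_i,\dots,q_p}$ (deleting the $q_i+1$ vertices numbered $Q_i,\dots,Q_i+q_i$). $|P_pS_\cdot|=\bigsqcup_{q_0,\dots,q_p}\Delta^{q_0\dots q_p}\times S_{q+p}/\!\sim$ is the geometric realization of the multi-simplicial set (using the $d^{(i)}_j,s^{(i)}_j$), and $\|\,|P_\cdot S_\cdot|\,\|=\bigsqcup_{p\ge0}\Delta^p\times|P_pS_\cdot|/\!\sim$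 with $(\varepsilon^it,s,\sigma)\sim(t,\mathrm{proj}_is,d_{(i)}\sigma)$, where $\mathrm{proj}_i:\Delta^{q_0\dots q_p}\to\Delta^{q_0\dots\hat q_i\dots q_p}$ deletes the $i$-th factor. $|S_\cdot|$ is the usual geometric realization; $\|\,|S_\cdot|\,\|=\bigsqcup_{p\ge0}\Delta^p\times|S_\cdot|/\!\sim$ with $(\varepsilon^it,x)\sim(t,x)$ is the fat realization of the constant $\Delta$-space $|S_\cdot|$, and $\mathrm{proj}_2(t,x)=x$. The map $\lambda_p:\Delta^p\times|P_pS_\cdot|\to|S_\cdot|$ is $\lambda_p(t,s^0,\dots,s^p,\sigma)=[(t_0s^0,\dots,t_ps^p),\sigma]$, where $(t_0s^0,\dots,t_ps^p)\in\Delta^{q+p}$, and $\Lambda$ is induced by $\Lambda_p(t,s,\sigma)=(t,\lambda_p(t,s,\sigma))$. *)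

theory Defs
  imports "HOL-Homology.Simplices"
begin

section \<open>Quotient spaces and homotopy equivalences\<close>

text \<open>The equivalence relation on the points of \<open>X\<close> generated by \<open>r\<close>, and the quotient of \<open>X\<close>
  by it; the points of the quotient are the equivalence classes.\<close>

definition gen_equiv :: "'a topology \<Rightarrow> ('a \<times> 'a) set \<Rightarrow> ('a \<times> 'a) set" where
  "gen_equiv X r =
     {(x, y). x \<in> topspace X \<and> y \<in> topspace X \<and>
        equivclp (\<lambda>u v. u \<in> topspace X \<and> v \<in> topspace X \<and> (u, v) \<in> r) x y}"

definition quotient_class :: "'a topology \<Rightarrow> ('a \<times> 'a) set \<Rightarrow> 'a \<Rightarrow> 'a set" where
  "quotient_class X r x = gen_equiv X r `` {x}"

definition quotient_space :: "'a topology \<Rightarrow> ('a \<times> 'a) set \<Rightarrow> 'a set topology" where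
  "quotient_space X r =
     topology (\<lambda>U. U \<subseteq> topspace X // gen_equiv X r \<and> openin X (\<Union>U))"

lemma equiv_gen_equiv: "equiv (topspace X) (gen_equiv X r)"
proof (rule equivI)
  show "refl_on (topspace X) (gen_equiv X r)"
    by (auto simp: refl_on_def gen_equiv_def)
  show "sym (gen_equiv X r)"
    by (auto simp: sym_def gen_equiv_def intro: equivclp_sym)
  show "trans (gen_equiv X r)"
    unfolding trans_def gen_equiv_def by (blast intro: equivclp_trans)
  show "gen_equiv X r \<subseteq> topspace X \<times> topspace X"
    by (auto simp: gen_equiv_def)
qed

lemma istopology_quotient_space:
  "istopology (\<lambda>U. U \<subseteq> topspace X // gen_equiv X r \<and> openin X (\<Union>U))"
proof -
  have "\<Union>(U \<inter> V) = \<Union>U \<inter> \<Union>V"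
    if "U \<subseteq> topspace X // gen_equiv X r" "V \<subseteq> topspace X // gen_equiv X r" for U V
  proof
    show "\<Union>U \<inter> \<Union>V \<subseteq> \<Union>(U \<inter> V)"
    proof
      fix x assume "x \<in> \<Union>U \<inter> \<Union>V"
      then obtain A B where "A \<in> U" "B \<in> V" "x \<in> A" "x \<in> B" by blast
      moreover from this have "A = B"
        using that quotient_disj[OF equiv_gen_equiv, of A X r B] by blast
      ultimately show "x \<in> \<Union>(U \<inter> V)" by blast
    qed
  qed blast
  moreover have "openin X (\<Union>(\<Union>\<K>))" if "\<forall>K\<in>\<K>. openin X (\<Union>K)" for \<K>
  proof -
    have "\<Union>(\<Union>\<K>) = \<Union>(Union ` \<K>)" by blast
    then show ?thesis using that by auto
  qed
  ultimately show ?thesis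
    unfolding istopology_def by (auto simp: openin_Int)
qed

lemma openin_quotient_space:
  "openin (quotient_space X r) U \<longleftrightarrow> U \<subseteq> topspace X // gen_equiv X r \<and> openin X (\<Union>U)"
  by (simp add: quotient_space_def topology_inverse'[OF istopology_quotient_space])

lemma topspace_quotient_space: "topspace (quotient_space X r) = topspace X // gen_equiv X r"
proof -
  have "openin (quotient_space X r) (topspace X // gen_equiv X r)"
    by (simp add: openin_quotient_space Union_quotient[OF equiv_gen_equiv])
  then show ?thesis
    by (metis openin_quotient_space openin_subset openin_topspace subset_antisym)
qed

lemma quotient_map_quotient_class:
  "quotient_map X (quotient_space X r) (quotient_class X r)"
proof -
  note E = equiv_gen_equiv[of X r]
  have "{x \<in> topspace X. gen_equiv X r `` {x} \<in> U} = \<Union>U"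
    if "U \<subseteq> topspace X // gen_equiv X r" for U
  proof (intro Set.set_eqI iffI)
    fix x assume "x \<in> {x \<in> topspace X. gen_equiv X r `` {x} \<in> U}"
    then show "x \<in> \<Union>U" using equiv_class_self[OF E] by blast
  next
    fix x assume "x \<in> \<Union>U"
    then obtain A where A: "A \<in> U" "x \<in> A" by blast
    with that have "A \<in> topspace X // gen_equiv X r" by blast
    then obtain y where y: "y \<in> topspace X" "A = gen_equiv X r `` {y}" by (rule quotientE)
    with A have yx: "(y, x) \<in> gen_equiv X r" by blast
    then have "A = gen_equiv X r `` {x}" using y equiv_class_eq[OF E] by simp
    moreover have "x \<in> topspace X" using yx by (auto simp: gen_equiv_def)
    ultimately show "x \<in> {x \<in> topspace X. gen_equiv X r `` {x} \<in> U}" using A by simp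
  qed
  then show ?thesis
    unfolding quotient_map_def topspace_quotient_space
    by (auto simp: quotient_class_def openin_quotient_space quotient_def)
qed

text \<open>The map out of a quotient induced by a map \<open>f\<close> that is constant on equivalence classes.\<close>

definition induced :: "('a \<Rightarrow> 'b) \<Rightarrow> 'a set \<Rightarrow> 'b" where
  "induced f C = the_elem (f ` C)"

definition homotopy_equivalence ::
    "'a topology \<Rightarrow> 'b topology \<Rightarrow> ('a \<Rightarrow> 'b) \<Rightarrow> bool" where
  "homotopy_equivalence X Y f \<longleftrightarrow>
     continuous_map X Y f \<and>
     (\<exists>g. continuous_map Y X g \<and>
          homotopic_with (\<lambda>_. True) X X (g \<circ> f) id \<and>
          homotopic_with (\<lambda>_. True) Y Y (f \<circ> g) id)"


section \<open>Simplicial sets and their geometric realization\<close>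

text \<open>\<open>face X n i\<close> and \<open>degen X n i\<close> are \<open>d\<^sub>i\<close> and \<open>s\<^sub>i\<close> with source \<open>simplices X n\<close>; the sets of
  simplices of different dimensions need not be disjoint.\<close>

record 'a sset =
  simplices :: "nat \<Rightarrow> 'a set"
  face :: "nat \<Rightarrow> nat \<Rightarrow> 'a \<Rightarrow> 'a"
  degen :: "nat \<Rightarrow> nat \<Rightarrow> 'a \<Rightarrow> 'a"

definition simplicial_set :: "'a sset \<Rightarrow> bool" where
  "simplicial_set X \<longleftrightarrow>
     (\<forall>n. \<forall>i\<le>Suc n. \<forall>x\<in>simplices X (Suc n). face X (Suc n) i x \<in> simplices X n) \<and>
     (\<forall>n. \<forall>i\<le>n. \<forall>x\<in>simplices X n. degen X n i x \<in> simplices X (Suc n)) \<and>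
     (\<forall>n i j. \<forall>x\<in>simplices X (Suc (Suc n)). i < j \<and> j \<le> Suc (Suc n) \<longrightarrow>
        face X (Suc n) i (face X (Suc (Suc n)) j x) =
        face X (Suc n) (j - 1) (face X (Suc (Suc n)) i x)) \<and>
     (\<forall>n i j. \<forall>x\<in>simplices X n. i \<le> j \<and> j \<le> n \<longrightarrow>
        degen X (Suc n) i (degen X n j x) = degen X (Suc n) (Suc j) (degen X n i x)) \<and>
     (\<forall>n i j. \<forall>x\<in>simplices X n. i < j \<and> j \<le> n \<longrightarrow>
        face X (Suc n) i (degen X n j x) = degen X (n - 1) (j - 1) (face X n i x)) \<and>
     (\<forall>n i j. \<forall>x\<in>simplices X n. j \<le> n \<and> (i = j \<or> i = Suc j) \<longrightarrow>
        face X (Suc n) i (degen X n j x) = x) \<and>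
     (\<forall>n i j. \<forall>x\<in>simplices X n. Suc j < i \<and> i \<le> Suc n \<longrightarrow>
        face X (Suc n) i (degen X n j x) = degen X (n - 1) j (face X n (i - 1) x))"

abbreviation simplex_top :: "nat \<Rightarrow> (nat \<Rightarrow> real) topology" where
  "simplex_top p \<equiv> subtopology (powertop_real UNIV) (standard_simplex p)"

text \<open>The coface map \<open>\<epsilon>\<^sup>i\<close> is \<^const>\<open>simplical_face\<close>; this is the codegeneracy
  \<open>\<Delta>\<^bsup>n+1\<^esup> \<rightarrow> \<Delta>\<^bsup>n\<^esup>\<close>.\<close>

definition codegen :: "nat \<Rightarrow> (nat \<Rightarrow> real) \<Rightarrow> nat \<Rightarrow> real" where
  "codegen j t = (\<lambda>i. if i < j then t i else if i = j then t j + t (Suc j) else t (Suc i))"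

definition realization_sum :: "'a sset \<Rightarrow> (nat \<times> (nat \<Rightarrow> real) \<times> 'a) topology" where
  "realization_sum X =
     sum_topology (\<lambda>n. prod_topology (simplex_top n) (discrete_topology (simplices X n))) UNIV"

definition realization_rel ::
    "'a sset \<Rightarrow> ((nat \<times> (nat \<Rightarrow> real) \<times> 'a) \<times> (nat \<times> (nat \<Rightarrow> real) \<times> 'a)) set" where
  "realization_rel X =
     {((Suc n, simplical_face i t, x), (n, t, face X (Suc n) i x)) | n i t x.
        i \<le> Suc n \<and> t \<in> standard_simplex n \<and> x \<in> simplices X (Suc n)} \<union>
     {((n, codegen j t, x), (Suc n, t, degen X n j x)) | n j t x.
        j \<le> n \<and> t \<in> standard_simplex (Suc n) \<and> x \<in> simplices X n}"

definition realization :: "'a sset \<Rightarrow> (nat \<times> (nat \<Rightarrow> real) \<times> 'a) set topology" where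
  "realization X = quotient_space (realization_sum X) (realization_rel X)"

definition realization_class ::
    "'a sset \<Rightarrow> nat \<times> (nat \<Rightarrow> real) \<times> 'a \<Rightarrow> (nat \<times> (nat \<Rightarrow> real) \<times> 'a) set" where
  "realization_class X = quotient_class (realization_sum X) (realization_rel X)"


section \<open>Multi-simplicial sets and their geometric realization\<close>

text \<open>Data of a \<open>(p+1)\<close>-multi-simplicial set for every \<open>p\<close> at once: the multi-index
  \<open>(q\<^sub>0,\<dots>,q\<^sub>p)\<close> is a list of length \<open>p+1\<close>, and \<open>mface M q i j\<close>, \<open>mdegen M q i j\<close> are the
  operators \<open>d\<^sup>(\<^sup>i\<^sup>)\<^sub>j\<close>, \<open>s\<^sup>(\<^sup>i\<^sup>)\<^sub>j\<close> with source \<open>msimplices M q\<close>.\<close>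

record 'a msset =
  msimplices :: "nat list \<Rightarrow> 'a set"
  mface :: "nat list \<Rightarrow> nat \<Rightarrow> nat \<Rightarrow> 'a \<Rightarrow> 'a"
  mdegen :: "nat list \<Rightarrow> nat \<Rightarrow> nat \<Rightarrow> 'a \<Rightarrow> 'a"

text \<open>A point \<open>(s\<^sup>0,\<dots>,s\<^sup>p)\<close> of the product of simplices is the extensional function
  \<open>i \<mapsto> s\<^sup>i\<close> on \<open>{..<length q}\<close>.\<close>

abbreviation multi_simplex_top :: "nat list \<Rightarrow> (nat \<Rightarrow> nat \<Rightarrow> real) topology" where
  "multi_simplex_top q \<equiv> product_topology (\<lambda>i. simplex_top (q ! i)) {..<length q}"

type_synonym 'a mpoint = "nat list \<times> (nat \<Rightarrow> nat \<Rightarrow> real) \<times> 'a"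

definition mrealization_sum :: "nat \<Rightarrow> 'a msset \<Rightarrow> 'a mpoint topology" where
  "mrealization_sum p M =
     sum_topology
       (\<lambda>q. prod_topology (multi_simplex_top q) (discrete_topology (msimplices M q)))
       {q. length q = Suc p}"

definition mrealization_rel :: "nat \<Rightarrow> 'a msset \<Rightarrow> ('a mpoint \<times> 'a mpoint) set" where
  "mrealization_rel p M =
     {((q, s(i := simplical_face j (s i)), x), (q[i := q ! i - 1], s, mface M q i j x))
        | q i j s x.
        length q = Suc p \<and> i \<le> p \<and> 0 < q ! i \<and> j \<le> q ! i \<and>
        s \<in> topspace (multi_simplex_top (q[i := q ! i - 1])) \<and> x \<in> msimplices M q} \<union>
     {((q, s(i := codegen j (s i)), x), (q[i := Suc (q ! i)], s, mdegen M q i j x))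
        | q i j s x.
        length q = Suc p \<and> i \<le> p \<and> j \<le> q ! i \<and>
        s \<in> topspace (multi_simplex_top (q[i := Suc (q ! i)])) \<and> x \<in> msimplices M q}"

definition mrealization :: "nat \<Rightarrow> 'a msset \<Rightarrow> 'a mpoint set topology" where
  "mrealization p M = quotient_space (mrealization_sum p M) (mrealization_rel p M)"

definition mrealization_class :: "nat \<Rightarrow> 'a msset \<Rightarrow> 'a mpoint \<Rightarrow> 'a mpoint set" where
  "mrealization_class p M = quotient_class (mrealization_sum p M) (mrealization_rel p M)"


section \<open>Fat realization of a \<open>\<Delta>\<close>-space\<close>

text \<open>The \<open>\<Delta>\<close>-space has spaces \<open>Y p\<close> and face maps \<open>\<delta> p i : Y p \<rightarrow> Y (p - 1)\<close>.\<close>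

definition fat_sum :: "(nat \<Rightarrow> 'b topology) \<Rightarrow> (nat \<times> (nat \<Rightarrow> real) \<times> 'b) topology" where
  "fat_sum Y = sum_topology (\<lambda>p. prod_topology (simplex_top p) (Y p)) UNIV"

definition fat_rel ::
    "(nat \<Rightarrow> 'b topology) \<Rightarrow> (nat \<Rightarrow> nat \<Rightarrow> 'b \<Rightarrow> 'b) \<Rightarrow>
     ((nat \<times> (nat \<Rightarrow> real) \<times> 'b) \<times> (nat \<times> (nat \<Rightarrow> real) \<times> 'b)) set" where
  "fat_rel Y \<delta> =
     {((Suc p, simplical_face i t, y), (p, t, \<delta> (Suc p) i y)) | p i t y.
        i \<le> Suc p \<and> t \<in> standard_simplex p \<and> y \<in> topspace (Y (Suc p))}"

definition fat_realization ::
    "(nat \<Rightarrow> 'b topology) \<Rightarrow> (nat \<Rightarrow> nat \<Rightarrow> 'b \<Rightarrow> 'b) \<Rightarrow>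
     (nat \<times> (nat \<Rightarrow> real) \<times> 'b) set topology" where
  "fat_realization Y \<delta> = quotient_space (fat_sum Y) (fat_rel Y \<delta>)"

definition fat_class ::
    "(nat \<Rightarrow> 'b topology) \<Rightarrow> (nat \<Rightarrow> nat \<Rightarrow> 'b \<Rightarrow> 'b) \<Rightarrow>
     nat \<times> (nat \<Rightarrow> real) \<times> 'b \<Rightarrow> (nat \<times> (nat \<Rightarrow> real) \<times> 'b) set" where
  "fat_class Y \<delta> = quotient_class (fat_sum Y) (fat_rel Y \<delta>)"


section \<open>The prismatic triangulation\<close>

text \<open>\<open>prism_offset q i\<close> is \<open>Q\<^sub>i = q\<^sub>0 + \<dots> + q\<^bsub>i-1\<^esub> + i\<close>, and \<open>prism_dim q\<close> is
  \<open>q\<^sub>0 + \<dots> + q\<^sub>p + p\<close>.\<close>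

definition prism_offset :: "nat list \<Rightarrow> nat \<Rightarrow> nat" where
  "prism_offset q i = sum_list (take i q) + i"

definition prism_dim :: "nat list \<Rightarrow> nat" where
  "prism_dim q = sum_list q + (length q - 1)"

definition prismatic :: "'a sset \<Rightarrow> 'a msset" where
  "prismatic X =
     \<lparr> msimplices = (\<lambda>q. simplices X (prism_dim q)),
       mface = (\<lambda>q i j. face X (prism_dim q) (prism_offset q i + j)),
       mdegen = (\<lambda>q i j. degen X (prism_dim q) (prism_offset q i + j)) \<rparr>"

text \<open>\<open>face_block X n a m = d\<^sub>a \<circ> d\<^bsub>a+1\<^esub> \<circ> \<dots> \<circ> d\<^bsub>a+m-1\<^esub>\<close>
  on \<open>n\<close>-simplices, the rightmost operator acting first.\<close>

primrec face_block :: "'a sset \<Rightarrow> nat \<Rightarrow> nat \<Rightarrow> nat \<Rightarrow> 'a \<Rightarrow> 'a" where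
  "face_block X n a 0 x = x"
| "face_block X n a (Suc m) x = face_block X (n - 1) a m (face X n (a + m) x)"

definition delete_nth :: "nat \<Rightarrow> nat list \<Rightarrow> nat list" where
  "delete_nth i q = take i q @ drop (Suc i) q"

text \<open>As \<open>s\<close> is extensional, so is the shifted function.\<close>

definition proj_delete :: "nat \<Rightarrow> (nat \<Rightarrow> nat \<Rightarrow> real) \<Rightarrow> nat \<Rightarrow> nat \<Rightarrow> real" where
  "proj_delete i s = (\<lambda>k. if k < i then s k else s (Suc k))"

text \<open>The \<open>\<Delta>\<close>-space \<open>p \<mapsto> |P\<^sub>pX|\<close> with face maps induced by \<open>(s, \<sigma>) \<mapsto> (proj\<^sub>i s, d\<^sub>(\<^sub>i\<^sub>) \<sigma>)\<close>.\<close>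

definition prism_space :: "'a sset \<Rightarrow> nat \<Rightarrow> 'a mpoint set topology" where
  "prism_space X p = mrealization p (prismatic X)"

definition prism_space_face ::
    "'a sset \<Rightarrow> nat \<Rightarrow> nat \<Rightarrow> 'a mpoint set \<Rightarrow> 'a mpoint set" where
  "prism_space_face X p i =
     induced (\<lambda>(q, s, x).
       mrealization_class (p - 1) (prismatic X)
         (delete_nth i q, proj_delete i s,
          face_block X (prism_dim q) (prism_offset q i) (Suc (q ! i)) x))"

definition fat_prism ::
    "'a sset \<Rightarrow> (nat \<times> (nat \<Rightarrow> real) \<times> 'a mpoint set) set topology" where
  "fat_prism X = fat_realization (prism_space X) (prism_space_face X)"


section \<open>The maps \<open>\<Lambda>\<close> and \<open>proj\<^sub>2\<close>\<close>

text \<open>The point \<open>(t\<^sub>0s\<^sup>0,\<dots>,t\<^sub>ps\<^sup>p)\<close>: its coordinate number \<open>Q\<^sub>i + j\<close> is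
  \<open>t\<^sub>i s\<^sup>i\<^sub>j\<close> for \<open>j \<le> q\<^sub>i\<close>.\<close>

definition prism_join ::
    "nat list \<Rightarrow> (nat \<Rightarrow> real) \<Rightarrow> (nat \<Rightarrow> nat \<Rightarrow> real) \<Rightarrow> nat \<Rightarrow> real" where
  "prism_join q t s k =
     (\<Sum>i<length q.
        if prism_offset q i \<le> k \<and> k \<le> prism_offset q i + q ! i
        then t i * s i (k - prism_offset q i) else 0)"

definition prism_lambda ::
    "'a sset \<Rightarrow> (nat \<Rightarrow> real) \<Rightarrow> 'a mpoint set \<Rightarrow> (nat \<times> (nat \<Rightarrow> real) \<times> 'a) set" where
  "prism_lambda X t =
     induced (\<lambda>(q, s, x). realization_class X (prism_dim q, prism_join q t s, x))"

definition prism_Lambda ::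
    "'a sset \<Rightarrow> (nat \<times> (nat \<Rightarrow> real) \<times> 'a mpoint set) set \<Rightarrow>
     (nat \<times> (nat \<Rightarrow> real) \<times> (nat \<times> (nat \<Rightarrow> real) \<times> 'a) set) set" where
  "prism_Lambda X =
     induced (\<lambda>(p, t, c).
       fat_class (\<lambda>_. realization X) (\<lambda>_ _. id) (p, t, prism_lambda X t c))"

definition fat_proj2 :: "(nat \<times> (nat \<Rightarrow> real) \<times> 'b) set \<Rightarrow> 'b" where
  "fat_proj2 = induced (\<lambda>(p, t, y). y)"

end

theory Submission
  imports Defs "HOL-Analysis.Abstract_Topological_Spaces"
begin

text \<open>Over a point \<open>t\<close> of the open simplex, \<open>\<lambda>\<^sub>p(t, -)\<close> is a bijection \<open>|P\<^sub>pS| \<rightarrow> |S|\<close>: it is the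
  homeomorphism of an edgewise subdivision. Hence \<open>\<Lambda>\<close> is a bijection. It is moreover a quotient map,
  because each cell of the target is the union of finitely many compact images of prisms. So \<open>\<Lambda>\<close> is a
  homeomorphism, and it remains to contract the fat realization of the constant \<open>\<Delta>\<close>-space \<open>|S|\<close> to
  \<open>|S|\<close> by coning off, \<open>t \<mapsto> ((1-u)t, u)\<close>.

  Injectivity and the quotient property are both shown by induction on \<open>p\<close>. Merging the last two blocks,
  \<open>(s\<^sup>p, s\<^bsup>p+1\<^esup>) \<mapsto> (c s\<^sup>p, (1-c) s\<^bsup>p+1\<^esup>)\<close>, factors \<open>\<lambda>\<^bsub>p+1\<^esub>\<close> through \<open>\<lambda>\<^sub>p\<close>; for \<open>0 < c < 1\<close> merging
  is undone by splitting the last block at height \<open>c\<close>, which doubles the vertex whose barycentric interval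
  contains \<open>c\<close> and so needs just one degeneracy operator.\<close>

section \<open>Quotients, sums and products of topological spaces\<close>

text \<open>A quotient map times an identity need not be a quotient map, and
  \<open>realization X\<close> need not be locally compact. Quotient maps are therefore multiplied
  only by simplices and by \<open>[0,1]\<close>, and the passage from \<open>[0,1]\<close> times the
  \<open>p\<close>-simplex to the \<open>Suc p\<close>-simplex is a proper map, which tolerates an
  arbitrary further factor.

  Bijectivity and topology are kept apart. Over the boundary of the simplex the maps \<lambda> are
  far from injective, so no continuous inverse is sought: splitting only has to be well defined on
  classes, and no continuity of it enters. Injectivity uses merging for \<open>0 < c < 1\<close>;
  the quotient property uses it for all \<open>c\<close> in \<open>[0,1]\<close>, since at the ends
  merging is still onto although it can no longer be undone.

  Injectivity over open simplices is enough for \<open>prism_Lambda\<close>: each point of a fat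
  realization has a representative with positive simplex coordinates, and in the target the list of
  nonzero coordinates is an invariant of the point.\<close>

lemma quotient_class_eq:
  assumes "(x, y) \<in> r" "x \<in> topspace X" "y \<in> topspace X"
  shows "quotient_class X r x = quotient_class X r y"
proof -
  have "(x, y) \<in> gen_equiv X r"
    using assms by (auto simp: gen_equiv_def intro!: r_into_equivclp)
  then show ?thesis
    unfolding quotient_class_def by (rule equiv_class_eq[OF equiv_gen_equiv])
qed

lemma gen_equiv_respects:
  assumes "(x, y) \<in> gen_equiv X r"
    and "\<And>u v. u \<in> topspace X \<Longrightarrow> v \<in> topspace X \<Longrightarrow> (u, v) \<in> r \<Longrightarrow> f u = f v"
  shows "f x = f y"
proof -
  have "equivclp (\<lambda>u v. u \<in> topspace X \<and> v \<in> topspace X \<and> (u, v) \<in> r) x y"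
    using assms(1) by (simp add: gen_equiv_def)
  then show ?thesis
    by (induction rule: equivclp_induct) (use assms(2) in metis)+
qed

text \<open>Equalities of classes are exploited only through invariants \<open>f\<close> of the
  relation, namely \<open>one_block_class\<close>, \<open>split_map\<close> and, for the fat
  realization, \<open>support_list\<close>; the generated relation never has to be analysed.\<close>

lemma quotient_class_eqD:
  assumes "quotient_class X r x = quotient_class X r y" "x \<in> topspace X" "y \<in> topspace X"
    and "\<And>u v. u \<in> topspace X \<Longrightarrow> v \<in> topspace X \<Longrightarrow> (u, v) \<in> r \<Longrightarrow> f u = f v"
  shows "f x = f y"
proof -
  have "(x, y) \<in> gen_equiv X r"
    using eq_equiv_class[OF _ equiv_gen_equiv] assms(1,3) unfolding quotient_class_def by metis
  then show ?thesis using assms(4) by (rule gen_equiv_respects)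
qed

text \<open>The image of a class under an invariant \<open>f\<close> is a singleton, so
  \<open>the_elem\<close> is meaningful. Every map out of a realization is evaluated on
  representatives this way.\<close>

lemma induced_quotient_class:
  assumes "x \<in> topspace X"
    and "\<And>u v. u \<in> topspace X \<Longrightarrow> v \<in> topspace X \<Longrightarrow> (u, v) \<in> r \<Longrightarrow> f u = f v"
  shows "induced f (quotient_class X r x) = f x"
proof -
  have "f ` quotient_class X r x = {f x}"
  proof
    show "f ` quotient_class X r x \<subseteq> {f x}"
    proof
      fix z assume "z \<in> f ` quotient_class X r x"
      then obtain y where y: "(x, y) \<in> gen_equiv X r" "z = f y"
        unfolding quotient_class_def by blast
      then show "z \<in> {f x}"
        using gen_equiv_respects[of x y X r f] assms(2) by auto
    qed
    show "{f x} \<subseteq> f ` quotient_class X r x"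
      using equiv_class_self[OF equiv_gen_equiv assms(1)] unfolding quotient_class_def by blast
  qed
  then show ?thesis by (simp add: induced_def)
qed

lemma topspace_quotient_space_image:
  "topspace (quotient_space X r) = quotient_class X r ` topspace X"
  using quotient_map_quotient_class unfolding quotient_map_def by metis

section \<open>Products with sums and with discrete factors\<close>

text \<open>Products distribute over sums because each injection \<open>Pair i\<close> is an open
  map: a box inside one summand remains open in the sum.\<close>

lemma openin_prod_sum_topology:
  assumes "W \<subseteq> topspace (prod_topology T (sum_topology X I))"
    and "\<And>i. i \<in> I \<Longrightarrow> openin (prod_topology T (X i)) {(t, y). (t, i, y) \<in> W}"
  shows "openin (prod_topology T (sum_topology X I)) W"
proof (subst openin_prod_topology_alt, intro allI impI)
  fix t z assume tz: "(t, z) \<in> W"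
  obtain i y where z: "z = (i, y)" by fastforce
  have i: "i \<in> I" using tz z assms(1) by auto
  have "(t, y) \<in> {(t, y). (t, i, y) \<in> W}" using tz z by simp
  then obtain U V where UV: "openin T U" "openin (X i) V" "t \<in> U" "y \<in> V"
      "U \<times> V \<subseteq> {(t, y). (t, i, y) \<in> W}"
    using assms(2)[OF i] unfolding openin_prod_topology_alt by metis
  have "openin (sum_topology X I) (Pair i ` V)"
    using open_map_component_injection[OF i] UV(2) unfolding open_map_def by blast
  then show "\<exists>U V. openin T U \<and> openin (sum_topology X I) V \<and> t \<in> U \<and> z \<in> V \<and> U \<times> V \<subseteq> W"
    using UV z by (intro exI[of _ U] exI[of _ "Pair i ` V"]) auto
qed

lemma openin_prod_discrete_topology:
  assumes "W \<subseteq> topspace (prod_topology T (prod_topology A (discrete_topology D)))"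
    and "\<And>x. x \<in> D \<Longrightarrow> openin (prod_topology T A) {(t, s). (t, s, x) \<in> W}"
  shows "openin (prod_topology T (prod_topology A (discrete_topology D))) W"
proof (subst openin_prod_topology_alt, intro allI impI)
  fix t z assume tz: "(t, z) \<in> W"
  obtain s x where z: "z = (s, x)" by fastforce
  have x: "x \<in> D" using tz z assms(1) by auto
  have "(t, s) \<in> {(t, s). (t, s, x) \<in> W}" using tz z by simp
  then obtain U V where UV: "openin T U" "openin A V" "t \<in> U" "s \<in> V"
      "U \<times> V \<subseteq> {(t, s). (t, s, x) \<in> W}"
    using assms(2)[OF x] unfolding openin_prod_topology_alt by metis
  have "openin (prod_topology A (discrete_topology D)) (V \<times> {x})"
    using UV(2) x by (simp add: openin_prod_Times_iff)
  then show "\<exists>U V. openin T U \<and> openin (prod_topology A (discrete_topology D)) V \<and>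
      t \<in> U \<and> z \<in> V \<and> U \<times> V \<subseteq> W"
    using UV z by (intro exI[of _ U] exI[of _ "V \<times> {x}"]) auto
qed

lemma continuous_map_prod_sum_topology:
  assumes "\<And>i. i \<in> I \<Longrightarrow> continuous_map (prod_topology T (X i)) Z (\<lambda>(t, y). f (t, i, y))"
  shows "continuous_map (prod_topology T (sum_topology X I)) Z f"
  unfolding continuous_map_def
proof (intro conjI allI impI)
  show f: "f \<in> topspace (prod_topology T (sum_topology X I)) \<rightarrow> topspace Z"
    using assms by (auto simp: continuous_map_def Pi_iff)
  fix U assume U: "openin Z U"
  show "openin (prod_topology T (sum_topology X I))
          {x \<in> topspace (prod_topology T (sum_topology X I)). f x \<in> U}"
  proof (rule openin_prod_sum_topology)
    fix i assume i: "i \<in> I"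
    have "openin (prod_topology T (X i))
            {x \<in> topspace (prod_topology T (X i)). (\<lambda>(t, y). f (t, i, y)) x \<in> U}"
      using assms[OF i] U by (rule openin_continuous_map_preimage)
    also have "{x \<in> topspace (prod_topology T (X i)). (\<lambda>(t, y). f (t, i, y)) x \<in> U} =
        {(t, y). (t, i, y) \<in> {x \<in> topspace (prod_topology T (sum_topology X I)). f x \<in> U}}"
      using i by auto
    finally show "openin (prod_topology T (X i)) \<dots>" .
  qed auto
qed

lemma continuous_map_prod_discrete_topology:
  assumes "\<And>x. x \<in> D \<Longrightarrow> continuous_map (prod_topology T A) Z (\<lambda>(t, s). f (t, s, x))"
  shows "continuous_map (prod_topology T (prod_topology A (discrete_topology D))) Z f"
  unfolding continuous_map_def
proof (intro conjI allI impI)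
  show f: "f \<in> topspace (prod_topology T (prod_topology A (discrete_topology D))) \<rightarrow> topspace Z"
    using assms by (auto simp: continuous_map_def Pi_iff)
  fix U assume U: "openin Z U"
  show "openin (prod_topology T (prod_topology A (discrete_topology D)))
          {x \<in> topspace (prod_topology T (prod_topology A (discrete_topology D))). f x \<in> U}"
  proof (rule openin_prod_discrete_topology)
    fix x assume x: "x \<in> D"
    have "openin (prod_topology T A)
            {y \<in> topspace (prod_topology T A). (\<lambda>(t, s). f (t, s, x)) y \<in> U}"
      using assms[OF x] U by (rule openin_continuous_map_preimage)
    also have "{y \<in> topspace (prod_topology T A). (\<lambda>(t, s). f (t, s, x)) y \<in> U} =
        {(t, s). (t, s, x) \<in> {x \<in> topspace (prod_topology T (prod_topology A (discrete_topology D))). f x \<in> U}}"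
      using x by auto
    finally show "openin (prod_topology T A) \<dots>" .
  qed auto
qed

text \<open>The complement is tested with the two openness criteria. In the intended use a slice is
  a single prism times \<open>T\<close>, where compactness arguments are available.\<close>

lemma closedin_prod_sum_discrete:
  fixes A :: "'i \<Rightarrow> 'b topology" and I :: "'i set" and D :: "'i \<Rightarrow> 'c set" and T :: "'t topology"
  defines "P \<equiv> prod_topology T (sum_topology (\<lambda>i. prod_topology (A i) (discrete_topology (D i))) I)"
  assumes W: "W \<subseteq> topspace P"
    and cl: "\<And>i x. i \<in> I \<Longrightarrow> x \<in> D i \<Longrightarrow> closedin (prod_topology T (A i)) {(t, s). (t, i, s, x) \<in> W}"
  shows "closedin P W"
proof -
  have "openin P (topspace P - W)"
    unfolding P_def
  proof (rule openin_prod_sum_topology)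
    fix i assume i: "i \<in> I"
    show "openin (prod_topology T (prod_topology (A i) (discrete_topology (D i))))
        {(t, y). (t, i, y) \<in> topspace
           (prod_topology T (sum_topology (\<lambda>i. prod_topology (A i) (discrete_topology (D i))) I)) - W}"
    proof (rule openin_prod_discrete_topology)
      fix x assume x: "x \<in> D i"
      have "openin (prod_topology T (A i)) (topspace (prod_topology T (A i)) - {(t, s). (t, i, s, x) \<in> W})"
        using cl[OF i x] by blast
      also have "topspace (prod_topology T (A i)) - {(t, s). (t, i, s, x) \<in> W} =
        {(t, s). (t, s, x) \<in> {(t, y). (t, i, y) \<in> topspace
           (prod_topology T (sum_topology (\<lambda>i. prod_topology (A i) (discrete_topology (D i))) I)) - W}}"
        using i x by auto
      finally show "openin (prod_topology T (A i)) \<dots>" .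
    qed (use i in auto)
  qed (auto simp: P_def)
  then show ?thesis using W by (simp add: closedin_def)
qed

lemma quotient_map_sum_topology:
  assumes "\<And>i. i \<in> I \<Longrightarrow> quotient_map (X i) (Y i) (f i)"
  shows "quotient_map (sum_topology X I) (sum_topology Y I) (\<lambda>(i, x). (i, f i x))"
proof -
  have eq: "openin (X i) {x \<in> topspace (X i). f i x \<in> U} \<longleftrightarrow> openin (Y i) U"
    if "i \<in> I" "U \<subseteq> topspace (Y i)" for i U
    using assms that by (simp add: quotient_map_def)
  have im: "f i ` topspace (X i) = topspace (Y i)" if "i \<in> I" for i
    using assms that by (simp add: quotient_map_def)
  have "openin (sum_topology X I)
          {x \<in> topspace (sum_topology X I). (\<lambda>(i, x). (i, f i x)) x \<in> U} \<longleftrightarrow>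
        openin (sum_topology Y I) U" if U: "U \<subseteq> topspace (sum_topology Y I)" for U
  proof -
    have "{x. (i, x) \<in> {x \<in> topspace (sum_topology X I). (\<lambda>(i, x). (i, f i x)) x \<in> U}} =
        {x \<in> topspace (X i). f i x \<in> {y. (i, y) \<in> U}}" if "i \<in> I" for i
      using that by auto
    moreover have "{y. (i, y) \<in> U} \<subseteq> topspace (Y i)" if "i \<in> I" for i
      using U by auto
    ultimately show ?thesis
      using U eq unfolding openin_sum_topology by (intro conj_cong ball_cong) (auto simp del: mem_Collect_eq)
  qed
  moreover have "(\<lambda>(i, x). (i, f i x)) ` topspace (sum_topology X I) = topspace (sum_topology Y I)"
    using im by (fastforce simp: image_iff)
  ultimately show ?thesis unfolding quotient_map_def by blast
qed

lemma compact_space_simplex_top: "compact_space (simplex_top p)"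
  using compactin_standard_simplex by (simp add: compact_space_subtopology)

lemma Hausdorff_space_simplex_top: "Hausdorff_space (simplex_top p)"
  by (simp add: Hausdorff_space_subtopology Hausdorff_space_product_topology)

lemma compact_space_multi_simplex_top: "compact_space (multi_simplex_top q)"
  by (simp add: compact_space_product_topology compact_space_simplex_top)

lemma Hausdorff_space_multi_simplex_top: "Hausdorff_space (multi_simplex_top q)"
  by (simp add: Hausdorff_space_product_topology Hausdorff_space_simplex_top)

text \<open>Local compactness of the extra factor is what preserves the quotient property.
  \<open>Z\<close> will always be a simplex or \<open>[0,1]\<close>.\<close>

lemma quotient_map_prod_compact_Hausdorff:
  assumes "compact_space Z" "Hausdorff_space Z" "quotient_map X Y f"
  shows "quotient_map (prod_topology Z X) (prod_topology Z Y) (\<lambda>(z, x). (z, f x))"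
  using assms by (intro quotient_map_prod_right) (auto simp: compact_imp_locally_compact_space)

section \<open>Coordinates of joined points\<close>

lemma standard_simplexI:
  assumes "\<And>i. 0 \<le> x i" "\<And>i. p < i \<Longrightarrow> x i = 0" "(\<Sum>i\<le>p. x i) = 1"
  shows "x \<in> standard_simplex p"
proof -
  have "x i \<le> 1" for i
  proof (cases "i \<le> p")
    case True
    have "x i \<le> (\<Sum>i\<le>p. x i)" using True assms(1) by (intro member_le_sum) auto
    then show ?thesis using assms(3) by simp
  qed (use assms(2)[of i] in auto)
  then show ?thesis using assms by (auto simp: standard_simplex_def)
qed

lemma standard_simplexD:
  assumes "x \<in> standard_simplex p"
  shows "0 \<le> x i" "p < i \<Longrightarrow> x i = 0" "(\<Sum>i\<le>p. x i) = 1" "(\<Sum>i<Suc p. x i) = 1"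
  using assms by (auto simp: standard_simplex_def lessThan_Suc_atMost)

lemma simplical_face_standard_simplex:
  "i \<le> Suc p \<Longrightarrow> t \<in> standard_simplex p \<Longrightarrow> simplical_face i t \<in> standard_simplex (Suc p)"
  by (rule simplical_face_in_standard_simplex) auto

lemma sum_atMost_split:
  fixes f :: "nat \<Rightarrow> 'a::comm_monoid_add"
  shows "j \<le> Suc n \<Longrightarrow> sum f {..n} = sum f {..<j} + sum f {j..n}"
  by (subst sum.union_disjoint[symmetric]) (auto intro!: sum.cong)

lemma codegen_standard_simplex:
  assumes "j \<le> n" "t \<in> standard_simplex (Suc n)"
  shows "codegen j t \<in> standard_simplex n"
proof (rule standard_simplexI)
  note t = standard_simplexD[OF assms(2)]
  show "0 \<le> codegen j t i" for i using t(1) by (simp add: codegen_def)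
  show "codegen j t i = 0" if "n < i" for i using t(2) that assms(1) by (auto simp: codegen_def)
  have "(\<Sum>i\<le>n. codegen j t i) = (\<Sum>i<j. codegen j t i) + (\<Sum>i=j..n. codegen j t i)"
    using assms(1) by (intro sum_atMost_split) auto
  also have "(\<Sum>i=j..n. codegen j t i) = codegen j t j + (\<Sum>i=Suc j..n. codegen j t i)"
    using assms(1) by (simp add: sum.atLeast_Suc_atMost)
  also have "(\<Sum>i=Suc j..n. codegen j t i) = (\<Sum>i=Suc j..n. t (Suc i))"
    by (intro sum.cong) (auto simp: codegen_def)
  also have "\<dots> = (\<Sum>i=Suc (Suc j)..Suc n. t i)"
    using sum.shift_bounds_cl_Suc_ivl[of t "Suc j" n] by simp
  also have "(\<Sum>i<j. codegen j t i) = (\<Sum>i<j. t i)"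
    by (intro sum.cong) (auto simp: codegen_def)
  also have "(\<Sum>i<j. t i) + (codegen j t j + (\<Sum>i=Suc (Suc j)..Suc n. t i)) = (\<Sum>i<j. t i) + (\<Sum>i=j..Suc n. t i)"
    using assms(1) by (simp add: codegen_def sum.atLeast_Suc_atMost del: sum.cl_ivl_Suc)
  also have "\<dots> = (\<Sum>i\<le>Suc n. t i)"
    using assms(1) by (intro sum_atMost_split[symmetric]) auto
  finally show "(\<Sum>i\<le>n. codegen j t i) = 1" using t(3) by simp
qed


lemma prism_offset_0 [simp]: "prism_offset q 0 = 0"
  by (simp add: prism_offset_def)

lemma prism_offset_Suc:
  "i < length q \<Longrightarrow> prism_offset q (Suc i) = Suc (prism_offset q i + q ! i)"
  by (simp add: prism_offset_def take_Suc_conv_app_nth)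

text \<open>Past the last block the offset counts all vertices, one more than the dimension. On the
  empty list the subtraction in \<open>prism_dim\<close> truncates and the equation fails.\<close>

lemma prism_offset_length: "q \<noteq> [] \<Longrightarrow> prism_offset q (length q) = Suc (prism_dim q)"
  by (cases q) (auto simp: prism_offset_def prism_dim_def)

lemma prism_offset_mono: "i \<le> l \<Longrightarrow> prism_offset q i \<le> prism_offset q l"
proof -
  assume "i \<le> l"
  then obtain d where "l = i + d" using le_Suc_ex by blast
  then show ?thesis by (simp add: prism_offset_def take_add)
qed

lemma prism_offset_less:
  assumes "i < l" "i < length q"
  shows "prism_offset q i + q ! i < prism_offset q l"
proof -
  have "prism_offset q (Suc i) \<le> prism_offset q l" using assms by (intro prism_offset_mono) auto
  then show ?thesis using prism_offset_Suc[OF assms(2)] by simp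
qed

text \<open>Together with \<open>prism_offset_less\<close> this makes the blocks a partition of the
  vertices into consecutive intervals; the induction peels off the last interval.\<close>

lemma prism_offset_cover:
  "m \<le> length q \<Longrightarrow> k < prism_offset q m \<Longrightarrow> \<exists>i<m. \<exists>j\<le>q ! i. k = prism_offset q i + j"
proof (induction m)
  case (Suc m)
  show ?case
  proof (cases "k < prism_offset q m")
    case True
    with Suc obtain i j where "i < m" "j \<le> q ! i" "k = prism_offset q i + j" by auto
    then show ?thesis by (intro exI[of _ i]) auto
  next
    case False
    have "k = prism_offset q m + (k - prism_offset q m)" using False by simp
    moreover have "k - prism_offset q m \<le> q ! m"
      using Suc.prems False prism_offset_Suc[of m q] by simp
    ultimately show ?thesis by blast
  qed
qed simp

lemma prism_offset_le_dim:
  assumes "i < length q" "j \<le> q ! i"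
  shows "prism_offset q i + j \<le> prism_dim q"
proof -
  have "prism_offset q i + q ! i < prism_offset q (length q)"
    using assms by (intro prism_offset_less) auto
  then show ?thesis using assms prism_offset_length[of q] by (cases "q = []") auto
qed

text \<open>Blocks are disjoint, so a vertex meets the condition of only one summand: the sum in
  \<open>prism_join\<close> is a case distinction in disguise.\<close>

lemma prism_join_nth:
  assumes "i < length q" "j \<le> q ! i"
  shows "prism_join q t s (prism_offset q i + j) = t i * s i j"
proof -
  let ?k = "prism_offset q i + j"
  have "prism_offset q l \<le> ?k \<and> ?k \<le> prism_offset q l + q ! l \<longleftrightarrow> l = i" if "l < length q" for l
    using prism_offset_less[of l i q] prism_offset_less[of i l q] that assms
    by (cases l i rule: linorder_cases) auto
  then have "prism_join q t s ?k = (\<Sum>l<length q. if l = i then t i * s i j else 0)"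
    unfolding prism_join_def by (intro sum.cong) auto
  then show ?thesis using assms by simp
qed

lemma prism_join_beyond:
  assumes "prism_offset q (length q) \<le> k"
  shows "prism_join q t s k = 0"
proof -
  have "\<not> k \<le> prism_offset q l + q ! l" if "l < length q" for l
    using prism_offset_less[of l "length q" q] that assms by auto
  then show ?thesis unfolding prism_join_def by (intro sum.neutral) auto
qed

text \<open>All identities between joined points are reduced to this blockwise criterion, which
  leaves only offsets to compare.\<close>

lemma prism_join_eqI:
  assumes "\<And>i j. i < length q \<Longrightarrow> j \<le> q ! i \<Longrightarrow> f (prism_offset q i + j) = t i * s i j"
    and "\<And>k. prism_offset q (length q) \<le> k \<Longrightarrow> f k = 0"
  shows "prism_join q t s = f"
proof
  fix k
  show "prism_join q t s k = f k"
  proof (cases "k < prism_offset q (length q)")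
    case True
    then obtain i j where "i < length q" "j \<le> q ! i" "k = prism_offset q i + j"
      using prism_offset_cover[OF order_refl True] by blast
    then show ?thesis using prism_join_nth assms(1) by simp
  qed (use assms(2) prism_join_beyond in auto)
qed

lemma sum_prism_join:
  "m \<le> length q \<Longrightarrow>
    (\<Sum>k<prism_offset q m. prism_join q t s k) = (\<Sum>i<m. t i * (\<Sum>j\<le>q ! i. s i j))"
proof (induction m)
  case (Suc m)
  have m: "m < length q" using Suc.prems by simp
  let ?a = "prism_offset q m"
  have "(\<Sum>k<prism_offset q (Suc m). prism_join q t s k) =
      (\<Sum>k<?a. prism_join q t s k) + (\<Sum>k=?a..?a + q ! m. prism_join q t s k)"
    unfolding prism_offset_Suc[OF m] lessThan_Suc_atMost by (intro sum_atMost_split) auto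
  also have "(\<Sum>k=?a..?a + q ! m. prism_join q t s k) = (\<Sum>j\<le>q ! m. prism_join q t s (?a + j))"
    using sum.shift_bounds_cl_nat_ivl[of "prism_join q t s" 0 ?a "q ! m"]
    by (simp add: add.commute atLeast0AtMost)
  also have "\<dots> = (\<Sum>j\<le>q ! m. t m * s m j)"
    using prism_join_nth[OF m] by (intro sum.cong) auto
  finally show ?case using Suc by (simp add: sum_distrib_left)
qed simp

lemma prism_join_in_simplex:
  assumes "length q = Suc p" "t \<in> standard_simplex p" "s \<in> topspace (multi_simplex_top q)"
  shows "prism_join q t s \<in> standard_simplex (prism_dim q)"
proof (rule standard_simplexI)
  have s: "s i \<in> standard_simplex (q ! i)" if "i < length q" for i
    using that assms(3) by (auto simp: PiE_iff)
  have q: "q \<noteq> []" using assms(1) by auto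
  note t = standard_simplexD[OF assms(2)]
  show "0 \<le> prism_join q t s k" for k
    unfolding prism_join_def by (intro sum_nonneg) (auto simp: t(1) standard_simplexD(1)[OF s])
  show "prism_join q t s k = 0" if "prism_dim q < k" for k
    using that q by (intro prism_join_beyond) (auto simp: prism_offset_length)
  have "(\<Sum>k\<le>prism_dim q. prism_join q t s k) = (\<Sum>k<prism_offset q (length q). prism_join q t s k)"
    using q by (simp add: prism_offset_length lessThan_Suc_atMost)
  also have "\<dots> = (\<Sum>i<length q. t i * (\<Sum>j\<le>q ! i. s i j))"
    by (rule sum_prism_join) simp
  also have "\<dots> = (\<Sum>i<length q. t i)"
    using standard_simplexD(3)[OF s] by (intro sum.cong) auto
  also have "\<dots> = 1" using t(4) assms(1) by simp
  finally show "(\<Sum>k\<le>prism_dim q. prism_join q t s k) = 1" .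
qed

text \<open>The shift is stated additively so that it serves both \<open>v = q ! i - 1\<close> and
  \<open>v = Suc (q ! i)\<close> without natural subtraction.\<close>

lemma prism_offset_update:
  assumes "i < length q"
  shows "l \<le> i \<Longrightarrow> prism_offset (q[i := v]) l = prism_offset q l"
    and "i < l \<Longrightarrow> prism_offset (q[i := v]) l + q ! i = prism_offset q l + v"
proof -
  show "prism_offset (q[i := v]) l = prism_offset q l" if "l \<le> i"
    using that by (simp add: prism_offset_def)
  show "prism_offset (q[i := v]) l + q ! i = prism_offset q l + v" if "i < l"
  proof -
    obtain d where "l = Suc (i + d)" using \<open>i < l\<close> less_iff_Suc_add by auto
    then have "prism_offset (q[i := v]) l + q ! i = prism_offset q l + v" 
      using assms
    proof (induction d arbitrary: l)
      case 0
      then show ?case by (simp add: prism_offset_def take_Suc_conv_app_nth)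
    next
      case (Suc d)
      show ?case
      proof (cases "Suc (i + d) < length q")
        case True
        then show ?thesis using Suc by (simp add: prism_offset_Suc)
      next
        \<comment> \<open>Past the end of the list \<open>take\<close> is saturated, and only the
          summand \<open>l\<close> of the offset grows, equally on both sides.\<close>
        case False
        then have "take (Suc (Suc (i + d))) q = take (Suc (i + d)) q"
          "take (Suc (Suc (i + d))) (q[i := v]) = take (Suc (i + d)) (q[i := v])" by simp_all
        then show ?thesis using Suc.IH[OF refl] Suc.prems by (simp add: prism_offset_def)
      qed
    qed
    then show ?thesis .
  qed
qed

lemma prism_dim_update:
  assumes "i < length q"
  shows "prism_dim (q[i := v]) + q ! i = prism_dim q + v"
  using prism_offset_update(2)[OF assms assms, of v] assms prism_offset_length[of q]
    prism_offset_length[of "q[i := v]"]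
  by (cases "q = []") auto

text \<open>All coordinates of block \<open>i\<close> carry the same factor \<open>t i\<close>, so a
  zero inserted into \<open>s i\<close> is a zero inserted into the join at the corresponding global
  position.\<close>

lemma prism_join_simplical_face:
  assumes i: "i < length q" and pos: "0 < q ! i" and j: "j \<le> q ! i"
  shows "prism_join q t (s(i := simplical_face j (s i))) =
    simplical_face (prism_offset q i + j) (prism_join (q[i := q ! i - 1]) t s)"
proof (rule prism_join_eqI)
  let ?q = "q[i := q ! i - 1]"
  let ?F = "simplical_face (prism_offset q i + j) (prism_join ?q t s)"
  fix l j' assume l: "l < length q" and j': "j' \<le> q ! l"
  \<comment> \<open>Blocks before \<open>i\<close> have the same offset in both lists; blocks after
    \<open>i\<close> start one vertex later in \<open>q\<close> than in the shortened list.\<close>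
  consider "l < i" | "l = i" "j' < j" | "l = i" "j' = j" | "l = i" "j < j'" | "i < l" by linarith
  then show "?F (prism_offset q l + j') = t l * (s(i := simplical_face j (s i))) l j'"
  proof cases
    case 1
    moreover have "prism_offset q l + j' < prism_offset q i" using prism_offset_less[OF 1 l] j' by simp
    moreover have "prism_join ?q t s (prism_offset ?q l + j') = t l * s l j'"
      using 1 l j' by (intro prism_join_nth) auto
    ultimately show ?thesis
      using prism_offset_update(1)[OF i, of l] by (simp add: simplical_face_def)
  next
    case 2
    moreover have "prism_join ?q t s (prism_offset ?q i + j') = t i * s i j'"
      using 2 i j by (intro prism_join_nth) auto
    ultimately show ?thesis
      using prism_offset_update(1)[OF i, of i] by (simp add: simplical_face_def)
  next
    case 3
    then show ?thesis by (simp add: simplical_face_def)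
  next
    case 4
    moreover have "prism_join ?q t s (prism_offset ?q i + (j' - 1)) = t i * s i (j' - 1)"
      using 4 i j' by (intro prism_join_nth) auto
    ultimately show ?thesis
      using prism_offset_update(1)[OF i, of i] by (simp add: simplical_face_def)
  next
    case 5
    moreover have lt: "prism_offset q i + q ! i < prism_offset q l" using prism_offset_less[OF 5 i] .
    moreover have "prism_join ?q t s (prism_offset ?q l + j') = t l * s l j'"
      using 5 l j' by (intro prism_join_nth) auto
    moreover have "prism_offset ?q l = prism_offset q l - 1"
      using prism_offset_update(2)[OF i 5, of "q ! i - 1"] pos by simp
    ultimately show ?thesis using j by (simp add: simplical_face_def)
  qed
next
  let ?q = "q[i := q ! i - 1]"
  fix k assume k: "prism_offset q (length q) \<le> k"
  have "prism_offset ?q (length q) = prism_offset q (length q) - 1"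
    using prism_offset_update(2)[OF i i, of "q ! i - 1"] pos by simp
  moreover have "prism_offset q i + q ! i < prism_offset q (length q)"
    by (rule prism_offset_less[OF i i])
  ultimately show "simplical_face (prism_offset q i + j) (prism_join ?q t s) k = 0"
    using k j prism_join_beyond[of ?q "k - 1" t s] by (simp add: simplical_face_def)
qed

text \<open>The two coordinates added by the codegeneracy share the factor \<open>t i\<close>, so
  they may be added before or after joining.\<close>

lemma prism_join_codegen:
  assumes i: "i < length q" and j: "j \<le> q ! i"
  shows "prism_join q t (s(i := codegen j (s i))) =
    codegen (prism_offset q i + j) (prism_join (q[i := Suc (q ! i)]) t s)"
proof (rule prism_join_eqI)
  let ?q = "q[i := Suc (q ! i)]"
  let ?F = "codegen (prism_offset q i + j) (prism_join ?q t s)"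
  have nth: "prism_join ?q t s (prism_offset q i + j') = t i * s i j'" if "j' \<le> Suc (q ! i)" for j'
    using prism_join_nth[of i ?q j' t s] that i prism_offset_update(1)[OF i, of i] by simp
  fix l j' assume l: "l < length q" and j': "j' \<le> q ! l"
  consider "l < i" | "l = i" "j' < j" | "l = i" "j' = j" | "l = i" "j < j'" | "i < l" by linarith
  then show "?F (prism_offset q l + j') = t l * (s(i := codegen j (s i))) l j'"
  proof cases
    case 1
    moreover have "prism_offset q l + j' < prism_offset q i" using prism_offset_less[OF 1 l] j' by simp
    moreover have "prism_join ?q t s (prism_offset ?q l + j') = t l * s l j'"
      using 1 l j' by (intro prism_join_nth) auto
    ultimately show ?thesis
      using prism_offset_update(1)[OF i, of l] by (simp add: codegen_def)
  next
    case 2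
    then show ?thesis using nth[of j'] j' by (simp add: codegen_def)
  next
    case 3
    then show ?thesis using nth[of j] nth[of "Suc j"] j by (simp add: codegen_def distrib_left)
  next
    case 4
    then show ?thesis using nth[of "Suc j'"] j' by (simp add: codegen_def)
  next
    case 5
    moreover have lt: "prism_offset q i + q ! i < prism_offset q l" using prism_offset_less[OF 5 i] .
    moreover have "prism_join ?q t s (prism_offset ?q l + j') = t l * s l j'"
      using 5 l j' by (intro prism_join_nth) auto
    moreover have "prism_offset ?q l = Suc (prism_offset q l)"
      using prism_offset_update(2)[OF i 5, of "Suc (q ! i)"] by simp
    ultimately show ?thesis using j by (simp add: codegen_def)
  qed
next
  let ?q = "q[i := Suc (q ! i)]"
  fix k assume k: "prism_offset q (length q) \<le> k"
  have "prism_offset ?q (length q) = Suc (prism_offset q (length q))"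
    using prism_offset_update(2)[OF i i, of "Suc (q ! i)"] by simp
  moreover have "prism_offset q i + q ! i < prism_offset q (length q)"
    by (rule prism_offset_less[OF i i])
  ultimately show "codegen (prism_offset q i + j) (prism_join ?q t s) k = 0"
    using k j prism_join_beyond[of ?q "Suc k" t s] by (simp add: codegen_def)
qed

section \<open>The maps \<open>\<lambda>\<^sub>p\<close>\<close>

lemma simplicial_setD:
  assumes "simplicial_set X"
  shows face_in: "\<And>n i x. i \<le> Suc n \<Longrightarrow> x \<in> simplices X (Suc n) \<Longrightarrow> face X (Suc n) i x \<in> simplices X n"
    and degen_in: "\<And>n i x. i \<le> n \<Longrightarrow> x \<in> simplices X n \<Longrightarrow> degen X n i x \<in> simplices X (Suc n)"
    and degen_degen: "\<And>n i j x. x \<in> simplices X n \<Longrightarrow> i \<le> j \<Longrightarrow> j \<le> n \<Longrightarrow>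
        degen X (Suc n) i (degen X n j x) = degen X (Suc n) (Suc j) (degen X n i x)"
    and face_degen_less: "\<And>n i j x. x \<in> simplices X n \<Longrightarrow> i < j \<Longrightarrow> j \<le> n \<Longrightarrow>
        face X (Suc n) i (degen X n j x) = degen X (n - 1) (j - 1) (face X n i x)"
    and face_degen_eq: "\<And>n i j x. x \<in> simplices X n \<Longrightarrow> j \<le> n \<Longrightarrow> i = j \<or> i = Suc j \<Longrightarrow>
        face X (Suc n) i (degen X n j x) = x"
    and face_degen_greater: "\<And>n i j x. x \<in> simplices X n \<Longrightarrow> Suc j < i \<Longrightarrow> i \<le> Suc n \<Longrightarrow>
        face X (Suc n) i (degen X n j x) = degen X (n - 1) j (face X n (i - 1) x)"
proof -
  note X = assms[unfolded simplicial_set_def]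
  note X2 = conjunct2[OF X]
  note X3 = conjunct2[OF X2]
  note X4 = conjunct2[OF X3]
  note X5 = conjunct2[OF X4]
  note X6 = conjunct2[OF X5]
  note X7 = conjunct2[OF X6]
  fix n i j x
  show "i \<le> Suc n \<Longrightarrow> x \<in> simplices X (Suc n) \<Longrightarrow> face X (Suc n) i x \<in> simplices X n"
    using conjunct1[OF X] by blast
  show "i \<le> n \<Longrightarrow> x \<in> simplices X n \<Longrightarrow> degen X n i x \<in> simplices X (Suc n)"
    using conjunct1[OF X2] by blast
  show "x \<in> simplices X n \<Longrightarrow> i \<le> j \<Longrightarrow> j \<le> n \<Longrightarrow>
        degen X (Suc n) i (degen X n j x) = degen X (Suc n) (Suc j) (degen X n i x)"
    using conjunct1[OF X4] by blast
  show "x \<in> simplices X n \<Longrightarrow> i < j \<Longrightarrow> j \<le> n \<Longrightarrow>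
        face X (Suc n) i (degen X n j x) = degen X (n - 1) (j - 1) (face X n i x)"
    using conjunct1[OF X5] by blast
  show "x \<in> simplices X n \<Longrightarrow> j \<le> n \<Longrightarrow> i = j \<or> i = Suc j \<Longrightarrow>
        face X (Suc n) i (degen X n j x) = x"
    using conjunct1[OF X6] by blast
  show "x \<in> simplices X n \<Longrightarrow> Suc j < i \<Longrightarrow> i \<le> Suc n \<Longrightarrow>
        face X (Suc n) i (degen X n j x) = degen X (n - 1) j (face X n (i - 1) x)"
    using X7 by blast
qed

lemma mem_realization_sum [simp]:
  "(n, t, x) \<in> topspace (realization_sum X) \<longleftrightarrow> t \<in> standard_simplex n \<and> x \<in> simplices X n"
  by (simp add: realization_sum_def)

lemma mem_mrealization_sum:
  "(q, s, x) \<in> topspace (mrealization_sum p M) \<longleftrightarrow>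
     length q = Suc p \<and> s \<in> topspace (multi_simplex_top q) \<and> x \<in> msimplices M q"
  by (simp add: mrealization_sum_def)

lemma mem_prismatic_sum [simp]:
  "(q, s, x) \<in> topspace (mrealization_sum p (prismatic X)) \<longleftrightarrow>
     length q = Suc p \<and> s \<in> topspace (multi_simplex_top q) \<and> x \<in> simplices X (prism_dim q)"
  by (simp add: mem_mrealization_sum prismatic_def)

lemma realization_class_face:
  assumes "simplicial_set X" "i \<le> Suc n" "t \<in> standard_simplex n" "x \<in> simplices X (Suc n)"
  shows "realization_class X (Suc n, simplical_face i t, x) = realization_class X (n, t, face X (Suc n) i x)"
  unfolding realization_class_def
proof (rule quotient_class_eq)
  show "((Suc n, simplical_face i t, x), (n, t, face X (Suc n) i x)) \<in> realization_rel X"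
    using assms unfolding realization_rel_def by blast
qed (use assms in \<open>simp_all add: simplical_face_standard_simplex face_in\<close>)

lemma realization_class_degen:
  assumes "simplicial_set X" "j \<le> n" "t \<in> standard_simplex (Suc n)" "x \<in> simplices X n"
  shows "realization_class X (n, codegen j t, x) = realization_class X (Suc n, t, degen X n j x)"
  unfolding realization_class_def
proof (rule quotient_class_eq)
  show "((n, codegen j t, x), (Suc n, t, degen X n j x)) \<in> realization_rel X"
    using assms unfolding realization_rel_def by blast
qed (use assms in \<open>simp_all add: codegen_standard_simplex degen_in\<close>)

lemma mrealization_class_eq:
  assumes "(u, v) \<in> mrealization_rel p M" "u \<in> topspace (mrealization_sum p M)"
    "v \<in> topspace (mrealization_sum p M)"
  shows "mrealization_class p M u = mrealization_class p M v"
  using assms unfolding mrealization_class_def by (rule quotient_class_eq)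

lemma multi_simplex_fun_upd:
  assumes "s \<in> topspace (multi_simplex_top (q[i := v]))" "i < length q" "y \<in> standard_simplex (q ! i)"
  shows "s(i := y) \<in> topspace (multi_simplex_top q)"
  using assms by (force simp: PiE_iff extensional_def nth_list_update split: if_splits)

lemma mrealization_class_face:
  assumes X: "simplicial_set X" and q: "length q = Suc p" "i \<le> p" "0 < q ! i" "j \<le> q ! i"
    and s: "s \<in> topspace (multi_simplex_top (q[i := q ! i - 1]))"
    and x: "x \<in> simplices X (prism_dim q)"
  shows "mrealization_class p (prismatic X) (q, s(i := simplical_face j (s i)), x) =
    mrealization_class p (prismatic X) (q[i := q ! i - 1], s, face X (prism_dim q) (prism_offset q i + j) x)"
proof (rule mrealization_class_eq)
  have i: "i < length q" using q by simp
  show "((q, s(i := simplical_face j (s i)), x),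
      (q[i := q ! i - 1], s, face X (prism_dim q) (prism_offset q i + j) x))
      \<in> mrealization_rel p (prismatic X)"
    using assms unfolding mrealization_rel_def prismatic_def by auto
  have "s i \<in> standard_simplex (q ! i - 1)" using s i by (force simp: PiE_iff)
  then have "simplical_face j (s i) \<in> standard_simplex (q ! i)"
    using q simplical_face_standard_simplex[of j "q ! i - 1" "s i"] by simp
  then have "s(i := simplical_face j (s i)) \<in> topspace (multi_simplex_top q)"
    using s i by (intro multi_simplex_fun_upd)
  then show "(q, s(i := simplical_face j (s i)), x) \<in> topspace (mrealization_sum p (prismatic X))"
    using q x by (simp del: topspace_product_topology)
  have "prism_dim q = Suc (prism_dim (q[i := q ! i - 1]))"
    using prism_dim_update[OF i, of "q ! i - 1"] q by simp
  moreover have "prism_offset q i + j \<le> prism_dim q"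
    using prism_offset_le_dim[OF i q(4)] .
  ultimately show "(q[i := q ! i - 1], s, face X (prism_dim q) (prism_offset q i + j) x)
      \<in> topspace (mrealization_sum p (prismatic X))"
    using q s x face_in[OF X] by (simp del: topspace_product_topology)
qed

lemma mrealization_class_degen:
  assumes X: "simplicial_set X" and q: "length q = Suc p" "i \<le> p" "j \<le> q ! i"
    and s: "s \<in> topspace (multi_simplex_top (q[i := Suc (q ! i)]))"
    and x: "x \<in> simplices X (prism_dim q)"
  shows "mrealization_class p (prismatic X) (q, s(i := codegen j (s i)), x) =
    mrealization_class p (prismatic X) (q[i := Suc (q ! i)], s, degen X (prism_dim q) (prism_offset q i + j) x)"
proof (rule mrealization_class_eq)
  have i: "i < length q" using q by simp
  show "((q, s(i := codegen j (s i)), x),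
      (q[i := Suc (q ! i)], s, degen X (prism_dim q) (prism_offset q i + j) x))
      \<in> mrealization_rel p (prismatic X)"
    using assms unfolding mrealization_rel_def prismatic_def by auto
  have "s i \<in> standard_simplex (Suc (q ! i))" using s i by (force simp: PiE_iff)
  then have "codegen j (s i) \<in> standard_simplex (q ! i)"
    using q codegen_standard_simplex by blast
  then have "s(i := codegen j (s i)) \<in> topspace (multi_simplex_top q)"
    using s i by (intro multi_simplex_fun_upd)
  then show "(q, s(i := codegen j (s i)), x) \<in> topspace (mrealization_sum p (prismatic X))"
    using q x by (simp del: topspace_product_topology)
  have "prism_dim (q[i := Suc (q ! i)]) = Suc (prism_dim q)"
    using prism_dim_update[OF i, of "Suc (q ! i)"] q by simp
  moreover have "prism_offset q i + j \<le> prism_dim q"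
    using prism_offset_le_dim[OF i q(3)] .
  ultimately show "(q[i := Suc (q ! i)], s, degen X (prism_dim q) (prism_offset q i + j) x)
      \<in> topspace (mrealization_sum p (prismatic X))"
    using q s x degen_in[OF X] by (simp del: topspace_product_topology)
qed

text \<open>After joining, an operator of block \<open>i\<close> becomes the operator with global
  index \<open>prism_offset q i + j\<close>, exactly as in \<open>prismatic\<close>; hence a
  generating pair goes to a generating pair of the realization.\<close>

lemma prism_lambda_respects:
  assumes X: "simplicial_set X" and t: "t \<in> standard_simplex p"
    and r: "(u, v) \<in> mrealization_rel p (prismatic X)"
  shows "(\<lambda>(q, s, x). realization_class X (prism_dim q, prism_join q t s, x)) u =
    (\<lambda>(q, s, x). realization_class X (prism_dim q, prism_join q t s, x)) v"
  using r unfolding mrealization_rel_def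
proof (elim UnE CollectE exE conjE)
  fix q i j s x
  assume uv: "(u, v) = ((q, s(i := simplical_face j (s i)), x), (q[i := q ! i - 1], s, mface (prismatic X) q i j x))"
    and q: "length q = Suc p" "i \<le> p" "0 < q ! i" "j \<le> q ! i"
    and s: "s \<in> topspace (multi_simplex_top (q[i := q ! i - 1]))"
    and "x \<in> msimplices (prismatic X) q"
  then have x: "x \<in> simplices X (prism_dim q)" by (simp add: prismatic_def)
  let ?q = "q[i := q ! i - 1]"
  have i: "i < length q" using q by simp
  have d: "prism_dim q = Suc (prism_dim ?q)"
    using prism_dim_update[OF i, of "q ! i - 1"] q by simp
  have "realization_class X (prism_dim q, prism_join q t (s(i := simplical_face j (s i))), x) =
      realization_class X (Suc (prism_dim ?q), simplical_face (prism_offset q i + j) (prism_join ?q t s), x)"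
    using prism_join_simplical_face[OF i q(3,4)] d by simp
  also have "\<dots> = realization_class X (prism_dim ?q, prism_join ?q t s, face X (Suc (prism_dim ?q)) (prism_offset q i + j) x)"
    using prism_offset_le_dim[OF i q(4)] x d q prism_join_in_simplex[OF _ t s]
    by (intro realization_class_face[OF X]) auto
  finally show ?thesis using uv d by (simp add: prismatic_def)
next
  fix q i j s x
  assume uv: "(u, v) = ((q, s(i := codegen j (s i)), x), (q[i := Suc (q ! i)], s, mdegen (prismatic X) q i j x))"
    and q: "length q = Suc p" "i \<le> p" "j \<le> q ! i"
    and s: "s \<in> topspace (multi_simplex_top (q[i := Suc (q ! i)]))"
    and "x \<in> msimplices (prismatic X) q"
  then have x: "x \<in> simplices X (prism_dim q)" by (simp add: prismatic_def)
  let ?q = "q[i := Suc (q ! i)]"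
  have i: "i < length q" using q by simp
  have d: "prism_dim ?q = Suc (prism_dim q)"
    using prism_dim_update[OF i, of "Suc (q ! i)"] q by simp
  have "prism_join ?q t s \<in> standard_simplex (Suc (prism_dim q))"
    using prism_join_in_simplex[OF _ t s] d q by simp
  then have "realization_class X (prism_dim q, codegen (prism_offset q i + j) (prism_join ?q t s), x) =
      realization_class X (Suc (prism_dim q), prism_join ?q t s, degen X (prism_dim q) (prism_offset q i + j) x)"
    using prism_offset_le_dim[OF i q(3)] x
    by (intro realization_class_degen[OF X]) auto
  then show ?thesis using uv d prism_join_codegen[OF i q(3)] by (simp add: prismatic_def)
qed

lemma prism_lambda_class:
  assumes "simplicial_set X" "t \<in> standard_simplex p"
    "(q, s, x) \<in> topspace (mrealization_sum p (prismatic X))"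
  shows "prism_lambda X t (mrealization_class p (prismatic X) (q, s, x)) =
    realization_class X (prism_dim q, prism_join q t s, x)"
  unfolding prism_lambda_def mrealization_class_def
  using induced_quotient_class[OF assms(3) prism_lambda_respects[OF assms(1,2)]] by simp

lemma topspace_prism_space:
  "topspace (prism_space X p) =
    mrealization_class p (prismatic X) ` topspace (mrealization_sum p (prismatic X))"
  unfolding prism_space_def mrealization_def mrealization_class_def
  by (rule topspace_quotient_space_image)

lemma topspace_realization:
  "topspace (realization X) = realization_class X ` topspace (realization_sum X)"
  unfolding realization_def realization_class_def by (rule topspace_quotient_space_image)

lemma quotient_map_mrealization_class:
  "quotient_map (mrealization_sum p (prismatic X)) (prism_space X p) (mrealization_class p (prismatic X))"
  unfolding prism_space_def mrealization_def mrealization_class_def by (rule quotient_map_quotient_class)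

lemma quotient_map_realization_class:
  "quotient_map (realization_sum X) (realization X) (realization_class X)"
  unfolding realization_def realization_class_def by (rule quotient_map_quotient_class)

lemma continuous_map_simplex_top:
  assumes "\<And>k. continuous_map Z euclideanreal (\<lambda>z. f z k)"
    and "\<And>z. z \<in> topspace Z \<Longrightarrow> f z \<in> standard_simplex n"
  shows "continuous_map Z (simplex_top n) f"
  unfolding continuous_map_in_subtopology continuous_map_componentwise_UNIV
  using assms by auto

lemma continuous_map_simplex_coord:
  "continuous_map (simplex_top n) euclideanreal (\<lambda>t. t k)"
  by (intro continuous_map_from_subtopology continuous_map_product_projection) simp

lemma continuous_map_multi_simplex_coord:
  assumes "i < length q"
  shows "continuous_map (multi_simplex_top q) euclideanreal (\<lambda>s. s i k)"
proof -
  have "continuous_map (multi_simplex_top q) (simplex_top (q ! i)) (\<lambda>s. s i)"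
    using assms by (intro continuous_map_product_projection) auto
  then show ?thesis using continuous_map_compose[OF _ continuous_map_simplex_coord] by (force simp: o_def)
qed

lemma continuous_map_multi_simplex:
  assumes "\<And>i k. i < length q \<Longrightarrow> continuous_map Z euclideanreal (\<lambda>z. f z i k)"
    and "\<And>z. z \<in> topspace Z \<Longrightarrow> f z \<in> topspace (multi_simplex_top q)"
  shows "continuous_map Z (multi_simplex_top q) f"
  unfolding continuous_map_componentwise
proof (intro conjI ballI)
  show "f ` topspace Z \<subseteq> extensional {..<length q}"
    using assms(2) by (force simp: PiE_iff)
  show "continuous_map Z (simplex_top (q ! i)) (\<lambda>x. f x i)" if "i \<in> {..<length q}" for i
    using that assms by (intro continuous_map_simplex_top) (auto simp: PiE_iff)
qed

lemma continuous_map_prism_join: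
  assumes "length q = Suc p"
  shows "continuous_map (prod_topology (simplex_top p) (multi_simplex_top q))
    (simplex_top (prism_dim q)) (\<lambda>(t, s). prism_join q t s)"
proof (rule continuous_map_simplex_top)
  fix k
  have "continuous_map (prod_topology (simplex_top p) (multi_simplex_top q)) euclideanreal
      (\<lambda>z. if prism_offset q i \<le> k \<and> k \<le> prism_offset q i + q ! i
         then fst z i * snd z i (k - prism_offset q i) else 0)" if "i < length q" for i
    using continuous_map_compose[OF continuous_map_fst continuous_map_simplex_coord]
      continuous_map_compose[OF continuous_map_snd continuous_map_multi_simplex_coord[OF that]]
    by (auto simp: o_def intro!: continuous_map_real_mult)
  then show "continuous_map (prod_topology (simplex_top p) (multi_simplex_top q)) euclideanreal
      (\<lambda>z. (case z of (t, s) \<Rightarrow> prism_join q t s) k)"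
    unfolding prism_join_def case_prod_beta by (intro continuous_map_sum) auto
next
  fix z assume "z \<in> topspace (prod_topology (simplex_top p) (multi_simplex_top q))"
  then show "(case z of (t, s) \<Rightarrow> prism_join q t s) \<in> standard_simplex (prism_dim q)"
    using assms by (auto intro!: prism_join_in_simplex simp del: topspace_product_topology)
qed

lemma continuous_map_realization_class_simplex:
  assumes "continuous_map Z (simplex_top n) f" "x \<in> simplices X n"
  shows "continuous_map Z (realization X) (\<lambda>z. realization_class X (n, f z, x))"
proof -
  have "continuous_map Z (realization_sum X) (\<lambda>z. (n, f z, x))"
    unfolding realization_sum_def
    using continuous_map_compose[OF _ continuous_map_component_injection[of n UNIV "\<lambda>n. prod_topology (simplex_top n) (discrete_topology (simplices X n))"],
        of Z "\<lambda>z. (f z, x)"] assms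
    by (auto simp: o_def continuous_map_pairedI)
  then show ?thesis
    using continuous_map_compose[OF _ quotient_imp_continuous_map[OF quotient_map_realization_class]]
    by (force simp: o_def)
qed

text \<open>Joint continuity in \<open>t\<close> and the class is what the fat realization asks for.
  The simplex factor being compact Hausdorff, it can be checked on single prisms, where the joined
  coordinates are polynomial.\<close>

lemma continuous_map_prism_lambda:
  assumes X: "simplicial_set X"
  shows "continuous_map (prod_topology (simplex_top p) (prism_space X p)) (realization X)
    (\<lambda>(t, y). prism_lambda X t y)"
proof (rule continuous_compose_quotient_map)
  let ?M = "mrealization_sum p (prismatic X)"
  let ?f = "\<lambda>(t, q, s, x). realization_class X (prism_dim q, prism_join q t s, x)"
  show "quotient_map (prod_topology (simplex_top p) ?M) (prod_topology (simplex_top p) (prism_space X p))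
      (\<lambda>(t, z). (t, mrealization_class p (prismatic X) z))"
    by (intro quotient_map_prod_compact_Hausdorff compact_space_simplex_top Hausdorff_space_simplex_top
        quotient_map_mrealization_class)
  have "continuous_map (prod_topology (simplex_top p) ?M) (realization X) ?f"
    unfolding mrealization_sum_def
  proof (rule continuous_map_prod_sum_topology)
    fix q assume "q \<in> {q :: nat list. length q = Suc p}"
    then have q: "length q = Suc p" by simp
    show "continuous_map (prod_topology (simplex_top p)
        (prod_topology (multi_simplex_top q) (discrete_topology (msimplices (prismatic X) q))))
        (realization X) (\<lambda>(t, y). ?f (t, q, y))"
    proof (rule continuous_map_prod_discrete_topology)
      fix x assume "x \<in> msimplices (prismatic X) q"
      then have "x \<in> simplices X (prism_dim q)" by (simp add: prismatic_def)
      then show "continuous_map (prod_topology (simplex_top p) (multi_simplex_top q)) (realization X)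
          (\<lambda>(t, s). (\<lambda>(t, y). ?f (t, q, y)) (t, s, x))"
        using continuous_map_realization_class_simplex[OF continuous_map_prism_join[OF q]]
        by (simp add: case_prod_unfold)
    qed
  qed
  then show "continuous_map (prod_topology (simplex_top p) ?M) (realization X)
     ((\<lambda>(t, y). prism_lambda X t y) \<circ> (\<lambda>(t, z). (t, mrealization_class p (prismatic X) z)))"
    by (rule continuous_map_eq) (auto simp: prism_lambda_class[OF X] simp del: topspace_product_topology)
qed

section \<open>Deleting, merging and splitting blocks\<close>

text \<open>The iterated coface with indices \<open>a\<close>, \<open>Suc a\<close>, ...,
  \<open>a + m - 1\<close>, applied in this order; it is dual to \<open>face_block\<close>.\<close>

definition insert_zeros :: "nat \<Rightarrow> nat \<Rightarrow> (nat \<Rightarrow> real) \<Rightarrow> nat \<Rightarrow> real" where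
  "insert_zeros a m y = (\<lambda>k. if k < a then y k else if k < a + m then 0 else y (k - m))"

lemma insert_zeros_0 [simp]: "insert_zeros a 0 y = y"
  by (simp add: insert_zeros_def fun_eq_iff)

lemma insert_zeros_Suc: "insert_zeros a (Suc m) y = simplical_face (a + m) (insert_zeros a m y)"
  by (auto simp: insert_zeros_def simplical_face_def fun_eq_iff)

lemma insert_zeros_simplex:
  "a \<le> Suc n \<Longrightarrow> y \<in> standard_simplex n \<Longrightarrow> insert_zeros a m y \<in> standard_simplex (n + m)"
proof (induction m)
  case 0
  then show ?case by simp
next
  case (Suc m)
  then show ?case using simplical_face_standard_simplex[of "a + m" "n + m"]
    by (simp add: insert_zeros_Suc)
qed

text \<open>The coface applied last in \<open>insert_zeros\<close> has the same index as the face
  applied first in \<open>face_block\<close>, so the block is removed by one face relation per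
  vertex.\<close>

lemma face_block_class:
  assumes X: "simplicial_set X" and "a \<le> Suc n" "y \<in> standard_simplex n" "x \<in> simplices X (n + m)"
  shows "face_block X (n + m) a m x \<in> simplices X n \<and>
    realization_class X (n + m, insert_zeros a m y, x) = realization_class X (n, y, face_block X (n + m) a m x)"
  using assms(4)
proof (induction m arbitrary: x)
  case 0
  then show ?case by simp
next
  case (Suc m)
  have "realization_class X (n + Suc m, insert_zeros a (Suc m) y, x) =
      realization_class X (n + m, insert_zeros a m y, face X (Suc (n + m)) (a + m) x)"
    using realization_class_face[OF X, of "a + m" "n + m" "insert_zeros a m y" x]
      insert_zeros_simplex[OF assms(2,3)] assms(2) Suc.prems
    by (simp add: insert_zeros_Suc)
  moreover have "face X (Suc (n + m)) (a + m) x \<in> simplices X (n + m)"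
    using face_in[OF X] assms(2) Suc.prems by simp
  ultimately show ?case using Suc.IH by simp
qed

lemma length_delete_nth: "i < length q \<Longrightarrow> length (delete_nth i q) = length q - 1"
  by (simp add: delete_nth_def)

lemma nth_delete_nth:
  "i < length q \<Longrightarrow> l < length q - 1 \<Longrightarrow> delete_nth i q ! l = (if l < i then q ! l else q ! Suc l)"
  by (auto simp: delete_nth_def nth_append min_def)

lemma prism_offset_delete_nth:
  assumes "i < length q"
  shows "l \<le> i \<Longrightarrow> prism_offset (delete_nth i q) l = prism_offset q l"
    and "i \<le> l \<Longrightarrow> l < length q \<Longrightarrow>
      prism_offset (delete_nth i q) l + Suc (q ! i) = prism_offset q (Suc l)"
proof -
  show le: "prism_offset (delete_nth i q) l = prism_offset q l" if "l \<le> i" for l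
    using that assms by (simp add: prism_offset_def delete_nth_def min_def)
  show "prism_offset (delete_nth i q) l + Suc (q ! i) = prism_offset q (Suc l)" if "i \<le> l" "l < length q"
    using that
  proof (induction l rule: dec_induct)
    case base
    then show ?case using le[of i] assms by (simp add: prism_offset_Suc)
  next
    case (step l)
    then show ?case
      using assms by (simp add: prism_offset_Suc length_delete_nth nth_delete_nth)
  qed
qed

lemma prism_offset_delete_nth_length:
  assumes "i < length q"
  shows "prism_offset (delete_nth i q) (length q - 1) + Suc (q ! i) = prism_offset q (length q)"
proof -
  have "Suc (length q - 1) = length q" using assms by simp
  then show ?thesis using prism_offset_delete_nth(2)[OF assms, of "length q - 1"] assms by (metis Suc_leI Suc_le_mono lessI)
qed

lemma prism_dim_delete_nth:
  assumes "i < length q" "2 \<le> length q"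
  shows "prism_dim q = prism_dim (delete_nth i q) + Suc (q ! i)"
proof -
  have "delete_nth i q \<noteq> []" using assms length_delete_nth[of i q] by auto
  moreover have "prism_offset (delete_nth i q) (length q - 1) + Suc (q ! i) = prism_offset q (length q)"
    by (rule prism_offset_delete_nth_length[OF assms(1)])
  ultimately show ?thesis
    using prism_offset_length[of q] prism_offset_length[of "delete_nth i q"] assms
    by (cases "q = []") (simp_all add: length_delete_nth)
qed

text \<open>The coface makes coordinate \<open>i\<close> of the simplex point vanish, which turns
  all \<open>Suc (q ! i)\<close> coordinates of block \<open>i\<close> into zeros, whatever
  \<open>s i\<close> is.\<close>

lemma prism_join_delete_nth:
  assumes i: "i < length q" and "2 \<le> length q"
  shows "prism_join q (simplical_face i t) s =
    insert_zeros (prism_offset q i) (Suc (q ! i)) (prism_join (delete_nth i q) t (proj_delete i s))"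
proof (rule prism_join_eqI)
  let ?J = "prism_join (delete_nth i q) t (proj_delete i s)"
  fix l j assume l: "l < length q" and j: "j \<le> q ! l"
  consider "l < i" | "l = i" | "i < l" by linarith
  then show "insert_zeros (prism_offset q i) (Suc (q ! i)) ?J (prism_offset q l + j) = simplical_face i t l * s l j"
  proof cases
    case 1
    have "prism_offset q l + j < prism_offset q i" using prism_offset_less[OF 1 l] j by simp
    moreover have "?J (prism_offset (delete_nth i q) l + j) = t l * proj_delete i s l j"
      using 1 i j by (intro prism_join_nth) (auto simp: length_delete_nth nth_delete_nth)
    ultimately show ?thesis using 1 i
      by (simp add: insert_zeros_def prism_offset_delete_nth simplical_face_def proj_delete_def)
  next
    case 2
    then show ?thesis using j by (simp add: insert_zeros_def simplical_face_def)
  next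
    case 3
    then obtain l' where l': "l = Suc l'" "i \<le> l'" using less_imp_Suc_add by auto
    have "prism_offset q i + q ! i < prism_offset q l" using prism_offset_less[OF 3 i] .
    moreover have "?J (prism_offset (delete_nth i q) l' + j) = t l' * proj_delete i s l' j"
      using l l' i j by (intro prism_join_nth) (auto simp: length_delete_nth nth_delete_nth)
    moreover have "prism_offset q l + j - Suc (q ! i) = prism_offset (delete_nth i q) l' + j"
      using prism_offset_delete_nth(2)[OF i l'(2)] l l' by simp
    ultimately show ?thesis using l'
      by (simp add: insert_zeros_def simplical_face_def proj_delete_def)
  qed
next
  fix k assume k: "prism_offset q (length q) \<le> k"
  have "prism_offset q i + q ! i < prism_offset q (length q)" by (rule prism_offset_less[OF i i])
  moreover have "prism_offset (delete_nth i q) (length q - 1) + Suc (q ! i) = prism_offset q (length q)"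
    by (rule prism_offset_delete_nth_length[OF i])
  ultimately show "insert_zeros (prism_offset q i) (Suc (q ! i))
      (prism_join (delete_nth i q) t (proj_delete i s)) k = 0"
    using k i prism_join_beyond[of "delete_nth i q" "k - Suc (q ! i)" t "proj_delete i s"]
    by (simp add: insert_zeros_def length_delete_nth)
qed

lemma proj_delete_multi_simplex:
  assumes "i < length q" "s \<in> topspace (multi_simplex_top q)"
  shows "proj_delete i s \<in> topspace (multi_simplex_top (delete_nth i q))"
  using assms
  by (auto simp: PiE_iff extensional_def proj_delete_def length_delete_nth nth_delete_nth)

text \<open>Compatibility of \<lambda> with the deletion of a block, on representatives. Both the
  well-definedness of \<open>prism_space_face\<close> and that of \<open>prism_Lambda\<close> rest
  on it.\<close>

lemma prism_delete_class:
  assumes X: "simplicial_set X" and "length q = Suc (Suc p)" "i \<le> Suc p"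
    and t: "t \<in> standard_simplex p"
    and s: "s \<in> topspace (multi_simplex_top q)" and x: "x \<in> simplices X (prism_dim q)"
  defines "y \<equiv> face_block X (prism_dim q) (prism_offset q i) (Suc (q ! i)) x"
  shows "(delete_nth i q, proj_delete i s, y) \<in> topspace (mrealization_sum p (prismatic X))"
    and "realization_class X (prism_dim q, prism_join q (simplical_face i t) s, x) =
      realization_class X (prism_dim (delete_nth i q), prism_join (delete_nth i q) t (proj_delete i s), y)"
proof -
  let ?q = "delete_nth i q"
  have i: "i < length q" "2 \<le> length q" using assms by auto
  have len: "length ?q = Suc p" using i assms(2) by (simp add: length_delete_nth)
  have ps: "proj_delete i s \<in> topspace (multi_simplex_top ?q)"
    using proj_delete_multi_simplex[OF i(1) s] .
  note d = prism_dim_delete_nth[OF i]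
  have J: "prism_join ?q t (proj_delete i s) \<in> standard_simplex (prism_dim ?q)"
    by (rule prism_join_in_simplex[OF len t ps])
  have "prism_offset ?q i \<le> prism_offset ?q (length ?q)"
    using i by (intro prism_offset_mono) (simp add: length_delete_nth)
  then have a: "prism_offset q i \<le> Suc (prism_dim ?q)"
    using prism_offset_length[of ?q] len i prism_offset_delete_nth(1)[OF i(1), of i]
    by (cases "?q = []") auto
  have x': "x \<in> simplices X (prism_dim ?q + Suc (q ! i))" using x d by simp
  note fb = face_block_class[OF X a J x', folded d prism_join_delete_nth[OF i]]
  show "(?q, proj_delete i s, y) \<in> topspace (mrealization_sum p (prismatic X))"
    using fb len ps by (simp add: y_def del: topspace_product_topology)
  show "realization_class X (prism_dim q, prism_join q (simplical_face i t) s, x) =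
      realization_class X (prism_dim ?q, prism_join ?q t (proj_delete i s), y)"
    using fb by (simp add: y_def)
qed

section \<open>Merging two blocks\<close>

text \<open>A parametrisation of the \<open>Suc p\<close>-simplex by \<open>[0,1]\<close> times the
  \<open>p\<close>-simplex, dividing the last coordinate in the ratio \<open>c : 1 - c\<close>. It
  fails to be injective only where \<open>t p = 0\<close>.\<close>

definition subdivide :: "nat \<Rightarrow> real \<Rightarrow> (nat \<Rightarrow> real) \<Rightarrow> nat \<Rightarrow> real" where
  "subdivide p c t = (\<lambda>k. if k < p then t k else if k = p then c * t p
     else if k = Suc p then (1 - c) * t p else 0)"

text \<open>The point at height \<open>c\<close> in the join of an \<open>a\<close>-simplex with a
  second simplex, whose vertices are numbered from \<open>Suc a\<close> on; \<open>c\<close> is the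
  weight of the first factor.\<close>

definition join2 :: "nat \<Rightarrow> real \<Rightarrow> (nat \<Rightarrow> real) \<Rightarrow> (nat \<Rightarrow> real) \<Rightarrow> nat \<Rightarrow> real" where
  "join2 a c A B = (\<lambda>k. if k \<le> a then c * A k else (1 - c) * B (k - Suc a))"

text \<open>The value \<open>undefined\<close> beyond index \<open>L\<close> keeps the merged point
  extensional.\<close>

definition merge_blocks :: "nat \<Rightarrow> nat \<Rightarrow> real \<Rightarrow> (nat \<Rightarrow> nat \<Rightarrow> real) \<Rightarrow> nat \<Rightarrow> nat \<Rightarrow> real" where
  "merge_blocks L a c s = (\<lambda>i. if i < L then s i else if i = L then join2 a c (s L) (s (Suc L)) else undefined)"

lemma subdivide_simplex:
  assumes "0 \<le> c" "c \<le> 1" "t \<in> standard_simplex p"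
  shows "subdivide p c t \<in> standard_simplex (Suc p)"
proof (rule standard_simplexI)
  note t = standard_simplexD[OF assms(3)]
  show "0 \<le> subdivide p c t i" for i using t(1) assms by (simp add: subdivide_def)
  show "subdivide p c t i = 0" if "Suc p < i" for i using that by (simp add: subdivide_def)
  have "(\<Sum>i\<le>Suc p. subdivide p c t i) = (\<Sum>i<p. t i) + c * t p + (1 - c) * t p"
    by (simp add: subdivide_def lessThan_Suc_atMost[symmetric])
  also have "\<dots> = (\<Sum>i<Suc p. t i)" by (simp add: algebra_simps)
  finally show "(\<Sum>i\<le>Suc p. subdivide p c t i) = 1" using t(4) by simp
qed

lemma join2_simplex:
  assumes "0 \<le> c" "c \<le> 1" "A \<in> standard_simplex a" "B \<in> standard_simplex b"
  shows "join2 a c A B \<in> standard_simplex (Suc (a + b))"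
proof (rule standard_simplexI)
  note A = standard_simplexD[OF assms(3)] and B = standard_simplexD[OF assms(4)]
  show "0 \<le> join2 a c A B i" for i using A(1) B(1) assms by (simp add: join2_def)
  show "join2 a c A B i = 0" if "Suc (a + b) < i" for i using that B(2) by (simp add: join2_def)
  have "(\<Sum>i\<le>Suc (a + b). join2 a c A B i) =
      (\<Sum>i<Suc a. join2 a c A B i) + (\<Sum>i=Suc a..Suc (a + b). join2 a c A B i)"
    by (intro sum_atMost_split) auto
  also have "(\<Sum>i<Suc a. join2 a c A B i) = c"
    using A(3) by (simp add: join2_def lessThan_Suc_atMost sum_distrib_left[symmetric])
  also have "(\<Sum>i=Suc a..Suc (a + b). join2 a c A B i) = (\<Sum>i\<le>b. join2 a c A B (i + Suc a))"
    using sum.shift_bounds_cl_nat_ivl[of "join2 a c A B" 0 "Suc a" b]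
    by (simp add: add.commute atLeast0AtMost)
  also have "\<dots> = 1 - c"
    using B(3) by (simp add: join2_def sum_distrib_left[symmetric])
  finally show "(\<Sum>i\<le>Suc (a + b). join2 a c A B i) = 1" by simp
qed

lemma prism_offset_append:
  "i < length qs \<Longrightarrow> prism_offset (qs @ r) i = prism_offset qs i"
  "prism_offset (qs @ r) (length qs) = sum_list qs + length qs"
  "prism_offset (qs @ a # r) (Suc (length qs)) = Suc (sum_list qs + length qs + a)"
  "prism_offset (qs @ a # b # r) (Suc (Suc (length qs))) = Suc (Suc (sum_list qs + length qs + a + b))"
  by (simp_all add: prism_offset_def)

lemma prism_dim_append:
  "prism_dim (qs @ [n]) = sum_list qs + length qs + n"
  "prism_dim (qs @ [a, b]) = Suc (sum_list qs + length qs + a + b)"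
  by (simp_all add: prism_dim_def)

lemma multi_simplex_append1:
  "s \<in> topspace (multi_simplex_top (qs @ [n])) \<longleftrightarrow>
    s \<in> extensional {..<Suc (length qs)} \<and> (\<forall>i<length qs. s i \<in> standard_simplex (qs ! i)) \<and>
    s (length qs) \<in> standard_simplex n"
  by (auto simp: PiE_iff nth_append lessThan_Suc)

lemma multi_simplex_append2:
  "s \<in> topspace (multi_simplex_top (qs @ [a, b])) \<longleftrightarrow>
    s \<in> extensional {..<Suc (Suc (length qs))} \<and> (\<forall>i<length qs. s i \<in> standard_simplex (qs ! i)) \<and>
    s (length qs) \<in> standard_simplex a \<and> s (Suc (length qs)) \<in> standard_simplex b"
  by (auto simp: PiE_iff nth_append lessThan_Suc)

lemma merge_blocks_multi_simplex:
  assumes "0 \<le> c" "c \<le> 1" "s \<in> topspace (multi_simplex_top (qs @ [a, b]))"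
  shows "merge_blocks (length qs) a c s \<in> topspace (multi_simplex_top (qs @ [Suc (a + b)]))"
  using assms join2_simplex unfolding multi_simplex_append1 multi_simplex_append2
  by (auto simp: merge_blocks_def extensional_def)

text \<open>Either way the last two blocks receive the total factors \<open>c * t L\<close> and
  \<open>(1 - c) * t L\<close> with \<open>L = length qs\<close>. The merged block has
  \<open>Suc a + Suc b\<close> vertices, hence dimension \<open>Suc (a + b)\<close>.\<close>

lemma prism_join_merge_blocks:
  "prism_join (qs @ [a, b]) (subdivide (length qs) c t) s =
    prism_join (qs @ [Suc (a + b)]) t (merge_blocks (length qs) a c s)"
proof (rule prism_join_eqI)
  let ?L = "length qs" and ?q = "qs @ [Suc (a + b)]"
  let ?J = "prism_join ?q t (merge_blocks (length qs) a c s)"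
  fix i j assume i: "i < length (qs @ [a, b])" and j: "j \<le> (qs @ [a, b]) ! i"
  consider "i < ?L" | "i = ?L" | "i = Suc ?L" using i by fastforce
  then show "?J (prism_offset (qs @ [a, b]) i + j) = subdivide ?L c t i * s i j"
  proof cases
    case 1
    then have "?J (prism_offset ?q i + j) = t i * merge_blocks ?L a c s i j"
      using j by (intro prism_join_nth) (auto simp: nth_append)
    then show ?thesis using 1 by (simp add: prism_offset_append subdivide_def merge_blocks_def)
  next
    case 2
    then have "?J (prism_offset ?q ?L + j) = t ?L * merge_blocks ?L a c s ?L j"
      using j by (intro prism_join_nth) (auto simp: nth_append)
    then show ?thesis using 2 j
      by (simp add: prism_offset_append subdivide_def merge_blocks_def join2_def nth_append)
  next
    case 3
    then have "?J (prism_offset ?q ?L + (Suc a + j)) = t ?L * merge_blocks ?L a c s ?L (Suc a + j)"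
      using j by (intro prism_join_nth) (auto simp: nth_append)
    then show ?thesis using 3 j
      by (simp add: prism_offset_append subdivide_def merge_blocks_def join2_def nth_append add.assoc)
  qed
next
  fix k assume "prism_offset (qs @ [a, b]) (length (qs @ [a, b])) \<le> k"
  then show "prism_join (qs @ [Suc (a + b)]) t (merge_blocks (length qs) a c s) k = 0"
    by (intro prism_join_beyond) (simp add: prism_offset_append)
qed

text \<open>\<open>split_index c n v k\<close>: the height \<open>c\<close> lies in the interval of vertex \<open>k\<close> when \<open>[0,1]\<close> is cut into
  consecutive intervals of lengths \<open>v 0, \<dots>, v n\<close>.\<close>

definition split_index :: "real \<Rightarrow> nat \<Rightarrow> (nat \<Rightarrow> real) \<Rightarrow> nat \<Rightarrow> bool" where
  "split_index c n v k \<longleftrightarrow> k \<le> n \<and> (\<Sum>l<k. v l) \<le> c \<and> c \<le> (\<Sum>l<Suc k. v l)"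

text \<open>A cut at height \<open>c\<close> gives vertex \<open>k\<close> a share on either side,
  so it becomes the last vertex on the left and vertex 0 on the right. The dimensions are therefore
  \<open>k\<close> and \<open>n - k\<close>; division by \<open>c\<close> and \<open>1 - c\<close>
  renormalises.\<close>

definition split_left :: "real \<Rightarrow> (nat \<Rightarrow> real) \<Rightarrow> nat \<Rightarrow> nat \<Rightarrow> real" where
  "split_left c v k = (\<lambda>j. if j < k then v j / c else if j = k then (c - (\<Sum>l<k. v l)) / c else 0)"

definition split_right :: "real \<Rightarrow> (nat \<Rightarrow> real) \<Rightarrow> nat \<Rightarrow> nat \<Rightarrow> real" where
  "split_right c v k = (\<lambda>j. if j = 0 then ((\<Sum>l<Suc k. v l) - c) / (1 - c) else v (k + j) / (1 - c))"

text \<open>Take the least \<open>k\<close> whose cumulated weight reaches \<open>c\<close>; the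
  total weight 1 guarantees one. The lower bound is minimality, or \<open>0 \<le> c\<close> if
  \<open>k = 0\<close>.\<close>

lemma split_index_exists:
  assumes "v \<in> standard_simplex n" "0 \<le> c" "c \<le> 1"
  shows "\<exists>k. split_index c n v k"
proof -
  define P where "P k \<longleftrightarrow> c \<le> (\<Sum>l<Suc k. v l)" for k
  define k where "k = Least P"
  have n: "P n" unfolding P_def using standard_simplexD(4)[OF assms(1)] assms by simp
  have "c \<le> (\<Sum>l<Suc k. v l)" using LeastI[of P, OF n] unfolding k_def P_def .
  moreover have "k \<le> n" unfolding k_def using n by (rule Least_le)
  moreover have "(\<Sum>l<k. v l) \<le> c"
  proof (cases k)
    case (Suc m)
    then have "\<not> P m" using not_less_Least[of m P] unfolding k_def by simp
    then show ?thesis unfolding Suc P_def by linarith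
  qed (use assms in simp)
  ultimately show ?thesis unfolding split_index_def by blast
qed

lemma split_left_simplex:
  assumes "v \<in> standard_simplex n" "0 < c" "split_index c n v k"
  shows "split_left c v k \<in> standard_simplex k"
proof (rule standard_simplexI)
  note v = standard_simplexD[OF assms(1)]
  show "0 \<le> split_left c v k i" for i
    using v(1) assms by (simp add: split_left_def split_index_def)
  show "split_left c v k i = 0" if "k < i" for i using that by (simp add: split_left_def)
  have "(\<Sum>i\<le>k. split_left c v k i) = (\<Sum>i<k. v i / c) + (c - (\<Sum>l<k. v l)) / c"
    unfolding lessThan_Suc_atMost[symmetric] by (simp add: split_left_def)
  also have "\<dots> = 1"
    using assms(2) unfolding sum_divide_distrib[symmetric] add_divide_distrib[symmetric] by simp
  finally show "(\<Sum>i\<le>k. split_left c v k i) = 1" .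
qed

lemma sum_lessThan_shift:
  fixes v :: "nat \<Rightarrow> 'a::comm_monoid_add"
  shows "(\<Sum>l<a + b. v l) = (\<Sum>l<a. v l) + (\<Sum>l<b. v (a + l))"
  by (induction b) (simp_all add: add.assoc)

lemma split_right_simplex:
  assumes "v \<in> standard_simplex n" "c < 1" "split_index c n v k"
  shows "split_right c v k \<in> standard_simplex (n - k)"
proof (rule standard_simplexI)
  note v = standard_simplexD[OF assms(1)]
  show "0 \<le> split_right c v k i" for i
    using v(1) assms by (simp add: split_right_def split_index_def)
  show "split_right c v k i = 0" if "n - k < i" for i using that v(2) by (simp add: split_right_def)
  have "(\<Sum>i\<le>n - k. split_right c v k i) =
      split_right c v k 0 + (\<Sum>i<n - k. split_right c v k (Suc i))"
    unfolding lessThan_Suc_atMost[symmetric] by (rule sum.lessThan_Suc_shift)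
  also have "\<dots> = ((\<Sum>l<Suc k. v l) - c) / (1 - c) + (\<Sum>i<n - k. v (Suc k + i) / (1 - c))"
    by (simp add: split_right_def)
  also have "\<dots> = ((\<Sum>l<Suc k. v l) + (\<Sum>i<n - k. v (Suc k + i)) - c) / (1 - c)"
    by (simp add: sum_divide_distrib[symmetric] add_divide_distrib diff_divide_distrib)
  also have "(\<Sum>l<Suc k. v l) + (\<Sum>i<n - k. v (Suc k + i)) = (\<Sum>l<Suc k + (n - k). v l)"
    by (rule sum_lessThan_shift[symmetric])
  also have "\<dots> = 1" using v(4) assms(3) by (simp add: split_index_def)
  finally show "(\<Sum>i\<le>n - k. split_right c v k i) = 1" using assms(2) by simp
qed

text \<open>After merging, the two shares of vertex \<open>k\<close> sit at the adjacent positions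
  \<open>k\<close> and \<open>Suc k\<close>, and the codegeneracy adds them up again.\<close>

lemma codegen_join2_split:
  assumes "0 < c" "c < 1"
  shows "codegen k (join2 k c (split_left c v k) (split_right c v k)) = v"
proof
  fix i
  consider "i < k" | "i = k" | "k < i" by linarith
  then show "codegen k (join2 k c (split_left c v k) (split_right c v k)) i = v i"
    by cases (use assms in \<open>auto simp: codegen_def join2_def split_left_def split_right_def\<close>)
qed

text \<open>For \<open>0 < c < 1\<close> the factors come from splitting. At the ends this would
  divide by zero, but there one factor has weight zero and is arbitrary: a 0-simplex is put in its
  place, so that the first or last vertex is doubled with weight zero.\<close>

lemma codegen_join2_surj:
  assumes v: "v \<in> standard_simplex n" and c: "0 \<le> c" "c \<le> 1"
  obtains k A B where "k \<le> n" "A \<in> standard_simplex k" "B \<in> standard_simplex (n - k)"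
    "codegen k (join2 k c A B) = v"
proof -
  consider "c = 0" | "c = 1" | "0 < c" "c < 1" using c by linarith
  then show thesis
  proof cases
    case 1
    show ?thesis
    proof (rule that)
      show "codegen 0 (join2 0 c (\<lambda>j. if j = 0 then 1 else 0) v) = v"
        using 1 by (auto simp: codegen_def join2_def fun_eq_iff)
    qed (use v in auto)
  next
    case 2
    show ?thesis
    proof (rule that)
      show "codegen n (join2 n c v (\<lambda>j. if j = 0 then 1 else 0)) = v"
        using 2 standard_simplexD(2)[OF v] by (auto simp: codegen_def join2_def fun_eq_iff)
    qed (use v in auto)
  next
    case 3
    obtain k where k: "split_index c n v k" using split_index_exists[OF v c] ..
    show ?thesis
    proof (rule that)
      show "codegen k (join2 k c (split_left c v k) (split_right c v k)) = v"
        by (rule codegen_join2_split[OF 3])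
      show "split_left c v k \<in> standard_simplex k" by (rule split_left_simplex[OF v 3(1) k])
      show "split_right c v k \<in> standard_simplex (n - k)" by (rule split_right_simplex[OF v 3(2) k])
      show "k \<le> n" using k by (simp add: split_index_def)
    qed
  qed
qed

section \<open>Relations in the last two blocks\<close>

abbreviation block_start :: "nat list \<Rightarrow> nat" where
  "block_start qs \<equiv> sum_list qs + length qs"

lemma list_update_append2:
  "i < length qs \<Longrightarrow> (qs @ r)[i := v] = qs[i := v] @ r"
  "(qs @ a # r)[length qs := v] = qs @ v # r"
  "(qs @ a # b # r)[Suc (length qs) := v] = qs @ a # v # r"
  "(qs @ a # b # r) ! Suc (length qs) = b"
  by (simp_all add: list_update_append nth_append)

text \<open>The generating relations are restated for lists with the two final entries displayed, so
  that offsets become explicit sums.\<close>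

lemma mrealization_class_face_last:
  assumes "simplicial_set X" "s \<in> topspace (multi_simplex_top (qs @ [a, b]))" "j \<le> Suc b"
    "x \<in> simplices X (Suc (block_start qs + a + Suc b))"
  shows "mrealization_class (Suc (length qs)) (prismatic X)
      (qs @ [a, Suc b], s(Suc (length qs) := simplical_face j (s (Suc (length qs)))), x) =
    mrealization_class (Suc (length qs)) (prismatic X)
      (qs @ [a, b], s, face X (Suc (block_start qs + a + Suc b)) (Suc (block_start qs + a) + j) x)"
  using mrealization_class_face[OF assms(1), of "qs @ [a, Suc b]" "Suc (length qs)" "Suc (length qs)" j s x] assms
  by (simp add: list_update_append2 prism_dim_append prism_offset_append del: topspace_product_topology)

lemma mrealization_class_face_mid:
  assumes "simplicial_set X" "s \<in> topspace (multi_simplex_top (qs @ [a, b]))" "j \<le> Suc a"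
    "x \<in> simplices X (Suc (block_start qs + Suc a + b))"
  shows "mrealization_class (Suc (length qs)) (prismatic X)
      (qs @ [Suc a, b], s(length qs := simplical_face j (s (length qs))), x) =
    mrealization_class (Suc (length qs)) (prismatic X)
      (qs @ [a, b], s, face X (Suc (block_start qs + Suc a + b)) (block_start qs + j) x)"
  using mrealization_class_face[OF assms(1), of "qs @ [Suc a, b]" "Suc (length qs)" "length qs" j s x] assms
  by (simp add: list_update_append2 prism_dim_append prism_offset_append del: topspace_product_topology)

lemma mrealization_class_degen_last:
  assumes "simplicial_set X" "s \<in> topspace (multi_simplex_top (qs @ [a, Suc b]))" "j \<le> b"
    "x \<in> simplices X (Suc (block_start qs + a + b))"
  shows "mrealization_class (Suc (length qs)) (prismatic X)
      (qs @ [a, b], s(Suc (length qs) := codegen j (s (Suc (length qs)))), x) =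
    mrealization_class (Suc (length qs)) (prismatic X)
      (qs @ [a, Suc b], s, degen X (Suc (block_start qs + a + b)) (Suc (block_start qs + a) + j) x)"
  using mrealization_class_degen[OF assms(1), of "qs @ [a, b]" "Suc (length qs)" "Suc (length qs)" j s x] assms
  by (simp add: list_update_append2 prism_dim_append prism_offset_append del: topspace_product_topology)

lemma mrealization_class_degen_mid:
  assumes "simplicial_set X" "s \<in> topspace (multi_simplex_top (qs @ [Suc a, b]))" "j \<le> a"
    "x \<in> simplices X (Suc (block_start qs + a + b))"
  shows "mrealization_class (Suc (length qs)) (prismatic X)
      (qs @ [a, b], s(length qs := codegen j (s (length qs))), x) =
    mrealization_class (Suc (length qs)) (prismatic X)
      (qs @ [Suc a, b], s, degen X (Suc (block_start qs + a + b)) (block_start qs + j) x)"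
  using mrealization_class_degen[OF assms(1), of "qs @ [a, b]" "Suc (length qs)" "length qs" j s x] assms
  by (simp add: list_update_append2 prism_dim_append prism_offset_append del: topspace_product_topology)

section \<open>Splitting the last block\<close>

definition split_point :: "real \<Rightarrow> nat \<Rightarrow> (nat \<Rightarrow> nat \<Rightarrow> real) \<Rightarrow> nat \<Rightarrow> nat \<Rightarrow> nat \<Rightarrow> real" where
  "split_point c L s k = (\<lambda>i. if i < L then s i else if i = L then split_left c (s L) k
     else if i = Suc L then split_right c (s L) k else undefined)"

text \<open>Vertex \<open>k\<close> of the last block is vertex \<open>block_start qs + k\<close> of
  the whole simplex, which explains the degeneracy. The index stays a parameter because it is not
  unique when \<open>c\<close> is a boundary between intervals.\<close>

definition split_class ::
    "'a sset \<Rightarrow> real \<Rightarrow> nat list \<Rightarrow> nat \<Rightarrow> (nat \<Rightarrow> nat \<Rightarrow> real) \<Rightarrow> 'a \<Rightarrow> nat \<Rightarrow> 'a mpoint set" where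
  "split_class X c qs n s x k =
     mrealization_class (Suc (length qs)) (prismatic X)
       (qs @ [k, n - k], split_point c (length qs) s k,
        degen X (block_start qs + n) (block_start qs + k) x)"

lemma split_point_multi_simplex:
  assumes "s \<in> topspace (multi_simplex_top (qs @ [n]))" "0 < c" "c < 1" "split_index c n (s (length qs)) k"
  shows "split_point c (length qs) s k \<in> topspace (multi_simplex_top (qs @ [k, n - k]))"
  using assms split_left_simplex[OF _ assms(2,4)] split_right_simplex[OF _ assms(3,4)]
  unfolding multi_simplex_append1 multi_simplex_append2
  by (auto simp: split_point_def extensional_def)

text \<open>When \<open>c\<close> is the boundary between two vertex intervals, either vertex may be doubled; both choices
  have the point without doubled vertex as a common face.\<close>

lemma split_class_Suc:
  assumes X: "simplicial_set X" and s: "s \<in> topspace (multi_simplex_top (qs @ [n]))"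
    and c: "0 < c" "c < 1" and x: "x \<in> simplices X (block_start qs + n)"
    and k: "split_index c n (s (length qs)) k" "split_index c n (s (length qs)) (Suc k)"
  shows "split_class X c qs n s x k = split_class X c qs n s x (Suc k)"
proof -
  let ?L = "length qs" and ?Q = "block_start qs"
  let ?v = "s ?L"
  define b where "b = n - Suc k"
  have kn: "n = Suc (k + b)" "n - k = Suc b" "n - Suc k = b" using k by (auto simp: split_index_def b_def)
  have sum: "(\<Sum>l<Suc k. ?v l) = c" using k by (simp add: split_index_def)
  \<comment> \<open>\<open>w\<close> is the point without a doubled vertex: at this boundary the
    left part for \<open>k\<close> ends with the full vertex \<open>k\<close>, and the right part
    for \<open>Suc k\<close> begins with the full vertex \<open>Suc k\<close>.\<close>
  define w where "w = (\<lambda>i. if i < ?L then s i else if i = ?L then split_left c ?v k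
    else if i = Suc ?L then split_right c ?v (Suc k) else undefined)"
  have w: "w \<in> topspace (multi_simplex_top (qs @ [k, b]))"
    using split_point_multi_simplex[OF s c k(1)] split_point_multi_simplex[OF s c k(2)] kn
    unfolding multi_simplex_append2 by (auto simp: w_def split_point_def extensional_def)
  \<comment> \<open>With index \<open>k\<close> the right share of vertex \<open>k\<close> is zero,
    a zero in front of the right part of \<open>w\<close>; with index \<open>Suc k\<close> there is
    a zero at the end of its left part. In both cases the face removing the zero cancels the
    degeneracy, being one of the two faces of the doubled vertex.\<close>
  have "split_point c ?L s k = w(Suc ?L := simplical_face 0 (w (Suc ?L)))"
  proof -
    have "split_right c ?v k j = simplical_face 0 (split_right c ?v (Suc k)) j" for j
    proof -
      consider "j = 0" | "j = 1" | "1 < j" by linarith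
      then show ?thesis using sum by cases (simp_all add: simplical_face_def split_right_def)
    qed
    then have "split_right c ?v k = simplical_face 0 (split_right c ?v (Suc k))" ..
    then show ?thesis by (simp add: fun_eq_iff split_point_def w_def)
  qed
  then have "split_class X c qs n s x k = mrealization_class (Suc ?L) (prismatic X)
      (qs @ [k, b], w, face X (Suc (?Q + k + Suc b)) (Suc (?Q + k) + 0) (degen X (?Q + n) (?Q + k) x))"
    using mrealization_class_face_last[OF X w, of 0 "degen X (?Q + n) (?Q + k) x"] kn x degen_in[OF X, of "?Q + k" "?Q + n" x]
    by (simp add: split_class_def add.assoc)
  also have "face X (Suc (?Q + k + Suc b)) (Suc (?Q + k) + 0) (degen X (?Q + n) (?Q + k) x) = x"
    using face_degen_eq[OF X x, of "?Q + k" "Suc (?Q + k)"] kn by (simp add: add.assoc)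
  finally have "split_class X c qs n s x k = mrealization_class (Suc ?L) (prismatic X) (qs @ [k, b], w, x)" .
  moreover have "face X (Suc (?Q + Suc k + b)) (?Q + Suc k) (degen X (?Q + n) (?Q + Suc k) x) = x"
    using face_degen_eq[OF X x, of "?Q + Suc k" "?Q + Suc k"] kn by (simp add: add.assoc)
  moreover have "split_point c ?L s (Suc k) = w(?L := simplical_face (Suc k) (w ?L))"
    using sum c
    by (auto simp: fun_eq_iff split_point_def w_def simplical_face_def split_left_def less_Suc_eq)
  ultimately show ?thesis
    using mrealization_class_face_mid[OF X w, of "Suc k" "degen X (?Q + n) (?Q + Suc k) x"] kn x
      degen_in[OF X, of "?Q + Suc k" "?Q + n" x]
    by (simp add: split_class_def add.assoc)
qed

text \<open>Cumulated weights are monotone, so the admissible indices form an interval and it is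
  enough to compare neighbouring ones.\<close>

lemma split_index_between:
  assumes "v \<in> standard_simplex n" "split_index c n v k" "split_index c n v k'" "k \<le> m" "m \<le> k'"
  shows "split_index c n v m"
proof -
  have "(\<Sum>l<i. v l) \<le> (\<Sum>l<j. v l)" if "i \<le> j" for i j
    using that standard_simplexD(1)[OF assms(1)] by (intro sum_mono2) auto
  then have "(\<Sum>l<m. v l) \<le> (\<Sum>l<k'. v l)" "(\<Sum>l<Suc k. v l) \<le> (\<Sum>l<Suc m. v l)"
    using assms(4,5) by (blast intro: Suc_le_mono[THEN iffD2])+
  then show ?thesis
    using assms(2-5) unfolding split_index_def by (meson order_trans)
qed

lemma split_class_indep:
  assumes X: "simplicial_set X" and s: "s \<in> topspace (multi_simplex_top (qs @ [n]))"
    and c: "0 < c" "c < 1" and x: "x \<in> simplices X (block_start qs + n)"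
    and k: "split_index c n (s (length qs)) k" "split_index c n (s (length qs)) k'"
  shows "split_class X c qs n s x k = split_class X c qs n s x k'"
proof -
  let ?v = "s (length qs)"
  have v: "?v \<in> standard_simplex n" using s unfolding multi_simplex_append1 by blast
  have le: "split_class X c qs n s x k = split_class X c qs n s x m"
    if "k \<le> m" "m \<le> k'" and i: "split_index c n ?v k" "split_index c n ?v k'" for k k' m
    using that(1,2)
  proof (induction m rule: dec_induct)
    case (step m)
    have "split_index c n ?v m" "split_index c n ?v (Suc m)"
      using split_index_between[OF v i] step.hyps step.prems by simp_all
    then have "split_class X c qs n s x m = split_class X c qs n s x (Suc m)"
      by (rule split_class_Suc[OF X s c x])
    then show ?case using step by simp
  qed simp
  show ?thesis
  proof (cases "k \<le> k'")
    case True
    then show ?thesis by (rule le[OF _ order_refl k])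
  next
    case False
    then show ?thesis by (intro le[OF _ order_refl k(2,1), symmetric]) simp
  qed
qed

text \<open>The choice by \<open>SOME\<close> is immaterial by \<open>split_class_indep\<close>; on
  points of the realization sum any admissible index computes the value.\<close>

definition split_map :: "'a sset \<Rightarrow> real \<Rightarrow> 'a mpoint \<Rightarrow> 'a mpoint set" where
  "split_map X c = (\<lambda>(q, s, x). split_class X c (butlast q) (last q) s x
     (SOME k. split_index c (last q) (s (length (butlast q))) k))"

lemma split_map_eq:
  assumes "simplicial_set X" "s \<in> topspace (multi_simplex_top (qs @ [n]))"
    "0 < c" "c < 1" "x \<in> simplices X (block_start qs + n)"
    "split_index c n (s (length qs)) k"
  shows "split_map X c (qs @ [n], s, x) = split_class X c qs n s x k"
proof -
  have "split_index c n (s (length qs)) (SOME k. split_index c n (s (length qs)) k)"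
    using assms(6) by (rule someI)
  then show ?thesis
    using split_class_indep[OF assms(1-5) _ assms(6)] by (simp add: split_map_def)
qed

text \<open>In a merged block the height \<open>c\<close> is exactly the end of the interval of
  vertex \<open>a\<close>, so \<open>a\<close> is admissible. Doubling it puts a vertex of weight
  zero in front of the right part, and removing that vertex cancels the degeneracy.\<close>

lemma split_map_merge:
  assumes X: "simplicial_set X" and c: "0 < c" "c < 1"
    and s: "s \<in> topspace (multi_simplex_top (qs @ [a, b]))"
    and x: "x \<in> simplices X (Suc (block_start qs + a + b))"
  shows "split_map X c (qs @ [Suc (a + b)], merge_blocks (length qs) a c s, x) =
    mrealization_class (Suc (length qs)) (prismatic X) (qs @ [a, b], s, x)"
proof -
  let ?L = "length qs" and ?Q = "block_start qs"
  let ?m = "merge_blocks ?L a c s"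
  have c': "0 \<le> c" "c \<le> 1" using c by auto
  have sL: "s ?L \<in> standard_simplex a" "s (Suc ?L) \<in> standard_simplex b"
    and ext: "s \<in> extensional {..<Suc (Suc ?L)}"
    using s unfolding multi_simplex_append2 by auto
  have m: "?m \<in> topspace (multi_simplex_top (qs @ [Suc (a + b)]))"
    by (rule merge_blocks_multi_simplex[OF c' s])
  have mL: "?m ?L = join2 a c (s ?L) (s (Suc ?L))" by (simp add: merge_blocks_def)
  have suma: "(\<Sum>l<a. ?m ?L l) = c * (\<Sum>l<a. s ?L l)"
    by (simp add: mL join2_def sum_distrib_left)
  have "(\<Sum>l<Suc a. s ?L l) = 1" using standard_simplexD(4)[OF sL(1)] .
  then have s1: "(\<Sum>l<a. s ?L l) = 1 - s ?L a" by simp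
  have sumSa: "(\<Sum>l<Suc a. ?m ?L l) = c"
    using suma by (simp add: s1 mL join2_def algebra_simps)
  have "(\<Sum>l<a. ?m ?L l) \<le> c"
    using c standard_simplexD(1)[OF sL(1)] by (simp add: suma s1)
  then have k: "split_index c (Suc (a + b)) (?m ?L) a"
    using sumSa by (simp add: split_index_def)
  have d: "degen X (?Q + Suc (a + b)) (?Q + a) x \<in> simplices X (Suc (?Q + a + Suc b))"
    using degen_in[OF X, of "?Q + a" "Suc (?Q + a + b)" x] x by (simp add: add.assoc)
  have "split_left c (?m ?L) a = s ?L"
    using c standard_simplexD(2)[OF sL(1)]
    unfolding split_left_def suma s1 by (auto simp: fun_eq_iff mL join2_def right_diff_distrib)
  moreover have "split_right c (?m ?L) a = simplical_face 0 (s (Suc ?L))"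
    using c unfolding split_right_def sumSa by (auto simp: fun_eq_iff simplical_face_def mL join2_def)
  ultimately have "split_point c ?L ?m a = s(Suc ?L := simplical_face 0 (s (Suc ?L)))"
    using ext by (auto simp: fun_eq_iff split_point_def merge_blocks_def extensional_def)
  then have "split_class X c qs (Suc (a + b)) ?m x a = mrealization_class (Suc ?L) (prismatic X)
      (qs @ [a, Suc b], s(Suc ?L := simplical_face 0 (s (Suc ?L))), degen X (?Q + Suc (a + b)) (?Q + a) x)"
    by (simp add: split_class_def)
  also have "\<dots> = mrealization_class (Suc ?L) (prismatic X)
      (qs @ [a, b], s, face X (Suc (?Q + a + Suc b)) (Suc (?Q + a) + 0) (degen X (?Q + Suc (a + b)) (?Q + a) x))"
    by (rule mrealization_class_face_last[OF X s _ d]) simp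
  also have "face X (Suc (?Q + a + Suc b)) (Suc (?Q + a) + 0) (degen X (?Q + Suc (a + b)) (?Q + a) x) = x"
    using face_degen_eq[OF X, of x "Suc (?Q + a + b)" "?Q + a" "Suc (?Q + a)"] x by (simp add: add.assoc)
  finally show ?thesis
    using split_map_eq[OF X m c _ k, of x] x by (simp add: add.assoc)
qed

section \<open>Compatibility of splitting with faces and degeneracies\<close>

text \<open>The cut is governed by cumulated weights, which a coface or codegeneracy only reindexes;
  the admissible index is transported accordingly.\<close>

lemma sum_simplical_face:
  "(\<Sum>l<i. simplical_face j v l) = (if i \<le> j then \<Sum>l<i. v l else \<Sum>l<i - 1. (v l :: real))"
proof (induction i)
  case (Suc i)
  show ?case
  proof (cases "i \<le> j")
    case True
    then show ?thesis using Suc.IH by (cases "i = j") (auto simp: simplical_face_def)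
  next
    case False
    then obtain i' where "i = Suc i'" by (cases i) auto
    then show ?thesis using False Suc.IH by (auto simp: simplical_face_def)
  qed
qed simp

lemma sum_codegen:
  "(\<Sum>l<i. codegen j v l) = (if i \<le> j then \<Sum>l<i. v l else \<Sum>l<Suc i. v l)"
proof (induction i)
  case (Suc i)
  then show ?case by (cases i j rule: linorder_cases) (auto simp: codegen_def)
qed simp

text \<open>A zero inserted at or before the cut vertex belongs to the left part and pushes the cut
  vertex to \<open>Suc k\<close>.\<close>

lemma split_simplical_face_le:
  assumes "j \<le> k" "split_index c m v k"
  shows "split_index c (Suc m) (simplical_face j v) (Suc k)"
    and "split_left c (simplical_face j v) (Suc k) = simplical_face j (split_left c v k)"
    and "split_right c (simplical_face j v) (Suc k) = split_right c v k"
proof -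
  have s: "(\<Sum>l<Suc k. simplical_face j v l) = (\<Sum>l<k. v l)"
    "(\<Sum>l<Suc (Suc k). simplical_face j v l) = (\<Sum>l<Suc k. v l)"
    using assms(1) unfolding sum_simplical_face by simp_all
  show "split_index c (Suc m) (simplical_face j v) (Suc k)"
    using assms(2) unfolding split_index_def s by simp
  show "split_left c (simplical_face j v) (Suc k) = simplical_face j (split_left c v k)"
    unfolding split_left_def s using assms(1) by (auto simp: fun_eq_iff simplical_face_def)
  show "split_right c (simplical_face j v) (Suc k) = split_right c v k"
    unfolding split_right_def s using assms(1) by (auto simp: fun_eq_iff simplical_face_def)
qed

text \<open>A zero inserted after the cut vertex belongs to the right part. That part starts with
  vertex \<open>k\<close>, whence the index \<open>j - k\<close>, which is never 0.\<close>

lemma split_simplical_face_gr: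
  assumes "k < j" "split_index c m v k"
  shows "split_index c (Suc m) (simplical_face j v) k"
    and "split_left c (simplical_face j v) k = split_left c v k"
    and "split_right c (simplical_face j v) k = simplical_face (j - k) (split_right c v k)"
proof -
  have s: "(\<Sum>l<k. simplical_face j v l) = (\<Sum>l<k. v l)"
    "(\<Sum>l<Suc k. simplical_face j v l) = (\<Sum>l<Suc k. v l)"
    using assms(1) unfolding sum_simplical_face by simp_all
  show "split_index c (Suc m) (simplical_face j v) k"
    using assms(2) unfolding split_index_def s by simp
  show "split_left c (simplical_face j v) k = split_left c v k"
    unfolding split_left_def s using assms(1) by (auto simp: fun_eq_iff simplical_face_def)
  show "split_right c (simplical_face j v) k = simplical_face (j - k) (split_right c v k)"
    unfolding split_right_def s
  proof
    fix l
    have "k + l - 1 = k + (l - 1)" if "l \<noteq> 0" using that by simp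
    then show "(if l = 0 then ((\<Sum>l<Suc k. v l) - c) / (1 - c) else simplical_face j v (k + l) / (1 - c)) =
      simplical_face (j - k) (\<lambda>j. if j = 0 then ((\<Sum>l<Suc k. v l) - c) / (1 - c) else v (k + j) / (1 - c)) l"
      using assms(1) by (auto simp: simplical_face_def)
  qed
qed

text \<open>In the critical case \<open>k = j\<close> the cut vertex absorbs its successor, and
  nonnegativity of \<open>v\<close> makes its interval grow to the right, so that \<open>c\<close>
  stays inside.\<close>

lemma split_codegen_le:
  assumes "k \<le> j" "j \<le> m" "split_index c (Suc m) v k" "\<And>l. 0 \<le> v l"
  shows "split_index c m (codegen j v) k"
    and "split_left c (codegen j v) k = split_left c v k"
    and "split_right c (codegen j v) k = codegen (j - k) (split_right c v k)"
proof -
  have s: "(\<Sum>l<k. codegen j v l) = (\<Sum>l<k. v l)"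
    using assms(1) unfolding sum_codegen by simp
  have s2: "(\<Sum>l<Suc k. codegen j v l) = (\<Sum>l<Suc k. v l) + (if k = j then v (Suc k) else 0)"
    using assms(1) unfolding sum_codegen by simp
  show "split_index c m (codegen j v) k"
    using assms unfolding split_index_def s s2 by (auto intro: add_increasing2)
  show "split_left c (codegen j v) k = split_left c v k"
    unfolding split_left_def s using assms(1) by (auto simp: fun_eq_iff codegen_def)
  show "split_right c (codegen j v) k = codegen (j - k) (split_right c v k)"
    unfolding split_right_def s2 using assms(1)
    by (auto simp: fun_eq_iff codegen_def add_divide_distrib diff_divide_distrib)
qed

text \<open>In the critical case \<open>k = j\<close> the cut vertex \<open>Suc k\<close> absorbs
  its predecessor, and its interval grows to the left.\<close>

lemma split_codegen_gr:
  assumes "j \<le> k" "j \<le> m" "split_index c (Suc m) v (Suc k)" "\<And>l. 0 \<le> v l"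
  shows "split_index c m (codegen j v) k"
    and "split_left c (codegen j v) k = codegen j (split_left c v (Suc k))"
    and "split_right c (codegen j v) k = split_right c v (Suc k)"
proof -
  have s: "(\<Sum>l<k. codegen j v l) = (\<Sum>l<Suc k. v l) - (if k = j then v k else 0)"
    using assms(1) unfolding sum_codegen by simp
  have s2: "(\<Sum>l<Suc k. codegen j v l) = (\<Sum>l<Suc (Suc k). v l)"
    using assms(1) unfolding sum_codegen by simp
  show "split_index c m (codegen j v) k"
    using assms(3) assms(4)[of k] unfolding split_index_def s s2 by auto
  show "split_left c (codegen j v) k = codegen j (split_left c v (Suc k))"
    unfolding split_left_def s using assms(1)
    by (auto simp: fun_eq_iff codegen_def add_divide_distrib diff_divide_distrib)
  show "split_right c (codegen j v) k = split_right c v (Suc k)"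
    unfolding split_right_def s2 using assms(1) by (auto simp: fun_eq_iff codegen_def)
qed

lemma block_start_update:
  assumes "i < length qs"
  shows "block_start (qs[i := v]) + qs ! i = block_start qs + v"
  using prism_offset_update(2)[OF assms assms, of v] by (simp add: prism_offset_def)

lemma prism_offset_block_start:
  assumes "i < length qs"
  shows "prism_offset qs i + qs ! i < block_start qs"
  using prism_offset_less[OF assms assms] by (simp add: prism_offset_def)

text \<open>A face in an earlier block leaves the cut alone. Its global index is below that of the
  doubling degeneracy, and the drop of the degeneracy index when the two are exchanged equals the
  drop of \<open>block_start\<close>.\<close>

lemma split_class_face_init:
  assumes X: "simplicial_set X" and c: "0 < c" "c < 1"
    and i: "i < length qs" "0 < qs ! i" "j \<le> qs ! i"
    and s: "s \<in> topspace (multi_simplex_top (qs[i := qs ! i - 1] @ [n]))"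
    and x: "x \<in> simplices X (block_start qs + n)"
    and k: "split_index c n (s (length qs)) k"
  shows "split_class X c qs n (s(i := simplical_face j (s i))) x k =
    split_class X c (qs[i := qs ! i - 1]) n s (face X (block_start qs + n) (prism_offset qs i + j) x) k"
proof -
  let ?qs = "qs[i := qs ! i - 1]" and ?L = "length qs" and ?Q = "block_start qs"
  have kn: "k \<le> n" using k by (simp add: split_index_def)
  have Q: "block_start ?qs = ?Q - 1" using block_start_update[OF i(1), of "qs ! i - 1"] i(2) by simp
  have o: "prism_offset qs i + j < ?Q" using prism_offset_block_start[OF i(1)] i(3) by simp
  have e: "prism_dim (qs @ [k, n - k]) = Suc (?Q + n)" "prism_offset (qs @ [k, n - k]) i = prism_offset qs i"
    "(qs @ [k, n - k]) ! i = qs ! i" "(qs @ [k, n - k])[i := qs ! i - 1] = ?qs @ [k, n - k]"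
    using i kn by (simp_all add: prism_dim_append prism_offset_append nth_append list_update_append2)
  have sp: "split_point c ?L s k \<in> topspace (multi_simplex_top (?qs @ [k, n - k]))"
    using split_point_multi_simplex[OF s c] k by simp
  have d: "degen X (?Q + n) (?Q + k) x \<in> simplices X (Suc (?Q + n))"
    using degen_in[OF X _ x] kn by simp
  have "split_class X c qs n (s(i := simplical_face j (s i))) x k = mrealization_class (Suc ?L) (prismatic X)
      (qs @ [k, n - k], (split_point c ?L s k)(i := simplical_face j (split_point c ?L s k i)), degen X (?Q + n) (?Q + k) x)"
    using i by (auto simp: split_class_def fun_eq_iff split_point_def intro!: arg_cong[where f = "mrealization_class (Suc ?L) (prismatic X)"])
  also have "\<dots> = mrealization_class (Suc ?L) (prismatic X)
      (?qs @ [k, n - k], split_point c ?L s k, face X (Suc (?Q + n)) (prism_offset qs i + j) (degen X (?Q + n) (?Q + k) x))"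
    using mrealization_class_face[OF X, of "qs @ [k, n - k]" "Suc ?L" i j "split_point c ?L s k" "degen X (?Q + n) (?Q + k) x",
        unfolded e] i sp d by simp
  also have "face X (Suc (?Q + n)) (prism_offset qs i + j) (degen X (?Q + n) (?Q + k) x) =
      degen X (?Q + n - 1) (?Q + k - 1) (face X (?Q + n) (prism_offset qs i + j) x)"
    using face_degen_less[OF X x] o kn by simp
  also have "mrealization_class (Suc ?L) (prismatic X) (?qs @ [k, n - k], split_point c ?L s k, \<dots>) =
      split_class X c ?qs n s (face X (?Q + n) (prism_offset qs i + j) x) k"
    unfolding split_class_def Q using o by simp
  finally show ?thesis .
qed

text \<open>Exchanging the two degeneracies raises the index of the doubling by one, which matches
  the lengthened block in front of it.\<close>

lemma split_class_degen_init:
  assumes X: "simplicial_set X" and c: "0 < c" "c < 1"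
    and i: "i < length qs" "j \<le> qs ! i"
    and s: "s \<in> topspace (multi_simplex_top (qs[i := Suc (qs ! i)] @ [n]))"
    and x: "x \<in> simplices X (block_start qs + n)"
    and k: "split_index c n (s (length qs)) k"
  shows "split_class X c qs n (s(i := codegen j (s i))) x k =
    split_class X c (qs[i := Suc (qs ! i)]) n s (degen X (block_start qs + n) (prism_offset qs i + j) x) k"
proof -
  let ?qs = "qs[i := Suc (qs ! i)]" and ?L = "length qs" and ?Q = "block_start qs"
  have kn: "k \<le> n" using k by (simp add: split_index_def)
  have Q: "block_start ?qs = Suc ?Q" using block_start_update[OF i(1), of "Suc (qs ! i)"] by simp
  have o: "prism_offset qs i + j < ?Q" using prism_offset_block_start[OF i(1)] i(2) by simp
  have e: "prism_dim (qs @ [k, n - k]) = Suc (?Q + n)" "prism_offset (qs @ [k, n - k]) i = prism_offset qs i"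
    "(qs @ [k, n - k]) ! i = qs ! i" "(qs @ [k, n - k])[i := Suc (qs ! i)] = ?qs @ [k, n - k]"
    using i kn by (simp_all add: prism_dim_append prism_offset_append nth_append list_update_append2)
  have sp: "split_point c ?L s k \<in> topspace (multi_simplex_top (?qs @ [k, n - k]))"
    using split_point_multi_simplex[OF s c] k by simp
  have d: "degen X (?Q + n) (?Q + k) x \<in> simplices X (Suc (?Q + n))"
    using degen_in[OF X _ x] kn by simp
  have "split_class X c qs n (s(i := codegen j (s i))) x k = mrealization_class (Suc ?L) (prismatic X)
      (qs @ [k, n - k], (split_point c ?L s k)(i := codegen j (split_point c ?L s k i)), degen X (?Q + n) (?Q + k) x)"
    using i by (auto simp: split_class_def fun_eq_iff split_point_def intro!: arg_cong[where f = "mrealization_class (Suc ?L) (prismatic X)"])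
  also have "\<dots> = mrealization_class (Suc ?L) (prismatic X)
      (?qs @ [k, n - k], split_point c ?L s k, degen X (Suc (?Q + n)) (prism_offset qs i + j) (degen X (?Q + n) (?Q + k) x))"
    using mrealization_class_degen[OF X, of "qs @ [k, n - k]" "Suc ?L" i j "split_point c ?L s k" "degen X (?Q + n) (?Q + k) x",
        unfolded e] i sp d by simp
  also have "degen X (Suc (?Q + n)) (prism_offset qs i + j) (degen X (?Q + n) (?Q + k) x) =
      degen X (Suc (?Q + n)) (Suc (?Q + k)) (degen X (?Q + n) (prism_offset qs i + j) x)"
    using degen_degen[OF X x] o kn by simp
  also have "mrealization_class (Suc ?L) (prismatic X) (?qs @ [k, n - k], split_point c ?L s k, \<dots>) =
      split_class X c ?qs n s (degen X (?Q + n) (prism_offset qs i + j) x) k"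
    unfolding split_class_def Q using o by simp
  finally show ?thesis .
qed

text \<open>The index is existentially quantified because a face in the last block can move the cut
  vertex. The cases are distinguished by the part receiving the inserted zero; the same operator
  then acts on that one of the two new blocks.\<close>

lemma split_class_face_last:
  assumes X: "simplicial_set X" and c: "0 < c" "c < 1" and j: "j \<le> Suc m"
    and s: "s \<in> topspace (multi_simplex_top (qs @ [m]))"
    and x: "x \<in> simplices X (Suc (block_start qs + m))"
    and k: "split_index c m (s (length qs)) k"
  shows "\<exists>k'. split_index c (Suc m) (simplical_face j (s (length qs))) k' \<and>
    split_class X c qs (Suc m) (s(length qs := simplical_face j (s (length qs)))) x k' =
    split_class X c qs m s (face X (Suc (block_start qs + m)) (block_start qs + j) x) k"
proof -
  let ?L = "length qs" and ?Q = "block_start qs"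
  let ?w = "split_point c ?L s k"
  define b where "b = m - k"
  have m: "m = k + b" using k by (simp add: split_index_def b_def)
  have w: "?w \<in> topspace (multi_simplex_top (qs @ [k, b]))"
    using split_point_multi_simplex[OF s c k] by (simp add: b_def)
  show ?thesis
  proof (cases "j \<le> k")
    case True
    note sp = split_simplical_face_le[OF True k]
    have d: "degen X (Suc (?Q + m)) (?Q + Suc k) x \<in> simplices X (Suc (?Q + Suc k + b))"
      using degen_in[OF X _ x, of "?Q + Suc k"] m by (simp add: add.assoc)
    have "face X (Suc (?Q + Suc k + b)) (?Q + j) (degen X (Suc (?Q + m)) (?Q + Suc k) x) =
        degen X (?Q + m) (?Q + k) (face X (Suc (?Q + m)) (?Q + j) x)"
      using face_degen_less[OF X x, of "?Q + j" "?Q + Suc k"] True m by (simp add: add.assoc)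
    moreover have "split_point c ?L (s(?L := simplical_face j (s ?L))) (Suc k) = ?w(?L := simplical_face j (?w ?L))"
      using sp(2,3) by (auto simp: fun_eq_iff split_point_def)
    ultimately have "split_class X c qs (Suc m) (s(?L := simplical_face j (s ?L))) x (Suc k) =
        split_class X c qs m s (face X (Suc (?Q + m)) (?Q + j) x) k"
      using mrealization_class_face_mid[OF X w _ d, of j] True m by (simp add: split_class_def)
    then show ?thesis using sp(1) by blast
  next
    case False
    then have jk: "k < j" by simp
    note sp = split_simplical_face_gr[OF jk k]
    have d: "degen X (Suc (?Q + m)) (?Q + k) x \<in> simplices X (Suc (?Q + k + Suc b))"
      using degen_in[OF X _ x, of "?Q + k"] m by (simp add: add.assoc)
    \<comment> \<open>The doubled vertex in front raises the global position of the zero to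
      \<open>Suc (?Q + j)\<close>; commuting the face past the degeneracy lowers it back to
      \<open>?Q + j\<close>.\<close>
    have "face X (Suc (?Q + k + Suc b)) (Suc (?Q + k) + (j - k)) (degen X (Suc (?Q + m)) (?Q + k) x) =
        degen X (?Q + m) (?Q + k) (face X (Suc (?Q + m)) (?Q + j) x)"
      using face_degen_greater[OF X x, of "?Q + k" "Suc (?Q + j)"] jk j m by (simp add: add.assoc)
    moreover have "split_point c ?L (s(?L := simplical_face j (s ?L))) k =
        ?w(Suc ?L := simplical_face (j - k) (?w (Suc ?L)))"
      using sp(2,3) by (auto simp: fun_eq_iff split_point_def)
    ultimately have "split_class X c qs (Suc m) (s(?L := simplical_face j (s ?L))) x k =
        split_class X c qs m s (face X (Suc (?Q + m)) (?Q + j) x) k"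
      using mrealization_class_face_last[OF X w _ d, of "j - k"] jk j m by (simp add: split_class_def)
    then show ?thesis using sp(1) by blast
  qed
qed

text \<open>The index is given on the larger simplex and transported down; it drops by one exactly
  when the codegeneracy acts left of the cut vertex, that is, for \<open>j < k\<close>.\<close>

lemma split_class_degen_last:
  assumes X: "simplicial_set X" and c: "0 < c" "c < 1" and j: "j \<le> m"
    and s: "s \<in> topspace (multi_simplex_top (qs @ [Suc m]))"
    and x: "x \<in> simplices X (block_start qs + m)"
    and k: "split_index c (Suc m) (s (length qs)) k"
  shows "\<exists>k'. split_index c m (codegen j (s (length qs))) k' \<and>
    split_class X c qs m (s(length qs := codegen j (s (length qs)))) x k' =
    split_class X c qs (Suc m) s (degen X (block_start qs + m) (block_start qs + j) x) k"
proof -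
  let ?L = "length qs" and ?Q = "block_start qs"
  let ?w = "split_point c ?L s k"
  have w: "?w \<in> topspace (multi_simplex_top (qs @ [k, Suc m - k]))"
    using split_point_multi_simplex[OF s c k] .
  have km: "k \<le> Suc m" using k by (simp add: split_index_def)
  have pos: "0 \<le> s ?L l" for l
    using s standard_simplexD(1) unfolding multi_simplex_append1 by blast
  show ?thesis
  proof (cases "k \<le> j")
    case True
    note sp = split_codegen_le[OF True j k pos]
    define b where "b = m - k"
    have m: "m = k + b" using True j by (simp add: b_def)
    have w': "?w \<in> topspace (multi_simplex_top (qs @ [k, Suc b]))" using w m by simp
    have d: "degen X (?Q + m) (?Q + k) x \<in> simplices X (Suc (?Q + k + b))"
      using degen_in[OF X _ x, of "?Q + k"] m by (simp add: add.assoc)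
    have "degen X (Suc (?Q + k + b)) (Suc (?Q + k) + (j - k)) (degen X (?Q + m) (?Q + k) x) =
        degen X (?Q + Suc m) (?Q + k) (degen X (?Q + m) (?Q + j) x)"
      using degen_degen[OF X x, of "?Q + k" "?Q + j"] True j m by (simp add: add.assoc)
    moreover have "split_point c ?L (s(?L := codegen j (s ?L))) k =
        ?w(Suc ?L := codegen (j - k) (?w (Suc ?L)))"
      using sp(2,3) by (auto simp: fun_eq_iff split_point_def)
    ultimately have "split_class X c qs m (s(?L := codegen j (s ?L))) x k =
        split_class X c qs (Suc m) s (degen X (?Q + m) (?Q + j) x) k"
      using mrealization_class_degen_last[OF X w' _ d, of "j - k"] True j m by (simp add: split_class_def)
    then show ?thesis using sp(1) by blast
  next
    case False
    then obtain k0 where k0: "k = Suc k0" "j \<le> k0" by (cases k) auto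
    note sp = split_codegen_gr[OF k0(2) j k[unfolded k0(1)] pos]
    define b where "b = m - k0"
    have m: "m = k0 + b" using km k0 by (simp add: b_def)
    have w': "?w \<in> topspace (multi_simplex_top (qs @ [Suc k0, b]))" using w m k0 by simp
    have d: "degen X (?Q + m) (?Q + k0) x \<in> simplices X (Suc (?Q + k0 + b))"
      using degen_in[OF X _ x, of "?Q + k0"] m by (simp add: add.assoc)
    have "degen X (Suc (?Q + k0 + b)) (?Q + j) (degen X (?Q + m) (?Q + k0) x) =
        degen X (?Q + Suc m) (?Q + k) (degen X (?Q + m) (?Q + j) x)"
      using degen_degen[OF X x, of "?Q + j" "?Q + k0"] k0 m by (simp add: add.assoc)
    moreover have "split_point c ?L (s(?L := codegen j (s ?L))) k0 = ?w(?L := codegen j (?w ?L))"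
      using sp(2,3) k0 by (auto simp: fun_eq_iff split_point_def)
    ultimately have "split_class X c qs m (s(?L := codegen j (s ?L))) x k0 =
        split_class X c qs (Suc m) s (degen X (?Q + m) (?Q + j) x) k"
      using mrealization_class_degen_mid[OF X w' _ d, of j] k0 m by (simp add: split_class_def)
    then show ?thesis using sp(1) by blast
  qed
qed

section \<open>Injectivity of \<open>\<lambda>\<^sub>p\<close> over the open simplex\<close>

text \<open>In each generating pair an index is chosen for the point \<open>s\<close> and
  transported to the other representative. Operators in an earlier block keep it, operators in the
  last block may move it.\<close>

lemma split_map_respects:
  assumes X: "simplicial_set X" and c: "0 < c" "c < 1"
    and r: "(u, v) \<in> mrealization_rel p (prismatic X)"
    and uv: "u \<in> topspace (mrealization_sum p (prismatic X))" "v \<in> topspace (mrealization_sum p (prismatic X))"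
  shows "split_map X c u = split_map X c v"
  using r unfolding mrealization_rel_def
proof (elim UnE CollectE exE conjE)
  fix q i j s x
  assume eq: "(u, v) = ((q, s(i := simplical_face j (s i)), x), (q[i := q ! i - 1], s, mface (prismatic X) q i j x))"
    and q: "length q = Suc p" "i \<le> p" "0 < q ! i" "j \<le> q ! i"
    and s: "s \<in> topspace (multi_simplex_top (q[i := q ! i - 1]))"
  obtain qs n where qs: "q = qs @ [n]" using q(1) by (cases q rule: rev_cases) auto
  then have p: "p = length qs" using q(1) by simp
  have s1: "s(i := simplical_face j (s i)) \<in> topspace (multi_simplex_top (qs @ [n]))"
    and x: "x \<in> simplices X (block_start qs + n)"
    and dx: "mface (prismatic X) q i j x \<in> simplices X (prism_dim (q[i := q ! i - 1]))"
    using uv eq qs p by (simp_all add: prism_dim_append del: topspace_product_topology)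
  show ?thesis
  proof (cases "i < p")
    case True
    let ?qs = "qs[i := qs ! i - 1]"
    have i: "i < length qs" "0 < qs ! i" "j \<le> qs ! i" using True p q qs by (auto simp: nth_append)
    have upd: "q[i := q ! i - 1] = ?qs @ [n]" using i qs by (simp add: nth_append list_update_append2)
    have s2: "s \<in> topspace (multi_simplex_top (?qs @ [n]))" using s unfolding upd .
    then have "s (length qs) \<in> standard_simplex n" unfolding multi_simplex_append1 by simp
    then obtain k where k: "split_index c n (s (length qs)) k"
      using split_index_exists[of "s (length qs)" n c] c by auto
    have mf: "mface (prismatic X) q i j x = face X (block_start qs + n) (prism_offset qs i + j) x"
      using qs i by (simp add: prismatic_def prism_dim_append prism_offset_append)
    have "split_map X c u = split_class X c qs n (s(i := simplical_face j (s i))) x k"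
      using split_map_eq[OF X s1 c x, of k] k i eq qs by simp
    also have "\<dots> = split_class X c ?qs n s (mface (prismatic X) q i j x) k"
      unfolding mf by (rule split_class_face_init[OF X c i s2 x k])
    also have "\<dots> = split_map X c v"
      using split_map_eq[OF X s2 c, of "mface (prismatic X) q i j x" k] k eq upd dx
      by (simp add: prism_dim_append)
    finally show ?thesis .
  next
    case False
    then have i: "i = length qs" using q p by simp
    obtain m where m: "n = Suc m" using q(3) qs i by (cases n) auto
    have upd: "q[i := q ! i - 1] = qs @ [m]" using i qs m by (simp add: list_update_append2)
    have s2: "s \<in> topspace (multi_simplex_top (qs @ [m]))" using s unfolding upd .
    then have "s (length qs) \<in> standard_simplex m" unfolding multi_simplex_append1 by simp
    then obtain k where k: "split_index c m (s (length qs)) k"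
      using split_index_exists[of "s (length qs)" m c] c by auto
    have mf: "mface (prismatic X) q i j x = face X (Suc (block_start qs + m)) (block_start qs + j) x"
      using qs i m by (simp add: prismatic_def prism_dim_append prism_offset_append)
    have j: "j \<le> Suc m" using q(4) i qs m by simp
    obtain k' where k': "split_index c (Suc m) (simplical_face j (s (length qs))) k'"
      "split_class X c qs (Suc m) (s(length qs := simplical_face j (s (length qs)))) x k' =
       split_class X c qs m s (face X (Suc (block_start qs + m)) (block_start qs + j) x) k"
      using split_class_face_last[OF X c j s2 _ k] x m by auto
    have "split_map X c u = split_class X c qs (Suc m) (s(length qs := simplical_face j (s (length qs)))) x k'"
      using split_map_eq[OF X s1 c x, of k'] k' i eq qs m by simp
    also have "\<dots> = split_class X c qs m s (mface (prismatic X) q i j x) k"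
      unfolding mf by (rule k'(2))
    also have "\<dots> = split_map X c v"
      using split_map_eq[OF X s2 c, of "mface (prismatic X) q i j x" k] k eq upd dx
      by (simp add: prism_dim_append)
    finally show ?thesis .
  qed
next
  fix q i j s x
  assume eq: "(u, v) = ((q, s(i := codegen j (s i)), x), (q[i := Suc (q ! i)], s, mdegen (prismatic X) q i j x))"
    and q: "length q = Suc p" "i \<le> p" "j \<le> q ! i"
    and s: "s \<in> topspace (multi_simplex_top (q[i := Suc (q ! i)]))"
  obtain qs n where qs: "q = qs @ [n]" using q(1) by (cases q rule: rev_cases) auto
  then have p: "p = length qs" using q(1) by simp
  have s1: "s(i := codegen j (s i)) \<in> topspace (multi_simplex_top (qs @ [n]))"
    and x: "x \<in> simplices X (block_start qs + n)"
    and dx: "mdegen (prismatic X) q i j x \<in> simplices X (prism_dim (q[i := Suc (q ! i)]))"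
    using uv eq qs p by (simp_all add: prism_dim_append del: topspace_product_topology)
  show ?thesis
  proof (cases "i < p")
    case True
    let ?qs = "qs[i := Suc (qs ! i)]"
    have i: "i < length qs" "j \<le> qs ! i" using True p q qs by (auto simp: nth_append)
    have upd: "q[i := Suc (q ! i)] = ?qs @ [n]" using i qs by (simp add: nth_append list_update_append2)
    have s2: "s \<in> topspace (multi_simplex_top (?qs @ [n]))" using s unfolding upd .
    then have "s (length qs) \<in> standard_simplex n" unfolding multi_simplex_append1 by simp
    then obtain k where k: "split_index c n (s (length qs)) k"
      using split_index_exists[of "s (length qs)" n c] c by auto
    have mf: "mdegen (prismatic X) q i j x = degen X (block_start qs + n) (prism_offset qs i + j) x"
      using qs i by (simp add: prismatic_def prism_dim_append prism_offset_append)
    have "split_map X c u = split_class X c qs n (s(i := codegen j (s i))) x k"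
      using split_map_eq[OF X s1 c x, of k] k i eq qs by simp
    also have "\<dots> = split_class X c ?qs n s (mdegen (prismatic X) q i j x) k"
      unfolding mf by (rule split_class_degen_init[OF X c i s2 x k])
    also have "\<dots> = split_map X c v"
      using split_map_eq[OF X s2 c, of "mdegen (prismatic X) q i j x" k] k eq upd dx
      by (simp add: prism_dim_append)
    finally show ?thesis .
  next
    case False
    then have i: "i = length qs" using q p by simp
    have upd: "q[i := Suc (q ! i)] = qs @ [Suc n]" using i qs by (simp add: list_update_append2)
    have s2: "s \<in> topspace (multi_simplex_top (qs @ [Suc n]))" using s unfolding upd .
    then have "s (length qs) \<in> standard_simplex (Suc n)" unfolding multi_simplex_append1 by simp
    then obtain k where k: "split_index c (Suc n) (s (length qs)) k"
      using split_index_exists[of "s (length qs)" "Suc n" c] c by auto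
    have mf: "mdegen (prismatic X) q i j x = degen X (block_start qs + n) (block_start qs + j) x"
      using qs i by (simp add: prismatic_def prism_dim_append prism_offset_append)
    have j: "j \<le> n" using q(3) i qs by simp
    obtain k' where k': "split_index c n (codegen j (s (length qs))) k'"
      "split_class X c qs n (s(length qs := codegen j (s (length qs)))) x k' =
       split_class X c qs (Suc n) s (degen X (block_start qs + n) (block_start qs + j) x) k"
      using split_class_degen_last[OF X c j s2 x k] by auto
    have "split_map X c u = split_class X c qs n (s(length qs := codegen j (s (length qs)))) x k'"
      using split_map_eq[OF X s1 c x, of k'] k' i eq qs by simp
    also have "\<dots> = split_class X c qs (Suc n) s (mdegen (prismatic X) q i j x) k"
      unfolding mf by (rule k'(2))
    also have "\<dots> = split_map X c v"
      using split_map_eq[OF X s2 c, of "mdegen (prismatic X) q i j x" k] k eq upd dx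
      by (simp add: prism_dim_append)
    finally show ?thesis .
  qed
qed

section \<open>The case of a single block\<close>

definition one_block :: "(nat \<Rightarrow> real) \<Rightarrow> nat \<Rightarrow> nat \<Rightarrow> real" where
  "one_block r = (\<lambda>i. if i = 0 then r else undefined)"

text \<open>On classes this is the inverse of \<lambda> over the single point of the
  0-simplex.\<close>

definition one_block_class :: "'a sset \<Rightarrow> nat \<times> (nat \<Rightarrow> real) \<times> 'a \<Rightarrow> 'a mpoint set" where
  "one_block_class X = (\<lambda>(n, r, x). mrealization_class 0 (prismatic X) ([n], one_block r, x))"

lemma one_block_multi_simplex:
  "one_block r \<in> topspace (multi_simplex_top [n]) \<longleftrightarrow> r \<in> standard_simplex n"
  by (auto simp: one_block_def PiE_iff extensional_def)

lemma prism_dim_one_block [simp]: "prism_dim [n] = n"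
  by (simp add: prism_dim_def)

lemma one_block_class_respects:
  assumes X: "simplicial_set X" and r: "(u, v) \<in> realization_rel X"
  shows "one_block_class X u = one_block_class X v"
  using r unfolding realization_rel_def
proof (elim UnE CollectE exE conjE)
  fix n i t x
  assume eq: "(u, v) = ((Suc n, simplical_face i t, x), (n, t, face X (Suc n) i x))"
    and i: "i \<le> Suc n" and t: "t \<in> standard_simplex n" and x: "x \<in> simplices X (Suc n)"
  have "one_block (simplical_face i t) = (one_block t)(0 := simplical_face i (one_block t 0))"
    by (auto simp: one_block_def)
  then show ?thesis
    using mrealization_class_face[OF X, of "[Suc n]" 0 0 i "one_block t" x] eq i t x one_block_multi_simplex[of t n]
    by (simp add: one_block_class_def del: topspace_product_topology)
next
  fix n j t x
  assume eq: "(u, v) = ((n, codegen j t, x), (Suc n, t, degen X n j x))"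
    and j: "j \<le> n" and t: "t \<in> standard_simplex (Suc n)" and x: "x \<in> simplices X n"
  have "one_block (codegen j t) = (one_block t)(0 := codegen j (one_block t 0))"
    by (auto simp: one_block_def)
  then show ?thesis
    using mrealization_class_degen[OF X, of "[n]" 0 0 j "one_block t" x] eq j t x one_block_multi_simplex[of t "Suc n"]
    by (simp add: one_block_class_def del: topspace_product_topology)
qed

lemma prism_join_one_block:
  assumes "t \<in> standard_simplex 0" "s \<in> topspace (multi_simplex_top [n])"
  shows "prism_join [n] t s = s 0"
proof (rule prism_join_eqI)
  have "s 0 \<in> standard_simplex n" using assms(2) by (auto simp: PiE_iff)
  then show "s 0 k = 0" if "prism_offset [n] (length [n]) \<le> k" for k
    using that standard_simplexD(2) by (simp add: prism_offset_def)
qed (use assms(1) in \<open>simp add: standard_simplex_0\<close>)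

lemma one_block_eq: "s \<in> topspace (multi_simplex_top [n]) \<Longrightarrow> one_block (s 0) = s"
  by (auto simp: one_block_def PiE_iff extensional_def fun_eq_iff)

text \<open>Over the 0-simplex joining changes nothing, so the invariant
  \<open>one_block_class\<close> recovers the class from its image.\<close>

lemma prism_lambda_0_inj:
  assumes X: "simplicial_set X" and t: "t \<in> standard_simplex 0"
  shows "inj_on (prism_lambda X t) (topspace (prism_space X 0))"
  unfolding topspace_prism_space
proof (rule inj_onI, elim imageE)
  fix y y' u v
  assume y: "y = mrealization_class 0 (prismatic X) u" "y' = mrealization_class 0 (prismatic X) v"
    and u: "u \<in> topspace (mrealization_sum 0 (prismatic X))" and v: "v \<in> topspace (mrealization_sum 0 (prismatic X))"
    and eq: "prism_lambda X t y = prism_lambda X t y'"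
  have *: "\<exists>n s x. u = ([n], s, x) \<and> s \<in> topspace (multi_simplex_top [n]) \<and> x \<in> simplices X n"
    if "u \<in> topspace (mrealization_sum 0 (prismatic X))" for u
    using that by (cases u) (auto simp: length_Suc_conv simp del: topspace_product_topology)
  obtain n s x where u': "u = ([n], s, x)" "s \<in> topspace (multi_simplex_top [n])" "x \<in> simplices X n"
    using *[OF u] by blast
  obtain n' s' x' where v': "v = ([n'], s', x')" "s' \<in> topspace (multi_simplex_top [n'])" "x' \<in> simplices X n'"
    using *[OF v] by blast
  have s0: "s 0 \<in> standard_simplex n" "s' 0 \<in> standard_simplex n'" using u' v' by (auto simp: PiE_iff)
  have "realization_class X (n, s 0, x) = realization_class X (n', s' 0, x')"
    using eq unfolding y u' v'
    using prism_lambda_class[OF X t u[unfolded u']] prism_lambda_class[OF X t v[unfolded v']]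
      prism_join_one_block[OF t u'(2)] prism_join_one_block[OF t v'(2)] by simp
  then have "one_block_class X (n, s 0, x) = one_block_class X (n', s' 0, x')"
    unfolding realization_class_def
    by (rule quotient_class_eqD) (use s0 u' v' one_block_class_respects[OF X] in auto)
  then show "y = y'"
    using y u' v' one_block_eq[OF u'(2)] one_block_eq[OF v'(2)] by (simp add: one_block_class_def)
qed

section \<open>Induction on the number of blocks\<close>

text \<open>Merging is applied to representatives; the map that has to respect the relations is the
  one going back, \<open>split_map\<close>.\<close>

definition merge_rep :: "nat \<Rightarrow> real \<Rightarrow> 'a mpoint \<Rightarrow> 'a mpoint" where
  "merge_rep p c = (\<lambda>(q, s, x). (take p q @ [Suc (q ! p + q ! Suc p)], merge_blocks p (q ! p) c s, x))"

lemma merge_rep_append: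
  "merge_rep (length qs) c (qs @ [a, b], s, x) = (qs @ [Suc (a + b)], merge_blocks (length qs) a c s, x)"
  by (simp add: merge_rep_def nth_append)

lemma prismatic_sum_cases:
  assumes "u \<in> topspace (mrealization_sum (Suc p) (prismatic X))"
  obtains qs a b s x where "u = (qs @ [a, b], s, x)" "p = length qs"
    "s \<in> topspace (multi_simplex_top (qs @ [a, b]))" "x \<in> simplices X (Suc (block_start qs + a + b))"
proof -
  obtain q s x where u: "u = (q, s, x)" by (cases u) auto
  then have q: "length q = Suc (Suc p)" and s: "s \<in> topspace (multi_simplex_top q)"
    and x: "x \<in> simplices X (prism_dim q)"
    using assms unfolding u mem_prismatic_sum by blast+
  obtain q' b where q': "q = q' @ [b]" using q by (cases q rule: rev_cases) auto
  then obtain qs a where "q' = qs @ [a]" using q by (cases q' rule: rev_cases) auto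
  with q' have "q = qs @ [a, b]" by simp
  then show ?thesis using that u q s x by (simp add: prism_dim_append del: topspace_product_topology)
qed

lemma merge_rep_topspace:
  assumes "0 \<le> c" "c \<le> 1" "u \<in> topspace (mrealization_sum (Suc p) (prismatic X))"
  shows "merge_rep p c u \<in> topspace (mrealization_sum p (prismatic X))"
  using assms(3)
proof (rule prismatic_sum_cases)
  fix qs a b s x
  assume u: "u = (qs @ [a, b], s, x)" "p = length qs"
    and s: "s \<in> topspace (multi_simplex_top (qs @ [a, b]))"
    and x: "x \<in> simplices X (Suc (block_start qs + a + b))"
  show ?thesis
    unfolding u merge_rep_append using merge_blocks_multi_simplex[OF assms(1,2) s] x
    by (simp add: prism_dim_append add.assoc del: topspace_product_topology)
qed

text \<open>This factorisation carries both inductions on \<open>p\<close>, for injectivity and for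
  the quotient property.\<close>

lemma prism_lambda_merge:
  assumes X: "simplicial_set X" and t: "t \<in> standard_simplex p" and c: "0 \<le> c" "c \<le> 1"
    and u: "u \<in> topspace (mrealization_sum (Suc p) (prismatic X))"
  shows "prism_lambda X (subdivide p c t) (mrealization_class (Suc p) (prismatic X) u) =
    prism_lambda X t (mrealization_class p (prismatic X) (merge_rep p c u))"
  using u
proof (rule prismatic_sum_cases)
  fix qs a b s x
  assume u': "u = (qs @ [a, b], s, x)" "p = length qs"
  note m = merge_rep_topspace[OF c u]
  show ?thesis
    using prism_lambda_class[OF X subdivide_simplex[OF c t] u[unfolded u'(1)]]
      prism_lambda_class[OF X t m[unfolded u'(1), unfolded u'(2) merge_rep_append, folded u'(2)]]
    unfolding u'(1) by (simp add: u'(2) merge_rep_append prism_join_merge_blocks prism_dim_append add.assoc)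
qed

lemma prism_lambda_inj:
  assumes X: "simplicial_set X"
  shows "t \<in> standard_simplex p \<Longrightarrow> (\<And>i. i \<le> p \<Longrightarrow> 0 < t i) \<Longrightarrow>
    inj_on (prism_lambda X t) (topspace (prism_space X p))"
proof (induction p arbitrary: t)
  case 0
  then show ?case using prism_lambda_0_inj[OF X] by simp
next
  case (Suc p)
  \<comment> \<open>\<open>t'\<close> adds the last two coordinates of \<open>t\<close>, and
    \<open>c\<close> is the share of the first of them. Both being positive, \<open>c\<close> lies
    strictly between 0 and 1, where splitting undoes merging.\<close>
  define t' where "t' = codegen p t"
  define c where "c = t p / (t p + t (Suc p))"
  have pos: "0 < t p" "0 < t (Suc p)" using Suc.prems(2) by auto
  have c: "0 < c" "c < 1" and c': "0 \<le> c" "c \<le> 1" using pos by (simp_all add: c_def field_simps)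
  have t': "t' \<in> standard_simplex p" unfolding t'_def using Suc.prems(1) by (intro codegen_standard_simplex) auto
  have t'pos: "0 < t' i" if "i \<le> p" for i
    using Suc.prems(2) pos that by (auto simp: t'_def codegen_def intro: add_pos_pos)
  have cp: "c * (t p + t (Suc p)) = t p" using pos by (simp add: c_def)
  then have "(1 - c) * (t p + t (Suc p)) = t (Suc p)" by (simp add: left_diff_distrib)
  then have t: "t = subdivide p c t'"
    using cp standard_simplexD(2)[OF Suc.prems(1)]
    by (auto simp: fun_eq_iff subdivide_def t'_def codegen_def)
  show ?case
    unfolding topspace_prism_space
  proof (rule inj_onI, elim imageE)
    fix y y' u v
    assume y: "y = mrealization_class (Suc p) (prismatic X) u" "y' = mrealization_class (Suc p) (prismatic X) v"
      and u: "u \<in> topspace (mrealization_sum (Suc p) (prismatic X))"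
      and v: "v \<in> topspace (mrealization_sum (Suc p) (prismatic X))"
      and eq: "prism_lambda X t y = prism_lambda X t y'"
    note mu = merge_rep_topspace[OF c' u] and mv = merge_rep_topspace[OF c' v]
    have "prism_lambda X t' (mrealization_class p (prismatic X) (merge_rep p c u)) =
        prism_lambda X t' (mrealization_class p (prismatic X) (merge_rep p c v))"
      using eq prism_lambda_merge[OF X t' c' u] prism_lambda_merge[OF X t' c' v] unfolding y t by simp
    then have "mrealization_class p (prismatic X) (merge_rep p c u) =
        mrealization_class p (prismatic X) (merge_rep p c v)"
      using Suc.IH[OF t' t'pos] mu mv unfolding topspace_prism_space inj_on_def by blast
    \<comment> \<open>The induction hypothesis identifies the merged classes; the invariant
      \<open>split_map\<close> returns from them to the original ones.\<close>
    then have "split_map X c (merge_rep p c u) = split_map X c (merge_rep p c v)"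
      unfolding mrealization_class_def
      by (rule quotient_class_eqD) (use mu mv split_map_respects[OF X c] in auto)
    moreover have "split_map X c (merge_rep p c u) = mrealization_class (Suc p) (prismatic X) u"
      if u: "u \<in> topspace (mrealization_sum (Suc p) (prismatic X))" for u
      using u by (rule prismatic_sum_cases) (simp add: merge_rep_append split_map_merge[OF X c])
    ultimately show "y = y'" using u v y by simp
  qed
qed

section \<open>The maps \<open>(id, \<lambda>\<^sub>p)\<close> are quotient maps\<close>

text \<open>Here a continuous section \<open>?g\<close> is explicit, and a retraction is a quotient
  map. Its continuity is checked before passing to classes in \<open>realization X\<close>, which is
  legitimate beside the compact factor.\<close>

lemma prism_lambda_0_quotient:
  assumes X: "simplicial_set X"
  shows "quotient_map (prod_topology (simplex_top 0) (prism_space X 0)) (prod_topology (simplex_top 0) (realization X))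
    (\<lambda>(t, y). (t, prism_lambda X t y))"
proof (rule retraction_imp_quotient_map)
  let ?T = "simplex_top 0"
  let ?g = "\<lambda>(t, z). (t, induced (one_block_class X) z)"
  have K: "induced (one_block_class X) (realization_class X u) = one_block_class X u"
    if "u \<in> topspace (realization_sum X)" for u
    unfolding realization_class_def
    using that one_block_class_respects[OF X] by (rule induced_quotient_class)
  have contf: "continuous_map (prod_topology ?T (prism_space X 0)) (prod_topology ?T (realization X))
      (\<lambda>(t, y). (t, prism_lambda X t y))"
    using continuous_map_prism_lambda[OF X, of 0] by (simp add: case_prod_unfold continuous_map_paired continuous_map_fst)
  have "continuous_map (prod_topology ?T (realization_sum X)) (prism_space X 0) (\<lambda>(t, u). one_block_class X u)"
    unfolding realization_sum_def
  proof (rule continuous_map_prod_sum_topology)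
    fix n
    have "continuous_map (prod_topology ?T (prod_topology (simplex_top n) (discrete_topology (simplices X n))))
        (mrealization_sum 0 (prismatic X)) (\<lambda>(t, r, x). ([n], one_block r, x))"
    proof (rule continuous_map_prod_discrete_topology)
      fix x assume x: "x \<in> simplices X n"
      have "continuous_map (prod_topology ?T (simplex_top n)) (multi_simplex_top [n]) (\<lambda>(t, r). one_block r)"
      proof (rule continuous_map_multi_simplex)
        fix i k assume "i < length [n]"
        then show "continuous_map (prod_topology ?T (simplex_top n)) euclideanreal (\<lambda>z. (case z of (t, r) \<Rightarrow> one_block r) i k)"
          using continuous_map_compose[OF continuous_map_snd continuous_map_simplex_coord]
          by (simp add: one_block_def case_prod_unfold o_def)
      qed (use one_block_multi_simplex in force)
      moreover have "x \<in> msimplices (prismatic X) [n]" using x by (simp add: prismatic_def)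
      moreover have "[n] \<in> {q. length q = Suc 0}" by simp
      ultimately show "continuous_map (prod_topology ?T (simplex_top n)) (mrealization_sum 0 (prismatic X))
          (\<lambda>(t, s). case (t, s, x) of (t, r, x) \<Rightarrow> ([n], one_block r, x))"
        using continuous_map_compose[OF _ continuous_map_component_injection[of "[n]" "{q. length q = Suc 0}"
            "\<lambda>q. prod_topology (multi_simplex_top q) (discrete_topology (msimplices (prismatic X) q))"],
            of "prod_topology ?T (simplex_top n)" "\<lambda>(t, r). (one_block r, x)"]
        by (simp add: mrealization_sum_def case_prod_unfold o_def continuous_map_paired del: length_Cons)
    qed
    then show "continuous_map (prod_topology ?T (prod_topology (simplex_top n) (discrete_topology (simplices X n))))
        (prism_space X 0) (\<lambda>(t, y). case (t, n, y) of (t, u) \<Rightarrow> one_block_class X u)"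
      using continuous_map_compose[OF _ quotient_imp_continuous_map[OF quotient_map_mrealization_class]]
      by (force simp: one_block_class_def case_prod_unfold o_def)
  qed
  then have "continuous_map (prod_topology ?T (realization_sum X)) (prod_topology ?T (prism_space X 0))
      (\<lambda>(t, u). (t, one_block_class X u))"
    by (simp add: case_prod_unfold continuous_map_paired continuous_map_fst)
  then have "continuous_map (prod_topology ?T (realization_sum X)) (prod_topology ?T (prism_space X 0))
      (?g \<circ> (\<lambda>(t, u). (t, realization_class X u)))"
    by (rule continuous_map_eq) (auto simp: K)
  then have contg: "continuous_map (prod_topology ?T (realization X)) (prod_topology ?T (prism_space X 0)) ?g"
    using quotient_map_prod_compact_Hausdorff[OF compact_space_simplex_top Hausdorff_space_simplex_top
        quotient_map_realization_class, of 0 X]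
    by (rule continuous_compose_quotient_map[rotated])
  have "prism_lambda X t (induced (one_block_class X) z) = z"
    if t: "t \<in> standard_simplex 0" and z: "z \<in> topspace (realization X)" for t z
  proof -
    obtain n r x where u: "r \<in> standard_simplex n" "x \<in> simplices X n" "z = realization_class X (n, r, x)"
      using z unfolding topspace_realization by auto
    have s: "one_block r \<in> topspace (multi_simplex_top [n])" using u(1) by (simp only: one_block_multi_simplex)
    have "prism_lambda X t (one_block_class X (n, r, x)) = realization_class X (n, prism_join [n] t (one_block r), x)"
      unfolding one_block_class_def
      using prism_lambda_class[OF X t, of "[n]" "one_block r" x] s u by (simp del: topspace_product_topology)
    then show ?thesis
      using K[of "(n, r, x)"] u prism_join_one_block[OF t s] by (simp add: one_block_def)
  qed
  then show "retraction_map (prod_topology ?T (prism_space X 0)) (prod_topology ?T (realization X))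
      (\<lambda>(t, y). (t, prism_lambda X t y))"
    unfolding retraction_map_def retraction_maps_def using contf contg by (intro exI[of _ ?g]) auto
qed

section \<open>Merging as a quotient map\<close>

text \<open>Merging followed by the codegeneracy that reunites the two halves of the doubled vertex
  \<open>k\<close>; it maps prisms with last blocks \<open>k\<close>, \<open>n - k\<close> to prisms
  with last block \<open>n\<close>.\<close>

definition collapse :: "nat \<Rightarrow> nat \<Rightarrow> real \<Rightarrow> (nat \<Rightarrow> nat \<Rightarrow> real) \<Rightarrow> nat \<Rightarrow> nat \<Rightarrow> real" where
  "collapse L k c w = (merge_blocks L k c w)(L := codegen k (merge_blocks L k c w L))"

abbreviation unit_interval :: "real topology" where
  "unit_interval \<equiv> subtopology euclideanreal {0..1}"

lemma compact_space_unit_interval: "compact_space unit_interval"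
  by (simp add: compact_space_subtopology)

lemma Hausdorff_space_unit_interval: "Hausdorff_space unit_interval"
  by (simp add: Hausdorff_space_subtopology)

lemma continuous_map_collapse:
  assumes "k \<le> n"
  shows "continuous_map (prod_topology unit_interval (multi_simplex_top (qs @ [k, n - k])))
    (multi_simplex_top (qs @ [n])) (\<lambda>(c, w). collapse (length qs) k c w)"
proof (rule continuous_map_multi_simplex)
  let ?Z = "prod_topology unit_interval (multi_simplex_top (qs @ [k, n - k]))" and ?L = "length qs"
  have c: "continuous_map ?Z euclideanreal (\<lambda>z. fst z)"
    using continuous_map_fst[of unit_interval] continuous_map_into_fulltopology by blast
  have w: "continuous_map ?Z euclideanreal (\<lambda>z. snd z i j)" if "i < Suc (Suc ?L)" for i j
    using continuous_map_compose[OF continuous_map_snd continuous_map_multi_simplex_coord, of i "qs @ [k, n - k]" _ j] that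
    by (force simp: o_def)
  have wm: "continuous_map ?Z euclideanreal (\<lambda>z. fst z * snd z ?L j)"
    "continuous_map ?Z euclideanreal (\<lambda>z. (1 - fst z) * snd z (Suc ?L) j)" for j
    using c w by (intro continuous_map_real_mult continuous_map_diff; simp)+
  have wm2: "continuous_map ?Z euclideanreal (\<lambda>z. fst z * snd z ?L j + (1 - fst z) * snd z (Suc ?L) j')" for j j'
    using wm by (intro continuous_map_add)
  fix i j assume "i < length (qs @ [n])"
  then consider "i < ?L" | "i = ?L" by fastforce
  then show "continuous_map ?Z euclideanreal (\<lambda>z. (case z of (c, w) \<Rightarrow> collapse ?L k c w) i j)"
  proof cases
    case 1
    then show ?thesis using w by (simp add: collapse_def merge_blocks_def case_prod_unfold)
  next
    case 2
    then show ?thesis using w wm wm2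
      by (cases j k rule: linorder_cases)
        (simp_all add: collapse_def merge_blocks_def join2_def codegen_def case_prod_unfold)
  qed
next
  fix z assume z: "z \<in> topspace (prod_topology unit_interval (multi_simplex_top (qs @ [k, n - k])))"
  obtain c w where cw: "z = (c, w)" "0 \<le> c" "c \<le> 1" "w \<in> topspace (multi_simplex_top (qs @ [k, n - k]))"
    using z by (cases z) auto
  have "merge_blocks (length qs) k c w \<in> topspace (multi_simplex_top (qs @ [Suc n]))"
    using merge_blocks_multi_simplex[OF cw(2-4)] assms by simp
  then show "(case z of (c, w) \<Rightarrow> collapse (length qs) k c w) \<in> topspace (multi_simplex_top (qs @ [n]))"
    using codegen_standard_simplex[OF assms] unfolding multi_simplex_append1 cw(1)
    by (auto simp: collapse_def extensional_def)
qed

text \<open>For every height, the ends of \<open>[0,1]\<close> included, the finitely many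
  \<open>k \<le> n\<close> cover the whole target prism. This covering takes the place of a
  continuous section of merging.\<close>

lemma collapse_surj:
  assumes s: "s \<in> topspace (multi_simplex_top (qs @ [n]))" and c: "0 \<le> c" "c \<le> 1"
  obtains k w where "k \<le> n" "w \<in> topspace (multi_simplex_top (qs @ [k, n - k]))"
    "collapse (length qs) k c w = s"
proof -
  let ?L = "length qs"
  have "s ?L \<in> standard_simplex n" using s unfolding multi_simplex_append1 by blast
  then obtain k A B where k: "k \<le> n" "A \<in> standard_simplex k" "B \<in> standard_simplex (n - k)"
    "codegen k (join2 k c A B) = s ?L"
    using codegen_join2_surj[OF _ c] by metis
  show thesis
  proof (rule that)
    show "s(?L := A, Suc ?L := B) \<in> topspace (multi_simplex_top (qs @ [k, n - k]))"
      using s k unfolding multi_simplex_append1 multi_simplex_append2 by (auto simp: extensional_def)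
    show "collapse ?L k c (s(?L := A, Suc ?L := B)) = s"
      using s k(4) unfolding multi_simplex_append1
      by (auto simp: collapse_def merge_blocks_def fun_eq_iff extensional_def)
  qed (rule k(1))
qed

text \<open>This is the degeneracy relation at the merged block: the degeneracy on \<open>x\<close>
  is traded for the codegeneracy in \<open>collapse\<close>.\<close>

lemma merge_rep_collapse:
  assumes X: "simplicial_set X" and k: "k \<le> n" and c: "0 \<le> c" "c \<le> 1"
    and w: "w \<in> topspace (multi_simplex_top (qs @ [k, n - k]))"
    and x: "x \<in> simplices X (block_start qs + n)"
  shows "mrealization_class (length qs) (prismatic X)
      (merge_rep (length qs) c (qs @ [k, n - k], w, degen X (block_start qs + n) (block_start qs + k) x)) =
    mrealization_class (length qs) (prismatic X) (qs @ [n], collapse (length qs) k c w, x)"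
proof -
  have "merge_blocks (length qs) k c w \<in> topspace (multi_simplex_top (qs @ [Suc n]))"
    using merge_blocks_multi_simplex[OF c w] k by simp
  then show ?thesis
    using mrealization_class_degen[OF X, of "qs @ [n]" "length qs" "length qs" k "merge_blocks (length qs) k c w" x] k x
    by (simp add: merge_rep_append collapse_def prism_dim_append prism_offset_append list_update_append2
        del: topspace_product_topology)
qed

lemma continuous_map_merge_blocks:
  "continuous_map (prod_topology unit_interval (multi_simplex_top (qs @ [a, b])))
    (multi_simplex_top (qs @ [Suc (a + b)])) (\<lambda>(c, w). merge_blocks (length qs) a c w)"
proof (rule continuous_map_multi_simplex)
  let ?Z = "prod_topology unit_interval (multi_simplex_top (qs @ [a, b]))" and ?L = "length qs"
  have c: "continuous_map ?Z euclideanreal (\<lambda>z. fst z)"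
    using continuous_map_fst[of unit_interval] continuous_map_into_fulltopology by blast
  have w: "continuous_map ?Z euclideanreal (\<lambda>z. snd z i j)" if "i < Suc (Suc ?L)" for i j
    using continuous_map_compose[OF continuous_map_snd continuous_map_multi_simplex_coord, of i "qs @ [a, b]" _ j] that
    by (force simp: o_def)
  have wm: "continuous_map ?Z euclideanreal (\<lambda>z. fst z * snd z ?L j)"
    "continuous_map ?Z euclideanreal (\<lambda>z. (1 - fst z) * snd z (Suc ?L) j)" for j
    using c w by (intro continuous_map_real_mult continuous_map_diff; simp)+
  fix i j assume "i < length (qs @ [Suc (a + b)])"
  then consider "i < ?L" | "i = ?L" by fastforce
  then show "continuous_map ?Z euclideanreal (\<lambda>z. (case z of (c, w) \<Rightarrow> merge_blocks ?L a c w) i j)"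
    using w wm by cases (auto simp: merge_blocks_def join2_def case_prod_unfold)
next
  fix z assume z: "z \<in> topspace (prod_topology unit_interval (multi_simplex_top (qs @ [a, b])))"
  obtain c w where cw: "z = (c, w)" "0 \<le> c" "c \<le> 1" "w \<in> topspace (multi_simplex_top (qs @ [a, b]))"
    using z by (cases z) auto
  then show "(case z of (c, w) \<Rightarrow> merge_blocks (length qs) a c w) \<in> topspace (multi_simplex_top (qs @ [Suc (a + b)]))"
    using merge_blocks_multi_simplex by simp
qed

lemma continuous_map_mrealization_class:
  assumes "continuous_map Z (multi_simplex_top q) f" "length q = Suc p" "x \<in> simplices X (prism_dim q)"
  shows "continuous_map Z (prism_space X p) (\<lambda>z. mrealization_class p (prismatic X) (q, f z, x))"
proof -
  have "continuous_map Z (mrealization_sum p (prismatic X)) (\<lambda>z. (q, f z, x))"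
    unfolding mrealization_sum_def
    using continuous_map_compose[OF _ continuous_map_component_injection[of q "{q. length q = Suc p}"
        "\<lambda>q. prod_topology (multi_simplex_top q) (discrete_topology (msimplices (prismatic X) q))"],
        of Z "\<lambda>z. (f z, x)"] assms
    by (simp add: o_def prismatic_def continuous_map_paired)
  then show ?thesis
    using continuous_map_compose[OF _ quotient_imp_continuous_map[OF quotient_map_mrealization_class]]
    by (force simp: o_def)
qed

lemma continuous_map_merge_rep_class:
  "continuous_map (prod_topology unit_interval (mrealization_sum (Suc p) (prismatic X))) (prism_space X p)
    (\<lambda>(c, u). mrealization_class p (prismatic X) (merge_rep p c u))"
proof (subst (1) mrealization_sum_def, rule continuous_map_prod_sum_topology)
  fix q :: "nat list" assume "q \<in> {q. length q = Suc (Suc p)}"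
  then have len: "length q = Suc (Suc p)" by simp
  then obtain q' b where q': "q = q' @ [b]" by (cases q rule: rev_cases) auto
  then obtain qs a where "q' = qs @ [a]" using len by (cases q' rule: rev_cases) auto
  with q' len have q: "q = qs @ [a, b]" and p: "p = length qs" by auto
  show "continuous_map (prod_topology unit_interval
      (prod_topology (multi_simplex_top q) (discrete_topology (msimplices (prismatic X) q))))
      (prism_space X p) (\<lambda>(t, y). case (t, q, y) of (c, u) \<Rightarrow> mrealization_class p (prismatic X) (merge_rep p c u))"
  proof (rule continuous_map_prod_discrete_topology)
    fix x assume "x \<in> msimplices (prismatic X) q"
    then have x: "x \<in> simplices X (prism_dim (qs @ [Suc (a + b)]))"
      by (simp add: prismatic_def q prism_dim_append add.assoc)
    have len: "length (qs @ [Suc (a + b)]) = Suc p" using p by simp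
    show "continuous_map (prod_topology unit_interval (multi_simplex_top q)) (prism_space X p)
        (\<lambda>(t, s). case (t, s, x) of (t, y) \<Rightarrow> case (t, q, y) of (c, u) \<Rightarrow>
          mrealization_class p (prismatic X) (merge_rep p c u))"
      using continuous_map_mrealization_class[OF continuous_map_merge_blocks len x]
      by (simp add: q p merge_rep_append case_prod_unfold del: length_append)
  qed
qed

text \<open>It remains to see that a set with closed preimage is closed. Over one prism it is a
  union over \<open>k \<le> n\<close> of images of closed sets under closed maps, closed because
  their sources are compact and their target is Hausdorff.\<close>

lemma merge_rep_quotient:
  assumes X: "simplicial_set X"
  shows "quotient_map (prod_topology unit_interval (mrealization_sum (Suc p) (prismatic X)))
    (prod_topology unit_interval (prism_space X p))
    (\<lambda>(c, u). (c, mrealization_class p (prismatic X) (merge_rep p c u)))"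
  (is "quotient_map ?S ?Y ?\<Phi>")
  unfolding quotient_map_closedin
proof (intro conjI allI impI)
  let ?M = "mrealization_sum p (prismatic X)" and ?cl = "mrealization_class p (prismatic X)"
  have cont: "continuous_map ?S ?Y ?\<Phi>"
    using continuous_map_merge_rep_class[of p X]
    by (simp add: case_prod_unfold continuous_map_paired continuous_map_fst)
  have last_block: "\<exists>qs n s x. u = (qs @ [n], s, x) \<and> p = length qs \<and>
      s \<in> topspace (multi_simplex_top (qs @ [n])) \<and> x \<in> simplices X (block_start qs + n)"
    if u: "u \<in> topspace ?M" for u
  proof -
    obtain q s x where u': "u = (q, s, x)" by (cases u) auto
    then have q: "length q = Suc p" "s \<in> topspace (multi_simplex_top q)" "x \<in> simplices X (prism_dim q)"
      using u unfolding u' mem_prismatic_sum by blast+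
    obtain qs n where "q = qs @ [n]" using q(1) by (cases q rule: rev_cases) auto
    then show ?thesis using u' q by (auto simp: prism_dim_append simp del: topspace_product_topology)
  qed
  have rep: "(qs @ [k, n - k], w, degen X (block_start qs + n) (block_start qs + k) x)
      \<in> topspace (mrealization_sum (Suc p) (prismatic X))"
    if "p = length qs" "k \<le> n" "w \<in> topspace (multi_simplex_top (qs @ [k, n - k]))"
      "x \<in> simplices X (block_start qs + n)" for qs k n w x
    using that degen_in[OF X, of "block_start qs + k" "block_start qs + n" x]
    by (simp add: prism_dim_append add.assoc del: topspace_product_topology)
  show "?\<Phi> ` topspace ?S = topspace ?Y"
  proof
    show "?\<Phi> ` topspace ?S \<subseteq> topspace ?Y"
      using cont by (rule continuous_map_image_subset_topspace)
    show "topspace ?Y \<subseteq> ?\<Phi> ` topspace ?S"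
    proof
      fix z assume "z \<in> topspace ?Y"
      then obtain c u where z: "z = (c, ?cl u)" "0 \<le> c" "c \<le> 1" "u \<in> topspace ?M"
        by (auto simp: topspace_prism_space)
      obtain qs n s x where u: "u = (qs @ [n], s, x)" "p = length qs"
          "s \<in> topspace (multi_simplex_top (qs @ [n]))" "x \<in> simplices X (block_start qs + n)"
        using last_block[OF z(4)] by blast
      obtain k w where k: "k \<le> n" "w \<in> topspace (multi_simplex_top (qs @ [k, n - k]))"
          "collapse (length qs) k c w = s"
        using collapse_surj[OF u(3) z(2,3)] .
      let ?u = "(qs @ [k, n - k], w, degen X (block_start qs + n) (block_start qs + k) x)"
      have "z = ?\<Phi> (c, ?u)"
        using merge_rep_collapse[OF X k(1) z(2,3) k(2) u(4)] z(1) u k(3) by simp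
      moreover have "(c, ?u) \<in> topspace ?S"
        using rep[OF u(2) k(1,2) u(4)] z(2,3) by (simp del: mem_prismatic_sum)
      ultimately show "z \<in> ?\<Phi> ` topspace ?S" by blast
    qed
  qed
  fix U assume U: "U \<subseteq> topspace ?Y"
  show "closedin ?S {z \<in> topspace ?S. ?\<Phi> z \<in> U} = closedin ?Y U"
  proof
    assume "closedin ?Y U"
    then show "closedin ?S {z \<in> topspace ?S. ?\<Phi> z \<in> U}"
      using cont by (rule closedin_continuous_map_preimage[rotated])
  next
    assume cl: "closedin ?S {z \<in> topspace ?S. ?\<Phi> z \<in> U}"
    \<comment> \<open>Closedness of \<open>U\<close> is tested on the sum of prisms, because the
      class map times the identity of \<open>[0,1]\<close> is a quotient map.\<close>
    let ?W = "{z \<in> topspace (prod_topology unit_interval ?M). (\<lambda>(c, u). (c, ?cl u)) z \<in> U}"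
    have "closedin (prod_topology unit_interval ?M) ?W"
      unfolding mrealization_sum_def
    proof (rule closedin_prod_sum_discrete, fold mrealization_sum_def)
      fix q x assume "q \<in> {q. length q = Suc p}" and "x \<in> msimplices (prismatic X) q"
      then have len: "length q = Suc p" and x': "x \<in> simplices X (prism_dim q)"
        by (simp_all add: prismatic_def)
      then obtain qs n where q: "q = qs @ [n]" and p: "p = length qs"
        by (cases q rule: rev_cases) auto
      have x: "x \<in> simplices X (block_start qs + n)" using x' q by (simp add: prism_dim_append)
      \<comment> \<open>\<open>D k\<close> is the part of the given closed preimage visible in the
        prism of \<open>x\<close> with vertex \<open>k\<close> of its last block doubled;
        \<open>F k\<close> carries it to the prism of \<open>x\<close> itself.\<close>
      define D where "D k = {z \<in> topspace (prod_topology unit_interval (multi_simplex_top (qs @ [k, n - k]))).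
          (\<lambda>(c, w). (c, ?cl (merge_rep p c (qs @ [k, n - k], w, degen X (block_start qs + n) (block_start qs + k) x)))) z \<in> U}" for k
      define F where "F k = (\<lambda>(c, w). (c, collapse p k c w))" for k
      have Dcl: "closedin (prod_topology unit_interval (multi_simplex_top (qs @ [k, n - k]))) (D k)"
        if k: "k \<le> n" for k
      proof -
        let ?Z = "prod_topology unit_interval (multi_simplex_top (qs @ [k, n - k]))"
        let ?j = "\<lambda>(c, w). (c, qs @ [k, n - k], w, degen X (block_start qs + n) (block_start qs + k) x)"
        have "degen X (block_start qs + n) (block_start qs + k) x \<in> msimplices (prismatic X) (qs @ [k, n - k])"
          using degen_in[OF X _ x] k by (simp add: prismatic_def prism_dim_append add.assoc)
        moreover have "qs @ [k, n - k] \<in> {q. length q = Suc (Suc p)}" using p by simp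
        ultimately have "continuous_map ?Z ?S ?j"
          using continuous_map_compose[OF _ continuous_map_component_injection[of "qs @ [k, n - k]" "{q. length q = Suc (Suc p)}"
            "\<lambda>q. prod_topology (multi_simplex_top q) (discrete_topology (msimplices (prismatic X) q))"],
            of ?Z "\<lambda>(c, w). (w, degen X (block_start qs + n) (block_start qs + k) x)"]
          by (simp add: mrealization_sum_def case_prod_unfold o_def continuous_map_paired continuous_map_fst
              continuous_map_snd del: length_append)
        from closedin_continuous_map_preimage[OF this cl]
        have "closedin ?Z {z \<in> topspace ?Z. ?j z \<in> {z \<in> topspace ?S. ?\<Phi> z \<in> U}}" .
        also have "{z \<in> topspace ?Z. ?j z \<in> {z \<in> topspace ?S. ?\<Phi> z \<in> U}} = D k"
          unfolding D_def using rep[OF p k _ x] by (auto simp del: topspace_product_topology mem_prismatic_sum)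
        finally show ?thesis .
      qed
      have "closedin (prod_topology unit_interval (multi_simplex_top q)) (F k ` D k)" if k: "k \<le> n" for k
      proof -
        have "closed_map (prod_topology unit_interval (multi_simplex_top (qs @ [k, n - k])))
            (prod_topology unit_interval (multi_simplex_top q)) (F k)"
        proof (rule continuous_imp_closed_map)
          show "continuous_map (prod_topology unit_interval (multi_simplex_top (qs @ [k, n - k])))
            (prod_topology unit_interval (multi_simplex_top q)) (F k)"
            using continuous_map_collapse[OF k, of qs]
            by (simp add: F_def q p case_prod_unfold continuous_map_paired continuous_map_fst del: length_append)
        qed (simp_all add: compact_space_prod_topology compact_space_unit_interval compact_space_multi_simplex_top
            Hausdorff_space_prod_topology Hausdorff_space_unit_interval Hausdorff_space_multi_simplex_top del: length_append)
        then show ?thesis using Dcl[OF k] unfolding closed_map_def by blast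
      qed
      then have "closedin (prod_topology unit_interval (multi_simplex_top q)) (\<Union>k\<le>n. F k ` D k)"
        by (intro closedin_Union) auto
      \<comment> \<open>Both inclusions compare classes by \<open>merge_rep_collapse\<close>; the
        second also needs the covering \<open>collapse_surj\<close>.\<close>
      also have "(\<Union>k\<le>n. F k ` D k) = {(c, s). (c, q, s, x) \<in> ?W}"
      proof (intro Set.set_eqI iffI)
        fix z assume "z \<in> (\<Union>k\<le>n. F k ` D k)"
        then obtain k c w where k: "k \<le> n" and cw: "(c, w) \<in> D k" and z: "z = (c, collapse p k c w)"
          by (auto simp: F_def)
        have c: "0 \<le> c" "c \<le> 1" and w: "w \<in> topspace (multi_simplex_top (qs @ [k, n - k]))"
          using cw unfolding D_def by auto
        have "collapse p k c w \<in> topspace (multi_simplex_top q)"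
          using continuous_map_image_subset_topspace[OF continuous_map_collapse[OF k, of qs]] c w q p
          by (force simp del: topspace_product_topology)
        moreover have "(c, ?cl (q, collapse p k c w, x)) \<in> U"
          using cw merge_rep_collapse[OF X k c w x] unfolding D_def q p by simp
        ultimately show "z \<in> {(c, s). (c, q, s, x) \<in> ?W}"
          using z c len x' by (simp del: topspace_product_topology)
      next
        fix z assume "z \<in> {(c, s). (c, q, s, x) \<in> ?W}"
        then obtain c s where z: "z = (c, s)" and c: "0 \<le> c" "c \<le> 1"
          and s: "s \<in> topspace (multi_simplex_top (qs @ [n]))" and inU: "(c, ?cl (q, s, x)) \<in> U"
          using q by (auto simp del: topspace_product_topology)
        obtain k w where k: "k \<le> n" "w \<in> topspace (multi_simplex_top (qs @ [k, n - k]))"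
            "collapse (length qs) k c w = s"
          using collapse_surj[OF s c] .
        then have "(c, w) \<in> D k"
          using merge_rep_collapse[OF X k(1) c k(2) x] inU c unfolding D_def q p by simp
        moreover have "z = F k (c, w)" using z k(3) p by (simp add: F_def)
        ultimately show "z \<in> (\<Union>k\<le>n. F k ` D k)" using k(1) by blast
      qed
      finally show "closedin (prod_topology unit_interval (multi_simplex_top q)) {(c, s). (c, q, s, x) \<in> ?W}" .
    qed auto
    moreover have "quotient_map (prod_topology unit_interval ?M) ?Y (\<lambda>(c, u). (c, ?cl u))"
      by (intro quotient_map_prod_compact_Hausdorff compact_space_unit_interval Hausdorff_space_unit_interval
          quotient_map_mrealization_class)
    ultimately show "closedin ?Y U" using U unfolding quotient_map_closedin by blast
  qed
qed

section \<open>The inductive step for the quotient property\<close>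

lemma quotient_map_swap_left:
  "quotient_map (prod_topology A (prod_topology B C)) (prod_topology B (prod_topology A C)) (\<lambda>(a, b, c). (b, a, c))"
proof (rule retraction_imp_quotient_map)
  have c: "continuous_map (prod_topology A (prod_topology B C)) (prod_topology B (prod_topology A C)) (\<lambda>(a, b, c). (b, a, c))"
    for A :: "'d topology" and B :: "'e topology" and C :: "'f topology"
    using continuous_map_compose[OF continuous_map_snd[of A "prod_topology B C"] continuous_map_fst[of B C]]
      continuous_map_compose[OF continuous_map_snd[of A "prod_topology B C"] continuous_map_snd[of B C]]
    by (simp add: case_prod_unfold continuous_map_paired continuous_map_fst o_def)
  show "retraction_map (prod_topology A (prod_topology B C)) (prod_topology B (prod_topology A C)) (\<lambda>(a, b, c). (b, a, c))"
    unfolding retraction_map_def retraction_maps_def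
    by (intro exI[of _ "\<lambda>(b, a, c). (a, b, c)"] conjI c) auto
qed

lemma quotient_map_assoc:
  "quotient_map (prod_topology A (prod_topology B C)) (prod_topology (prod_topology A B) C) (\<lambda>(a, b, c). ((a, b), c))"
proof (rule retraction_imp_quotient_map)
  have c: "continuous_map (prod_topology A (prod_topology B C)) (prod_topology (prod_topology A B) C) (\<lambda>(a, b, c). ((a, b), c))"
    using continuous_map_compose[OF continuous_map_snd[of A "prod_topology B C"] continuous_map_fst[of B C]]
      continuous_map_compose[OF continuous_map_snd[of A "prod_topology B C"] continuous_map_snd[of B C]]
    by (simp add: case_prod_unfold continuous_map_paired continuous_map_fst o_def)
  have d: "continuous_map (prod_topology (prod_topology A B) C) (prod_topology A (prod_topology B C)) (\<lambda>((a, b), c). (a, b, c))"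
    using continuous_map_compose[OF continuous_map_fst[of "prod_topology A B" C] continuous_map_fst[of A B]]
      continuous_map_compose[OF continuous_map_fst[of "prod_topology A B" C] continuous_map_snd[of A B]]
    by (simp add: case_prod_unfold continuous_map_paired continuous_map_snd o_def)
  show "retraction_map (prod_topology A (prod_topology B C)) (prod_topology (prod_topology A B) C) (\<lambda>(a, b, c). ((a, b), c))"
    unfolding retraction_map_def retraction_maps_def
    by (intro exI[of _ "\<lambda>((a, b), c). (a, b, c)"] conjI c d) auto
qed

text \<open>A proper map stays closed after multiplication with any space, so \<open>C\<close> may
  be \<open>realization X\<close>.\<close>

lemma quotient_map_prod_proper:
  assumes "compact_space A" "Hausdorff_space B" "continuous_map A B f" "f ` topspace A = topspace B"
  shows "quotient_map (prod_topology A C) (prod_topology B C) (\<lambda>(a, c). (f a, c))"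
proof (rule continuous_closed_imp_quotient_map)
  have "proper_map A B f"
    using assms by (intro continuous_imp_proper_map Hausdorff_imp_kc_space)
  then have "proper_map (prod_topology A C) (prod_topology B C) (\<lambda>(a, c). (f a, c))"
    unfolding proper_map_prod using proper_map_id[unfolded id_def] by blast
  then show "closed_map (prod_topology A C) (prod_topology B C) (\<lambda>(a, c). (f a, c))"
    by (rule proper_imp_closed_map)
  show "continuous_map (prod_topology A C) (prod_topology B C) (\<lambda>(a, c). (f a, c))"
    using continuous_map_compose[OF continuous_map_fst assms(3)]
    by (simp add: case_prod_unfold continuous_map_paired continuous_map_snd o_def)
  show "(\<lambda>(a, c). (f a, c)) ` topspace (prod_topology A C) = topspace (prod_topology B C)"
    using assms(4) by force
qed

lemma subdivide_codegen:
  assumes "t \<in> standard_simplex (Suc p)"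
  obtains c where "0 \<le> c" "c \<le> 1" "t = subdivide p c (codegen p t)"
proof
  note t = standard_simplexD[OF assms]
  \<comment> \<open>If both coordinates vanish, division by zero yields \<open>c = 0\<close>, and
    the equations below still hold.\<close>
  define c where "c = t p / (t p + t (Suc p))"
  show "0 \<le> c" "c \<le> 1"
    using t(1)[of p] t(1)[of "Suc p"] by (auto simp: c_def divide_le_eq_1)
  have cp: "c * (t p + t (Suc p)) = t p"
    using t(1)[of p] t(1)[of "Suc p"] by (cases "t p + t (Suc p) = 0") (auto simp: c_def)
  then have "(1 - c) * (t p + t (Suc p)) = t (Suc p)" by (simp add: left_diff_distrib)
  then show "t = subdivide p c (codegen p t)"
    using cp t(2) by (auto simp: fun_eq_iff subdivide_def codegen_def)
qed

lemma continuous_map_subdivide: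
  "continuous_map (prod_topology unit_interval (simplex_top p)) (simplex_top (Suc p)) (\<lambda>(c, t). subdivide p c t)"
proof (rule continuous_map_simplex_top)
  let ?Z = "prod_topology unit_interval (simplex_top p)"
  have c: "continuous_map ?Z euclideanreal (\<lambda>z. fst z)"
    using continuous_map_fst[of unit_interval] continuous_map_into_fulltopology by blast
  have t: "continuous_map ?Z euclideanreal (\<lambda>z. snd z k)" for k
    using continuous_map_compose[OF continuous_map_snd continuous_map_simplex_coord] by (force simp: o_def)
  have "continuous_map ?Z euclideanreal (\<lambda>z. fst z * snd z p)"
    "continuous_map ?Z euclideanreal (\<lambda>z. (1 - fst z) * snd z p)"
    using c t by (intro continuous_map_real_mult continuous_map_diff; simp)+
  then show "continuous_map ?Z euclideanreal (\<lambda>z. (case z of (c, t) \<Rightarrow> subdivide p c t) k)" for k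
    using t by (simp add: case_prod_unfold subdivide_def)
next
  fix z assume "z \<in> topspace (prod_topology unit_interval (simplex_top p))"
  then show "(case z of (c, t) \<Rightarrow> subdivide p c t) \<in> standard_simplex (Suc p)"
    by (auto intro: subdivide_simplex)
qed

lemma prism_lambda_quotient:
  assumes X: "simplicial_set X"
  shows "quotient_map (prod_topology (simplex_top p) (prism_space X p)) (prod_topology (simplex_top p) (realization X))
    (\<lambda>(t, y). (t, prism_lambda X t y))"
proof (induction p)
  case 0
  show ?case by (rule prism_lambda_0_quotient[OF X])
next
  case (Suc p)
  let ?T = "simplex_top p" and ?T' = "simplex_top (Suc p)" and ?R = "realization X"
  let ?M = "mrealization_sum (Suc p) (prismatic X)"
  \<comment> \<open>The factors are permuted so that every map acts beside a compact one: merging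
    beside the simplex, \<lambda> beside \<open>[0,1]\<close>. Subdivision comes last and is
    proper.\<close>
  let ?g1 = "\<lambda>(t, z). (t, (\<lambda>(c, u). (c, mrealization_class p (prismatic X) (merge_rep p c u))) z)"
  let ?g2 = "\<lambda>(t, c, y). (c, t, y)"
  let ?g3 = "\<lambda>(c, z). (c, (\<lambda>(t, y). (t, prism_lambda X t y)) z)"
  let ?g4 = "\<lambda>(c, t, y). ((c, t), y)"
  let ?g5 = "\<lambda>(z, y). ((\<lambda>(c, t). subdivide p c t) z, y)"
  let ?h = "\<lambda>(t, c, u). (subdivide p c t, mrealization_class (Suc p) (prismatic X) u)"
  note [intro] = compact_space_simplex_top Hausdorff_space_simplex_top
    compact_space_unit_interval Hausdorff_space_unit_interval
  have q1: "quotient_map (prod_topology ?T (prod_topology unit_interval ?M))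
      (prod_topology ?T (prod_topology unit_interval (prism_space X p))) ?g1"
    by (intro quotient_map_prod_compact_Hausdorff merge_rep_quotient X) auto
  have q2: "quotient_map (prod_topology ?T (prod_topology unit_interval (prism_space X p)))
      (prod_topology unit_interval (prod_topology ?T (prism_space X p))) ?g2"
    by (rule quotient_map_swap_left)
  have q3: "quotient_map (prod_topology unit_interval (prod_topology ?T (prism_space X p)))
      (prod_topology unit_interval (prod_topology ?T ?R)) ?g3"
    by (intro quotient_map_prod_compact_Hausdorff Suc.IH) auto
  have q4: "quotient_map (prod_topology unit_interval (prod_topology ?T ?R))
      (prod_topology (prod_topology unit_interval ?T) ?R) ?g4"
    by (rule quotient_map_assoc)
  have q5: "quotient_map (prod_topology (prod_topology unit_interval ?T) ?R) (prod_topology ?T' ?R) ?g5"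
  proof (rule quotient_map_prod_proper)
    show "(\<lambda>(c, t). subdivide p c t) ` topspace (prod_topology unit_interval ?T) = topspace ?T'"
    proof
      show "topspace ?T' \<subseteq> (\<lambda>(c, t). subdivide p c t) ` topspace (prod_topology unit_interval ?T)"
      proof
        fix t assume "t \<in> topspace ?T'"
        then have t: "t \<in> standard_simplex (Suc p)" by simp
        then obtain c where "0 \<le> c" "c \<le> 1" "t = subdivide p c (codegen p t)" by (rule subdivide_codegen)
        moreover have "codegen p t \<in> standard_simplex p" using t by (intro codegen_standard_simplex) auto
        ultimately show "t \<in> (\<lambda>(c, t). subdivide p c t) ` topspace (prod_topology unit_interval ?T)"
          by (intro image_eqI[of _ _ "(c, codegen p t)"]) auto
      qed
    qed (rule continuous_map_image_subset_topspace[OF continuous_map_subdivide])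
  qed (auto simp: compact_space_prod_topology intro: continuous_map_subdivide)
  have "quotient_map (prod_topology ?T (prod_topology unit_interval ?M)) (prod_topology ?T' ?R)
      (?g5 \<circ> (?g4 \<circ> (?g3 \<circ> (?g2 \<circ> ?g1))))"
    by (intro quotient_map_compose[OF _ q5] quotient_map_compose[OF _ q4] quotient_map_compose[OF _ q3]
        quotient_map_compose[OF q1 q2])
  \<comment> \<open>By \<open>prism_lambda_merge\<close> the chain equals the map in question after
    the continuous \<open>?h\<close>; the outer factor of a composite quotient map inherits the
    property.\<close>
  then have q: "quotient_map (prod_topology ?T (prod_topology unit_interval ?M)) (prod_topology ?T' ?R)
      ((\<lambda>(t, y). (t, prism_lambda X t y)) \<circ> ?h)"
    by (rule quotient_map_eq) (auto simp: prism_lambda_merge[OF X])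
  have "continuous_map (prod_topology ?T (prod_topology unit_interval ?M)) ?T' (\<lambda>(t, c, u). subdivide p c t)"
  proof -
    have "continuous_map (prod_topology ?T (prod_topology unit_interval ?M)) (prod_topology unit_interval ?T)
        (\<lambda>(t, c, u). (c, t))"
      using continuous_map_compose[OF continuous_map_snd[of ?T "prod_topology unit_interval ?M"]
          continuous_map_fst[of unit_interval ?M]]
      by (simp add: case_prod_unfold continuous_map_paired continuous_map_fst o_def)
    from continuous_map_compose[OF this continuous_map_subdivide] show ?thesis
      by (simp add: case_prod_unfold o_def)
  qed
  moreover have "continuous_map (prod_topology ?T (prod_topology unit_interval ?M)) (prism_space X (Suc p))
      (\<lambda>(t, c, u). mrealization_class (Suc p) (prismatic X) u)"
    using continuous_map_compose[OF continuous_map_snd[of ?T "prod_topology unit_interval ?M"]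
        continuous_map_compose[OF continuous_map_snd[of unit_interval ?M]
          quotient_imp_continuous_map[OF quotient_map_mrealization_class]]]
    by (simp add: case_prod_unfold o_def)
  ultimately have h: "continuous_map (prod_topology ?T (prod_topology unit_interval ?M))
      (prod_topology ?T' (prism_space X (Suc p))) ?h"
    by (simp add: case_prod_unfold continuous_map_paired)
  have "continuous_map (prod_topology ?T' (prism_space X (Suc p))) (prod_topology ?T' ?R) (\<lambda>(t, y). (t, prism_lambda X t y))"
    using continuous_map_prism_lambda[OF X, of "Suc p"]
    by (simp add: case_prod_unfold continuous_map_paired continuous_map_fst)
  with h show ?case using q by (rule quotient_map_from_composition)
qed

section \<open>Fat realizations\<close>

lemma mem_fat_sum [simp]:
  "(p, t, y) \<in> topspace (fat_sum Y) \<longleftrightarrow> t \<in> standard_simplex p \<and> y \<in> topspace (Y p)"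
  by (simp add: fat_sum_def)

lemma topspace_fat_realization:
  "topspace (fat_realization Y \<delta>) = fat_class Y \<delta> ` topspace (fat_sum Y)"
  unfolding fat_realization_def fat_class_def by (rule topspace_quotient_space_image)

lemma quotient_map_fat_class:
  "quotient_map (fat_sum Y) (fat_realization Y \<delta>) (fat_class Y \<delta>)"
  unfolding fat_realization_def fat_class_def by (rule quotient_map_quotient_class)

lemma fat_class_face:
  assumes "i \<le> Suc p" "t \<in> standard_simplex p" "y \<in> topspace (Y (Suc p))" "\<delta> (Suc p) i y \<in> topspace (Y p)"
  shows "fat_class Y \<delta> (Suc p, simplical_face i t, y) = fat_class Y \<delta> (p, t, \<delta> (Suc p) i y)"
  unfolding fat_class_def
proof (rule quotient_class_eq)
  show "((Suc p, simplical_face i t, y), (p, t, \<delta> (Suc p) i y)) \<in> fat_rel Y \<delta>"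
    using assms unfolding fat_rel_def by blast
qed (use assms in \<open>simp_all add: simplical_face_standard_simplex\<close>)

text \<open>A vanishing coordinate exhibits \<open>t\<close> as a coface, and the relation then
  lowers \<open>p\<close>. The descent ends at the latest at the 0-simplex, whose only point is
  interior.\<close>

lemma fat_class_interior:
  assumes \<delta>: "\<And>p i y. i \<le> Suc p \<Longrightarrow> y \<in> topspace (Y (Suc p)) \<Longrightarrow> \<delta> (Suc p) i y \<in> topspace (Y p)"
  shows "t \<in> standard_simplex p \<Longrightarrow> y \<in> topspace (Y p) \<Longrightarrow>
    \<exists>p' t' y'. t' \<in> standard_simplex p' \<and> (\<forall>i\<le>p'. 0 < t' i) \<and> y' \<in> topspace (Y p') \<and>
      fat_class Y \<delta> (p, t, y) = fat_class Y \<delta> (p', t', y')"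
proof (induction p arbitrary: t y)
  case 0
  then show ?case by (intro exI[of _ 0] exI[of _ t] exI[of _ y]) (simp add: standard_simplex_0)
next
  case (Suc p)
  show ?case
  proof (cases "\<forall>i\<le>Suc p. 0 < t i")
    case True
    then show ?thesis using Suc.prems by blast
  next
    case False
    note t = standard_simplexD[OF Suc.prems(1)]
    obtain i where i: "i \<le> Suc p" "t i = 0" using False t(1) by (metis order_le_less)
    \<comment> \<open>Adding the zero coordinate \<open>i\<close> to a neighbour deletes it. The
      neighbour is the next coordinate or, for the last index \<open>Suc p\<close>, the previous
      one, whence the minimum.\<close>
    define t0 where "t0 = codegen (min i p) t"
    have t0: "t0 \<in> standard_simplex p"
      unfolding t0_def using Suc.prems(1) by (intro codegen_standard_simplex) auto
    have "t = simplical_face i t0"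
    proof
      fix k
      show "t k = simplical_face i t0 k"
      proof (cases "i \<le> p")
        case True
        then show ?thesis
          using i(2) by (cases k i rule: linorder_cases) (auto simp: t0_def codegen_def simplical_face_def)
      next
        case False
        then have "i = Suc p" using i(1) by simp
        then show ?thesis using i(2) t(2)
          by (cases k p rule: linorder_cases) (auto simp: t0_def codegen_def simplical_face_def)
      qed
    qed
    then have "fat_class Y \<delta> (Suc p, t, y) = fat_class Y \<delta> (p, t0, \<delta> (Suc p) i y)"
      using fat_class_face[of i p t0 y Y \<delta>] i(1) t0 Suc.prems(2) \<delta> by simp
    then show ?thesis using Suc.IH[OF t0 \<delta>[OF i(1) Suc.prems(2)]] by simp
  qed
qed

text \<open>Deleting the zeros of \<open>t\<close> gives an invariant of the points of the fat realization of a constant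
  \<open>\<Delta>\<close>-space.\<close>

definition support_list :: "nat \<times> (nat \<Rightarrow> real) \<times> 'b \<Rightarrow> real list \<times> 'b" where
  "support_list = (\<lambda>(p, t, y). (filter (\<lambda>r. r \<noteq> 0) (map t [0..<Suc p]), y))"

lemma support_list_simplical_face:
  assumes "i \<le> Suc p"
  shows "support_list (Suc p, simplical_face i t, y) = support_list (p, t, y)"
proof -
  have "[0..<Suc (Suc p)] = [0..<i] @ i # map Suc [i..<Suc p]"
    using assms upt_add_eq_append[of 0 i "Suc (Suc p) - i"] by (simp add: upt_conv_Cons map_Suc_upt del: upt_Suc)
  then have "map (simplical_face i t) [0..<Suc (Suc p)] = map t [0..<i] @ 0 # map t [i..<Suc p]"
    by (simp add: simplical_face_def del: upt_Suc)
  moreover have "map t [0..<Suc p] = map t [0..<i] @ map t [i..<Suc p]"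
    using assms upt_add_eq_append[of 0 i "Suc p - i"] by (simp del: upt_Suc flip: map_append)
  ultimately show ?thesis by (simp add: support_list_def del: upt_Suc)
qed

lemma support_list_interior:
  assumes "\<forall>i\<le>p. 0 < t i"
  shows "support_list (p, t, y) = (map t [0..<Suc p], y)"
  using assms by (fastforce simp: support_list_def filter_id_conv less_Suc_eq_le simp del: upt_Suc)

text \<open>For positive coordinates the filter in \<open>support_list\<close> removes nothing, so
  the invariant returns \<open>p\<close> through the length of the list and \<open>t\<close> through
  its entries.\<close>

lemma const_fat_class_interior_eq:
  assumes "fat_class (\<lambda>_. Y) (\<lambda>_ _. id) (p, t, y) = fat_class (\<lambda>_. Y) (\<lambda>_ _. id) (p', t', y')"
    and t: "t \<in> standard_simplex p" "\<forall>i\<le>p. 0 < t i" and t': "t' \<in> standard_simplex p'" "\<forall>i\<le>p'. 0 < t' i"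
    and y: "y \<in> topspace Y" "y' \<in> topspace Y"
  shows "p = p' \<and> t = t' \<and> y = y'"
proof -
  have "support_list (p, t, y) = support_list (p', t', y')"
    using assms(1) unfolding fat_class_def
    by (rule quotient_class_eqD) (use t t' y in \<open>auto simp: fat_rel_def support_list_simplical_face\<close>)
  then have m: "map t [0..<Suc p] = map t' [0..<Suc p']" and yy: "y = y'"
    using support_list_interior[OF t(2), of y] support_list_interior[OF t'(2), of y'] by auto
  have pp: "p = p'" using arg_cong[OF m, of length] by simp
  have "t k = t' k" if "k \<le> p" for k
    using m that unfolding pp map_eq_conv by auto
  moreover have "t k = t' k" if "\<not> k \<le> p" for k
    using that standard_simplexD(2)[OF t(1)] standard_simplexD(2)[OF t'(1)] pp by simp
  ultimately show ?thesis using pp yy by blast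
qed

section \<open>Contracting the constant fat realization\<close>

text \<open>The point at time \<open>u\<close> on the segment from \<open>t\<close> to the cone
  vertex \<open>Suc p\<close>. Numbering the cone vertex last makes coning commute with the cofaces
  without reindexing them.\<close>

definition cone_coords :: "nat \<Rightarrow> real \<Rightarrow> (nat \<Rightarrow> real) \<Rightarrow> nat \<Rightarrow> real" where
  "cone_coords p u t = (\<lambda>k. (1 - u) * t k + (if k = Suc p then u else 0))"

lemma cone_coords_simplex:
  assumes "0 \<le> u" "u \<le> 1" "t \<in> standard_simplex p"
  shows "cone_coords p u t \<in> standard_simplex (Suc p)"
proof (rule standard_simplexI)
  note t = standard_simplexD[OF assms(3)]
  show "0 \<le> cone_coords p u t i" for i using t(1) assms by (simp add: cone_coords_def)
  show "cone_coords p u t i = 0" if "Suc p < i" for i using that t(2) by (simp add: cone_coords_def)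
  have "(\<Sum>i\<le>p. cone_coords p u t i) = (\<Sum>i\<le>p. (1 - u) * t i)"
    by (intro sum.cong) (auto simp: cone_coords_def)
  also have "\<dots> = 1 - u" using t(3) by (simp add: sum_distrib_left[symmetric])
  finally show "(\<Sum>i\<le>Suc p. cone_coords p u t i) = 1"
    using t(2) by (simp add: cone_coords_def)
qed

lemma cone_coords_simplical_face: "i \<le> Suc p \<Longrightarrow> cone_coords (Suc p) u (simplical_face i t) = simplical_face i (cone_coords p u t)"
  by (auto simp: cone_coords_def simplical_face_def fun_eq_iff)

lemma cone_coords_0: "t \<in> standard_simplex p \<Longrightarrow> cone_coords p 0 t = simplical_face (Suc p) t"
  using standard_simplexD(2)[of t p] by (auto simp: cone_coords_def simplical_face_def fun_eq_iff)

definition vertex :: "nat \<Rightarrow> nat \<Rightarrow> real" where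
  "vertex n = (\<lambda>k. if k = n then 1 else 0)"

lemma vertex_simplex: "vertex n \<in> standard_simplex n"
  by (simp add: vertex_def)

lemma continuous_map_fat_class:
  assumes "continuous_map Z (simplex_top p) f" "continuous_map Z (Y p) g"
  shows "continuous_map Z (fat_realization Y \<delta>) (\<lambda>z. fat_class Y \<delta> (p, f z, g z))"
proof -
  have "continuous_map Z (fat_sum Y) (\<lambda>z. (p, f z, g z))"
    unfolding fat_sum_def
    using continuous_map_compose[OF _ continuous_map_component_injection[of p UNIV "\<lambda>p. prod_topology (simplex_top p) (Y p)"],
        of Z "\<lambda>z. (f z, g z)"] assms
    by (simp add: o_def continuous_map_paired)
  then show ?thesis
    using continuous_map_compose[OF _ quotient_imp_continuous_map[OF quotient_map_fat_class]]
    by (force simp: o_def)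
qed

lemma continuous_map_sum_topology:
  assumes "\<And>i. i \<in> I \<Longrightarrow> continuous_map (X i) Z (\<lambda>y. f (i, y))"
  shows "continuous_map (sum_topology X I) Z f"
  unfolding continuous_map_def
proof (intro conjI allI impI)
  show "f \<in> topspace (sum_topology X I) \<rightarrow> topspace Z"
    using assms by (auto simp: continuous_map_def Pi_iff)
  fix U assume "openin Z U"
  then have "openin (X i) {y \<in> topspace (X i). f (i, y) \<in> U}" if "i \<in> I" for i
    using assms[OF that] by (rule openin_continuous_map_preimage[rotated])
  then show "openin (sum_topology X I) {x \<in> topspace (sum_topology X I). f x \<in> U}"
    unfolding openin_sum_topology by (auto simp: conj_commute)
qed

text \<open>The section \<open>?g\<close> places \<open>y\<close> over the 0-simplex. Since the face
  maps are identities, coning leaves \<open>y\<close> alone, is compatible with the relation, and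
  deforms the identity into \<open>?g \<circ> fat_proj2\<close>.\<close>

lemma const_fat_homotopy_equivalence:
  fixes Y :: "'b topology"
  defines "F \<equiv> fat_realization (\<lambda>_. Y) (\<lambda>_ _. id)"
  shows "homotopy_equivalence F Y fat_proj2"
proof -
  let ?cl = "fat_class (\<lambda>_. Y) (\<lambda>_ _. id)" and ?S = "fat_sum (\<lambda>_. Y)"
  let ?g = "\<lambda>y. ?cl (0, vertex 0, y)"
  have q: "quotient_map ?S F ?cl" unfolding F_def by (rule quotient_map_fat_class)
  have face: "?cl (Suc p, simplical_face i t, y) = ?cl (p, t, y)"
    if "i \<le> Suc p" "t \<in> standard_simplex p" "y \<in> topspace Y" for p i t y
    using fat_class_face[of i p t y "\<lambda>_. Y" "\<lambda>_ _. id"] that by simp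
  have pr: "fat_proj2 (?cl (p, t, y)) = y" if "t \<in> standard_simplex p" "y \<in> topspace Y" for p t y
  proof -
    have "fat_proj2 (?cl (p, t, y)) = (\<lambda>(p, t, y). y) (p, t, y)"
      unfolding fat_proj2_def fat_class_def
      by (rule induced_quotient_class) (use that in \<open>auto simp: fat_rel_def\<close>)
    then show ?thesis by simp
  qed
  have contp: "continuous_map F Y fat_proj2"
  proof (rule continuous_compose_quotient_map[OF q])
    have "continuous_map ?S Y (\<lambda>(p, t, y). y)"
      unfolding fat_sum_def
      by (rule continuous_map_sum_topology) (simp add: case_prod_unfold continuous_map_snd)
    then show "continuous_map ?S Y (fat_proj2 \<circ> ?cl)"
      by (rule continuous_map_eq) (auto simp: pr)
  qed
  have contg: "continuous_map Y F ?g"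
    unfolding F_def by (rule continuous_map_fat_class) (auto simp: vertex_simplex)
  let ?h = "\<lambda>(u, C). induced (\<lambda>(p, t, y). ?cl (Suc p, cone_coords p u t, y)) C"
  have h: "?h (u, ?cl (p, t, y)) = ?cl (Suc p, cone_coords p u t, y)"
    if "0 \<le> u" "u \<le> 1" "t \<in> standard_simplex p" "y \<in> topspace Y" for u p t y
  proof -
    have "induced (\<lambda>(p, t, y). ?cl (Suc p, cone_coords p u t, y))
        (quotient_class ?S (fat_rel (\<lambda>_. Y) (\<lambda>_ _. id)) (p, t, y)) =
        (\<lambda>(p, t, y). ?cl (Suc p, cone_coords p u t, y)) (p, t, y)"
    proof (rule induced_quotient_class)
      fix v w assume "(v, w) \<in> fat_rel (\<lambda>_. Y) (\<lambda>_ _. id)"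
      then obtain p i t y where vw: "v = (Suc p, simplical_face i t, y)" "w = (p, t, y)"
        "i \<le> Suc p" "t \<in> standard_simplex p" "y \<in> topspace Y"
        unfolding fat_rel_def by auto
      then show "(\<lambda>(p, t, y). ?cl (Suc p, cone_coords p u t, y)) v = (\<lambda>(p, t, y). ?cl (Suc p, cone_coords p u t, y)) w"
        using face[of i "Suc p" "cone_coords p u t" y] cone_coords_simplex[OF that(1,2) vw(4)]
        by (simp add: cone_coords_simplical_face)
    qed (use that in auto)
    then show ?thesis by (simp add: fat_class_def)
  qed
  have conth: "continuous_map (prod_topology unit_interval F) F ?h"
  proof (rule continuous_compose_quotient_map)
    show "quotient_map (prod_topology unit_interval ?S) (prod_topology unit_interval F) (\<lambda>(u, x). (u, ?cl x))"
      by (intro quotient_map_prod_compact_Hausdorff compact_space_unit_interval Hausdorff_space_unit_interval q)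
    have "continuous_map (prod_topology unit_interval ?S) F (\<lambda>(u, p, t, y). ?cl (Suc p, cone_coords p u t, y))"
      unfolding fat_sum_def
    proof (rule continuous_map_prod_sum_topology)
      fix p
      let ?Z = "prod_topology unit_interval (prod_topology (simplex_top p) Y)"
      have u: "continuous_map ?Z euclideanreal (\<lambda>z. fst z)"
        using continuous_map_fst[of unit_interval] continuous_map_into_fulltopology by blast
      have t: "continuous_map ?Z euclideanreal (\<lambda>z. fst (snd z) k)" for k
        using continuous_map_compose[OF continuous_map_compose[OF continuous_map_snd continuous_map_fst]
          continuous_map_simplex_coord] by (force simp: o_def)
      have "continuous_map ?Z (simplex_top (Suc p)) (\<lambda>z. cone_coords p (fst z) (fst (snd z)))"
      proof (rule continuous_map_simplex_top)
        show "continuous_map ?Z euclideanreal (\<lambda>z. cone_coords p (fst z) (fst (snd z)) k)" for k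
          unfolding cone_coords_def using u t
          by (cases "k = Suc p") (simp_all add: continuous_map_add continuous_map_real_mult continuous_map_diff)
      qed (auto intro: cone_coords_simplex)
      moreover have "continuous_map ?Z Y (\<lambda>z. snd (snd z))"
        using continuous_map_compose[OF continuous_map_snd continuous_map_snd] by (force simp: o_def)
      ultimately show "continuous_map ?Z F (\<lambda>(u, y). case (u, p, y) of (u, p, t, y) \<Rightarrow> ?cl (Suc p, cone_coords p u t, y))"
        unfolding F_def using continuous_map_fat_class[of ?Z "Suc p" _ "\<lambda>_. Y"] by (simp add: case_prod_unfold)
    qed
    then show "continuous_map (prod_topology unit_interval ?S) F (?h \<circ> (\<lambda>(u, x). (u, ?cl x)))"
    proof (rule continuous_map_eq)
      fix z assume "z \<in> topspace (prod_topology unit_interval ?S)"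
      then obtain u p t y where "z = (u, p, t, y)" "0 \<le> u" "u \<le> 1" "t \<in> standard_simplex p" "y \<in> topspace Y"
        by (cases z) auto
      then show "(\<lambda>(u, p, t, y). ?cl (Suc p, cone_coords p u t, y)) z = (?h \<circ> (\<lambda>(u, x). (u, ?cl x))) z"
        using h by simp
    qed
  qed
  \<comment> \<open>The last vertex of each simplex is the coface 0 of the last vertex of the
    preceding one, so the cone points for different \<open>p\<close> all represent the same point
    over \<open>y\<close>.\<close>
  have v: "?cl (n, vertex n, y) = ?g y" if "y \<in> topspace Y" for n y
  proof (induction n)
    case (Suc n)
    have "vertex (Suc n) = simplical_face 0 (vertex n)"
      by (auto simp: vertex_def simplical_face_def fun_eq_iff)
    then have "?cl (Suc n, vertex (Suc n), y) = ?cl (n, vertex n, y)"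
      using face[OF _ vertex_simplex that, of 0 n] by (metis zero_le)
    then show ?case using Suc by (rule trans)
  qed simp
  have ends: "?h (0, C) = C \<and> ?h (1, C) = ?g (fat_proj2 C)" if "C \<in> topspace F" for C
  proof -
    obtain p t y where C: "C = ?cl (p, t, y)" "t \<in> standard_simplex p" "y \<in> topspace Y"
      using \<open>C \<in> topspace F\<close> unfolding F_def topspace_fat_realization by auto
    \<comment> \<open>At time 1 only the cone vertex is left; at time 0 the point lies in the
      opposite face, and the relation returns the original class.\<close>
    have "cone_coords p 1 t = vertex (Suc p)" by (auto simp: cone_coords_def vertex_def)
    then show ?thesis
      using h[of 0 t p y] h[of 1 t p y] C face[of "Suc p" p t y] v[of y "Suc p"] pr[of t p y] by (simp add: cone_coords_0)
  qed
  have "homotopic_with (\<lambda>_. True) F F id (?g \<circ> fat_proj2)"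
  proof (subst homotopic_with)
    show "\<exists>h. continuous_map (prod_topology unit_interval F) F h \<and> (\<forall>x\<in>topspace F. h (0, x) = id x) \<and>
        (\<forall>x\<in>topspace F. h (1, x) = (?g \<circ> fat_proj2) x) \<and> (\<forall>t\<in>{0..1}. True)"
      by (intro exI[of _ ?h] conjI conth ballI TrueI) (use ends in simp_all)
  qed simp
  then have "homotopic_with (\<lambda>_. True) F F (?g \<circ> fat_proj2) id"
    by (rule homotopic_with_symD)
  moreover have "homotopic_with (\<lambda>_. True) Y Y (fat_proj2 \<circ> ?g) id"
    by (rule homotopic_with_equal) (use continuous_map_compose[OF contg contp] pr vertex_simplex in auto)
  ultimately show ?thesis
    unfolding homotopy_equivalence_def using contp contg by blast
qed

section \<open>Assembling the equivalence\<close>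

lemma homotopy_equivalence_compose_homeomorphic:
  assumes f: "homeomorphic_map X Y f" and g: "homotopy_equivalence Y Z g"
  shows "homotopy_equivalence X Z (g \<circ> f)"
proof -
  obtain f' where f': "homeomorphic_maps X Y f f'" using f homeomorphic_map_maps by blast
  then have cf: "continuous_map X Y f" "continuous_map Y X f'"
    and inv: "\<And>x. x \<in> topspace X \<Longrightarrow> f' (f x) = x" "\<And>y. y \<in> topspace Y \<Longrightarrow> f (f' y) = y"
    by (auto simp: homeomorphic_maps_def)
  obtain g' where cg: "continuous_map Y Z g" "continuous_map Z Y g'"
    and h: "homotopic_with (\<lambda>_. True) Y Y (g' \<circ> g) id" "homotopic_with (\<lambda>_. True) Z Z (g \<circ> g') id"
    using g unfolding homotopy_equivalence_def by blast
  have "homotopic_with (\<lambda>_. True) X X (f' \<circ> ((g' \<circ> g) \<circ> f)) (f' \<circ> (id \<circ> f))"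
    by (rule homotopic_with_compose_continuous_map_left[OF
        homotopic_with_compose_continuous_map_right[OF h(1) cf(1)] cf(2)]) auto
  then have "homotopic_with (\<lambda>_. True) X X ((f' \<circ> g') \<circ> (g \<circ> f)) id"
    by (rule homotopic_with_eq) (use inv in auto)
  moreover have "homotopic_with (\<lambda>_. True) Z Z ((g \<circ> f) \<circ> (f' \<circ> g')) id"
  proof (rule homotopic_with_eq[OF h(2)])
    fix z assume "z \<in> topspace Z"
    then have "g' z \<in> topspace Y" using cg(2) by (auto simp: continuous_map_def)
    then show "((g \<circ> f) \<circ> (f' \<circ> g')) z = (g \<circ> g') z" using inv by simp
  qed auto
  ultimately show ?thesis
    unfolding homotopy_equivalence_def
    using continuous_map_compose[OF cf(1) cg(1)] continuous_map_compose[OF cg(2) cf(2)] by blast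
qed

lemma standard_simplex_interior_exists: "\<exists>t\<in>standard_simplex p. \<forall>i\<le>p. 0 < t i"
proof
  show "(\<lambda>i. if i \<le> p then 1 / real (Suc p) else 0) \<in> standard_simplex p"
    by (rule standard_simplexI) auto
qed auto

text \<open>That \<open>d\<^sub>(\<^sub>i\<^sub>)\<close> respects the relations of \<open>|P\<^bsub>p+1\<^esub>X|\<close> follows, without any simplicial identities for iterated
  faces, from the injectivity of \<open>\<lambda>\<^sub>p(t, -)\<close>.\<close>

lemma prism_space_face_class:
  assumes X: "simplicial_set X" and u: "(q, s, x) \<in> topspace (mrealization_sum (Suc p) (prismatic X))" and i: "i \<le> Suc p"
  shows "prism_space_face X (Suc p) i (mrealization_class (Suc p) (prismatic X) (q, s, x)) =
    mrealization_class p (prismatic X) (delete_nth i q, proj_delete i s,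
      face_block X (prism_dim q) (prism_offset q i) (Suc (q ! i)) x)"
proof -
  let ?d = "\<lambda>(q, s, x). (delete_nth i q, proj_delete i s, face_block X (prism_dim q) (prism_offset q i) (Suc (q ! i)) x)"
  let ?f = "\<lambda>(q, s, x). mrealization_class (Suc p - 1) (prismatic X)
         (delete_nth i q, proj_delete i s, face_block X (prism_dim q) (prism_offset q i) (Suc (q ! i)) x)"
  \<comment> \<open>Any interior \<open>t\<close> will do: \<open>prism_lambda X t\<close> is then
    injective and can test equality of classes.\<close>
  obtain t where t: "t \<in> standard_simplex p" "\<forall>i\<le>p. 0 < t i" using standard_simplex_interior_exists by blast
  have d: "?d u \<in> topspace (mrealization_sum p (prismatic X)) \<and>
      prism_lambda X t (?f u) = prism_lambda X (simplical_face i t) (mrealization_class (Suc p) (prismatic X) u)"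
    if "u \<in> topspace (mrealization_sum (Suc p) (prismatic X))" for u
  proof -
    obtain q s x where u: "u = (q, s, x)" by (cases u) auto
    then have q: "length q = Suc (Suc p)" "s \<in> topspace (multi_simplex_top q)" "x \<in> simplices X (prism_dim q)"
      using that unfolding u mem_prismatic_sum by blast+
    note del = prism_delete_class[OF X q(1) i t(1) q(2,3)]
    have "simplical_face i t \<in> standard_simplex (Suc p)" by (rule simplical_face_standard_simplex[OF i t(1)])
    then show ?thesis
      using prism_lambda_class[OF X t(1) del(1)] prism_lambda_class[OF X _ that[unfolded u]] del u
      by (simp del: mem_prismatic_sum)
  qed
  have "?f u = ?f v" if uv: "u \<in> topspace (mrealization_sum (Suc p) (prismatic X))"
    "v \<in> topspace (mrealization_sum (Suc p) (prismatic X))" and r: "(u, v) \<in> mrealization_rel (Suc p) (prismatic X)" for u v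
  proof -
    \<comment> \<open>Both sides are values of \<lambda> over the boundary point
      \<open>simplical_face i t\<close>, which depend only on the common class of \<open>u\<close>
      and \<open>v\<close>.\<close>
    have "prism_lambda X t (?f u) = prism_lambda X t (?f v)"
      using d[OF uv(1)] d[OF uv(2)] mrealization_class_eq[OF r uv] by simp
    moreover have "?f u \<in> topspace (prism_space X p)" "?f v \<in> topspace (prism_space X p)"
      using d[OF uv(1)] d[OF uv(2)] unfolding topspace_prism_space
      by (auto simp: case_prod_unfold simp del: mem_prismatic_sum)
    ultimately show ?thesis
      using prism_lambda_inj[OF X t(1)] t(2) unfolding inj_on_def by blast
  qed
  from induced_quotient_class[OF u this] show ?thesis
    unfolding prism_space_face_def mrealization_class_def[of "Suc p"] by simp
qed

lemma prism_space_face_props: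
  assumes X: "simplicial_set X" and y: "y \<in> topspace (prism_space X (Suc p))" and i: "i \<le> Suc p"
  shows "prism_space_face X (Suc p) i y \<in> topspace (prism_space X p)"
    and "t \<in> standard_simplex p \<Longrightarrow>
      prism_lambda X (simplical_face i t) y = prism_lambda X t (prism_space_face X (Suc p) i y)"
proof -
  obtain q s x where u: "y = mrealization_class (Suc p) (prismatic X) (q, s, x)"
    "(q, s, x) \<in> topspace (mrealization_sum (Suc p) (prismatic X))"
    using y unfolding topspace_prism_space by auto
  then have q: "length q = Suc (Suc p)" "s \<in> topspace (multi_simplex_top q)" "x \<in> simplices X (prism_dim q)"
    unfolding mem_prismatic_sum by blast+
  note f = prism_space_face_class[OF X u(2) i]
  obtain t0 where "t0 \<in> standard_simplex p" using nonempty_standard_simplex by blast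
  then show "prism_space_face X (Suc p) i y \<in> topspace (prism_space X p)"
    unfolding u f topspace_prism_space
    using prism_delete_class(1)[OF X q(1) i _ q(2,3)] by blast
  show "prism_lambda X (simplical_face i t) y = prism_lambda X t (prism_space_face X (Suc p) i y)"
    if t: "t \<in> standard_simplex p"
    using prism_delete_class[OF X q(1) i t q(2,3)] prism_lambda_class[OF X t]
      prism_lambda_class[OF X simplical_face_standard_simplex[OF i t] u(2)]
    unfolding u f by (simp del: mem_prismatic_sum)
qed

lemma prism_lambda_topspace:
  assumes "simplicial_set X" "t \<in> standard_simplex p" "y \<in> topspace (prism_space X p)"
  shows "prism_lambda X t y \<in> topspace (realization X)"
  using continuous_map_image_subset_topspace[OF continuous_map_prism_lambda[OF assms(1), of p]] assms by force

text \<open>In the target the relation only forgets cofaces, so well-definedness amounts to the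
  exchange of the coface with the block deletion under \<open>prism_lambda\<close>.\<close>

lemma prism_Lambda_class:
  assumes X: "simplicial_set X" and t: "t \<in> standard_simplex p" and y: "y \<in> topspace (prism_space X p)"
  shows "prism_Lambda X (fat_class (prism_space X) (prism_space_face X) (p, t, y)) =
    fat_class (\<lambda>_. realization X) (\<lambda>_ _. id) (p, t, prism_lambda X t y)"
proof -
  let ?f = "\<lambda>(p, t, c). fat_class (\<lambda>_. realization X) (\<lambda>_ _. id) (p, t, prism_lambda X t c)"
  have "prism_Lambda X (fat_class (prism_space X) (prism_space_face X) (p, t, y)) = ?f (p, t, y)"
    unfolding prism_Lambda_def fat_class_def[of "prism_space X"]
  proof (rule induced_quotient_class)
    fix u v assume "(u, v) \<in> fat_rel (prism_space X) (prism_space_face X)"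
    then obtain p i t y where uv: "u = (Suc p, simplical_face i t, y)" "v = (p, t, prism_space_face X (Suc p) i y)"
      "i \<le> Suc p" "t \<in> standard_simplex p" "y \<in> topspace (prism_space X (Suc p))"
      unfolding fat_rel_def by auto
    have "prism_lambda X (simplical_face i t) y \<in> topspace (realization X)"
      by (rule prism_lambda_topspace[OF X simplical_face_standard_simplex[OF uv(3,4)] uv(5)])
    then show "?f u = ?f v"
      using fat_class_face[OF uv(3,4), of "prism_lambda X (simplical_face i t) y" "\<lambda>_. realization X" "\<lambda>_ _. id"]
        prism_space_face_props(2)[OF X uv(5,3,4)] uv by simp
  qed (use t y in simp)
  then show ?thesis by simp
qed

lemma prism_Lambda_homeomorphic:
  assumes X: "simplicial_set X"
  shows "homeomorphic_map (fat_prism X) (fat_realization (\<lambda>_. realization X) (\<lambda>_ _. id)) (prism_Lambda X)"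
proof -
  let ?P = "prism_space X" and ?clP = "fat_class (prism_space X) (prism_space_face X)"
  let ?clR = "fat_class (\<lambda>_. realization X) (\<lambda>_ _. id)" and ?F = "fat_realization (\<lambda>_. realization X) (\<lambda>_ _. id)"
  have "quotient_map (fat_sum ?P) (fat_sum (\<lambda>_. realization X)) (\<lambda>(p, z). (p, (\<lambda>(t, y). (t, prism_lambda X t y)) z))"
    unfolding fat_sum_def by (rule quotient_map_sum_topology) (rule prism_lambda_quotient[OF X])
  then have "quotient_map (fat_sum ?P) ?F (?clR \<circ> (\<lambda>(p, z). (p, (\<lambda>(t, y). (t, prism_lambda X t y)) z)))"
    by (rule quotient_map_compose) (rule quotient_map_fat_class)
  \<comment> \<open>The quotient property is known before passing to classes; precomposition with
    the quotient map \<open>?clP\<close> does not change it.\<close>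
  then have "quotient_map (fat_sum ?P) ?F (prism_Lambda X \<circ> ?clP)"
    by (rule quotient_map_eq) (auto simp: prism_Lambda_class[OF X])
  then have q: "quotient_map (fat_prism X) ?F (prism_Lambda X)"
    unfolding fat_prism_def using quotient_map_compose_eq[OF quotient_map_fat_class] by blast
  have "inj_on (prism_Lambda X) (topspace (fat_prism X))"
  proof (rule inj_onI)
    fix C C' assume C: "C \<in> topspace (fat_prism X)" "C' \<in> topspace (fat_prism X)"
      and eq: "prism_Lambda X C = prism_Lambda X C'"
    have int: "\<exists>p t y. t \<in> standard_simplex p \<and> (\<forall>i\<le>p. 0 < t i) \<and> y \<in> topspace (?P p) \<and> C = ?clP (p, t, y)"
      if "C \<in> topspace (fat_prism X)" for C
    proof -
      obtain p t y where "C = ?clP (p, t, y)" "t \<in> standard_simplex p" "y \<in> topspace (?P p)"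
        using \<open>C \<in> topspace (fat_prism X)\<close> unfolding fat_prism_def topspace_fat_realization by auto
      then show ?thesis
        using fat_class_interior[of ?P "prism_space_face X" t p y] prism_space_face_props(1)[OF X] by metis
    qed
    obtain p t y where 1: "t \<in> standard_simplex p" "\<forall>i\<le>p. 0 < t i" "y \<in> topspace (?P p)" "C = ?clP (p, t, y)"
      using int[OF C(1)] by blast
    obtain p' t' y' where 2: "t' \<in> standard_simplex p'" "\<forall>i\<le>p'. 0 < t' i" "y' \<in> topspace (?P p')" "C' = ?clP (p', t', y')"
      using int[OF C(2)] by blast
    have "?clR (p, t, prism_lambda X t y) = ?clR (p', t', prism_lambda X t' y')"
      using eq prism_Lambda_class[OF X 1(1,3)] prism_Lambda_class[OF X 2(1,3)] 1(4) 2(4) by simp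
    \<comment> \<open>Interior representatives in the target determine \<open>p\<close> and
      \<open>t\<close>, so both points lie over the same interior \<open>t\<close>, where
      \<open>prism_lambda X t\<close> is injective.\<close>
    then have "p = p' \<and> t = t' \<and> prism_lambda X t y = prism_lambda X t' y'"
      by (rule const_fat_class_interior_eq[OF _ 1(1,2) 2(1,2)])
        (use prism_lambda_topspace[OF X] 1 2 in auto)
    moreover from this have "y = y'"
      using prism_lambda_inj[OF X 1(1)] 1 2 unfolding inj_on_def by blast
    ultimately show "C = C'" using 1(4) 2(4) by simp
  qed
  then show ?thesis using q by (simp add: homeomorphic_map_def)
qed

theorem corollary3p6:
  fixes S :: "'a sset"
  assumes "simplicial_set S"
  shows "homotopy_equivalence (fat_prism S) (realization S) (fat_proj2 \<circ> prism_Lambda S)"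
  using prism_Lambda_homeomorphic[OF assms] const_fat_homotopy_equivalence
  by (rule homotopy_equivalence_compose_homeomorphic)

end
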